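(* Let $(E,g)\to(M,I)$ be a real vector bundle of rank $2n$ over a complex manifold, equipped with a positive definite fiberwise metric $g$, a metric connection $\nabla$ with $(1,1)$ curvature, and a section $J$ of $\mathcal{T}(E,g)$ with $\nabla J=0$. Let $\mathcal{T}^{\#}(J)$ be any of $\mathcal{T}^{(m_1,* )}(J)$, $\mathcal{T}^{( *,m_{-1})}(J)$, $\mathcal{T}^{(m_1,m_{-1})}(J)$. Then for every $K\in\mathcal{T}^{\#}(J)$, $$T_{K}\mathcal{T}^{\#}(J)= V_{K}\mathcal{T}^{\#}(J) \oplus H_{K}^{\nabla}\mathcal{T}.$$
   Context: $\mathcal{T}=\mathcal{T}(E,g)=\{j\in \operatorname{End}E \mid j^2=-1,\ g(j\cdot,j\cdot)=g(\cdot,\cdot)\}$ with projection $\pi:\mathcal{T}\to M$. $(1,1)$ curvature means $R^{\nabla}(Iu,Iv)=R^{\nabla}(u,v)$ for all $u,v$. The connection $\nabla$ splits $T\mathcal{T}=V\mathcal{T}\oplus H^\nabla\mathcal{T}$, where $V_K\mathcal{T}=T_K\mathcal{T}(E_{\pi(K)},g)=\{A\in\mathfrak{o}(E_{\pi(K)},g)\mid AK+KA=0\}$ is the vertical space and $H^\nabla_K\mathcal{T}$ is the set of all $\frac{dK(t)}{dt}|_{t=0}$ where $K(t)$ is the $\nabla$-parallel translate of $K=K(0)$ along a curve in $M$. For $K\in\mathcal{T}$ write $J$ for $J_{\pi(K)}$. Define $\mathcal{T}^{(m_1,* )}(J)=\{K\mid \dim\operatorname{Ker}(J+K)=2m_1\}$,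 $\mathcal{T}^{( *,m_{-1})}(J)=\{K\mid \dim\operatorname{Ker}(J-K)=2m_{-1}\}$, and $\mathcal{T}^{(m_1,m_{-1})}(J)=\mathcal{T}^{(m_1,* )}(J)\cap\mathcal{T}^{( *,m_{-1})}(J)$; these are submanifolds of $\mathcal{T}$. $V_K\mathcal{T}^{\#}(J)$ denotes the tangent space at $K$ of the fibre $\mathcal{T}^{\#}(J)\cap\mathcal{T}(E_{\pi(K)},g)$. *)

theory Defs
  imports "HOL-Analysis.Analysis"
begin

section \<open>Smooth maps between Euclidean spaces\<close>

primrec Ck_on :: "nat \<Rightarrow> 'a set \<Rightarrow> ('a::euclidean_space \<Rightarrow> 'b::real_normed_vector) \<Rightarrow> bool" where
  "Ck_on 0 W f \<longleftrightarrow> continuous_on W f"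
| "Ck_on (Suc k) W f \<longleftrightarrow>
     (\<forall>x\<in>W. f differentiable (at x)) \<and> (\<forall>v. Ck_on k W (\<lambda>x. frechet_derivative f (at x) v))"

text \<open>Only used for open \<open>W\<close>.\<close>

definition smooth_on :: "'a set \<Rightarrow> ('a::euclidean_space \<Rightarrow> 'b::real_normed_vector) \<Rightarrow> bool" where
  "smooth_on W f \<longleftrightarrow> (\<forall>k. Ck_on k W f)"

definition holomorphic_map_on :: "(complex^'d) set \<Rightarrow> (complex^'d \<Rightarrow> complex^'d) \<Rightarrow> bool" where
  "holomorphic_map_on W f \<longleftrightarrow> smooth_on W f \<and>
     (\<forall>x\<in>W. \<forall>v. frechet_derivative f (at x) (\<i> *s v) = \<i> *s frechet_derivative f (at x) v)"


section \<open>Manifolds given by an atlas\<close>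

type_synonym ('x, 'a) atlas = "('x set \<times> ('x \<Rightarrow> 'a)) set"

text \<open>Tangent vectors are derivations on germs of smooth real functions. A tangent vector at
  \<open>p\<close> is normalised to vanish on functions that are not smooth near \<open>p\<close>.\<close>

type_synonym 'x tvec = "('x \<Rightarrow> real) \<Rightarrow> real"

definition smooth_at :: "('x, 'a::euclidean_space) atlas \<Rightarrow> ('x \<Rightarrow> 'b::real_normed_vector) \<Rightarrow> 'x \<Rightarrow> bool" where
  "smooth_at \<A> f p \<longleftrightarrow> (\<exists>(U, \<phi>)\<in>\<A>. p \<in> U \<and>
     (\<exists>W. open W \<and> \<phi> p \<in> W \<and> W \<subseteq> \<phi> ` U \<and> smooth_on W (f \<circ> inv_into U \<phi>)))"

definition smooth_curve :: "('x, 'a::euclidean_space) atlas \<Rightarrow> real set \<Rightarrow> (real \<Rightarrow> 'x) \<Rightarrow> bool" where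
  "smooth_curve \<A> T c \<longleftrightarrow> (\<forall>t\<in>T. \<exists>(U, \<phi>)\<in>\<A>. \<exists>\<delta>>0. {t-\<delta><..<t+\<delta>} \<subseteq> T \<and>
     c ` {t-\<delta><..<t+\<delta>} \<subseteq> U \<and> smooth_on {t-\<delta><..<t+\<delta>} (\<phi> \<circ> c))"

definition velocity :: "('x, 'a::euclidean_space) atlas \<Rightarrow> (real \<Rightarrow> 'x) \<Rightarrow> real \<Rightarrow> 'x tvec" where
  "velocity \<A> c t = (\<lambda>f. if smooth_at \<A> f (c t) then deriv (\<lambda>u. f (c u)) t else 0)"

text \<open>The tangent space at \<open>p\<close> of a submanifold \<open>S\<close>, as a set of tangent vectors of the ambient
  manifold: the velocities of the smooth curves of the ambient manifold that run inside \<open>S\<close>.\<close>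

definition tangent_space :: "('x, 'a::euclidean_space) atlas \<Rightarrow> 'x set \<Rightarrow> 'x \<Rightarrow> 'x tvec set" where
  "tangent_space \<A> S p = {velocity \<A> c 0 | c \<epsilon>. \<epsilon> > 0 \<and> smooth_curve \<A> {-\<epsilon><..<\<epsilon>} c \<and>
     c 0 = p \<and> c ` {-\<epsilon><..<\<epsilon>} \<subseteq> S}"

definition tvec_subspace :: "'x tvec set \<Rightarrow> bool" where
  "tvec_subspace V \<longleftrightarrow> (\<lambda>f. 0) \<in> V \<and>
     (\<forall>X\<in>V. \<forall>Y\<in>V. \<forall>a b. (\<lambda>f. a * X f + b * Y f) \<in> V)"

definition is_direct_sum :: "'x tvec set \<Rightarrow> 'x tvec set \<Rightarrow> 'x tvec set \<Rightarrow> bool" where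
  "is_direct_sum T V H \<longleftrightarrow> tvec_subspace V \<and> tvec_subspace H \<and> V \<inter> H = {\<lambda>f. 0} \<and>
     T = {\<lambda>f. X f + Y f | X Y. X \<in> V \<and> Y \<in> H}"

definition vector_field :: "('m, 'a::euclidean_space) atlas \<Rightarrow> 'm set \<Rightarrow> ('m \<Rightarrow> 'm tvec) \<Rightarrow> bool" where
  "vector_field \<A> W X \<longleftrightarrow> (\<forall>p\<in>W. X p \<in> tangent_space \<A> UNIV p \<and>
     (\<forall>f. smooth_at \<A> f p \<longrightarrow> smooth_at \<A> (\<lambda>q. X q f) p))"

definition lie_bracket ::
    "('m, 'a::euclidean_space) atlas \<Rightarrow> ('m \<Rightarrow> 'm tvec) \<Rightarrow> ('m \<Rightarrow> 'm tvec) \<Rightarrow> 'm \<Rightarrow> 'm tvec" where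
  "lie_bracket \<A> X Y p = (\<lambda>f. if smooth_at \<A> f p
     then X p (\<lambda>q. Y q f) - Y p (\<lambda>q. X q f) else 0)"


section \<open>Complex manifolds\<close>

definition complex_manifold ::
    "('m::{t2_space, second_countable_topology}, complex^'d) atlas \<Rightarrow> bool" where
  "complex_manifold \<A> \<longleftrightarrow> (\<Union>(U, \<phi>)\<in>\<A>. U) = UNIV \<and>
     (\<forall>(U, \<phi>)\<in>\<A>. open U \<and> open (\<phi> ` U) \<and> homeomorphism U (\<phi> ` U) \<phi> (inv_into U \<phi>)) \<and>
     (\<forall>(U, \<phi>)\<in>\<A>. \<forall>(V, \<psi>)\<in>\<A>. holomorphic_map_on (\<phi> ` (U \<inter> V)) (\<psi> \<circ> inv_into U \<phi>))"

definition tvec_coords :: "('m \<Rightarrow> 'a::euclidean_space) \<Rightarrow> 'm tvec \<Rightarrow> 'a" where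
  "tvec_coords \<phi> X = (\<Sum>b\<in>Basis. X (\<lambda>q. \<phi> q \<bullet> b) *\<^sub>R b)"

text \<open>The complex structure \<open>I\<close> on the real tangent spaces: \<open>d\<phi>(I X) = \<i> d\<phi>(X)\<close> for every
  holomorphic chart \<open>\<phi>\<close>.\<close>

definition cplx_structure :: "('m, complex^'d) atlas \<Rightarrow> 'm \<Rightarrow> 'm tvec \<Rightarrow> 'm tvec" where
  "cplx_structure \<A> p X = (THE Z. Z \<in> tangent_space \<A> UNIV p \<and>
     (\<forall>(U, \<phi>)\<in>\<A>. p \<in> U \<longrightarrow> tvec_coords \<phi> Z = \<i> *s tvec_coords \<phi> X))"


section \<open>Vector bundles\<close>

text \<open>The fibres are linear subspaces \<open>E p\<close> of a real vector space that carries no topology. This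
  is no restriction (take the direct sum of all fibres); the fibres over different points may
  intersect, so points of total spaces are pairs consisting of a base point and a fibre element.
  The smooth structure comes only from the local trivialisations \<open>(U, \<Phi>)\<close>.\<close>

type_synonym ('m, 'v, 'k) trivs = "('m set \<times> ('m \<Rightarrow> 'v \<Rightarrow> real^'k)) set"

definition linear_on_set :: "'v::real_vector set \<Rightarrow> ('v \<Rightarrow> 'w::real_vector) \<Rightarrow> bool" where
  "linear_on_set F A \<longleftrightarrow> (\<forall>v\<in>F. \<forall>w\<in>F. A (v + w) = A v + A w) \<and>
     (\<forall>c. \<forall>v\<in>F. A (c *\<^sub>R v) = c *\<^sub>R A v)"

definition vector_bundle ::
    "('m::topological_space, 'a::euclidean_space) atlas \<Rightarrow> ('m \<Rightarrow> 'v::real_vector set) \<Rightarrow>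
     ('m, 'v, 'k::finite) trivs \<Rightarrow> bool" where
  "vector_bundle \<A> E \<B> \<longleftrightarrow> (\<forall>p. subspace (E p)) \<and> (\<Union>(U, \<Phi>)\<in>\<B>. U) = UNIV \<and>
     (\<forall>(U, \<Phi>)\<in>\<B>. open U \<and>
        (\<forall>p\<in>U. linear_on_set (E p) (\<Phi> p) \<and> bij_betw (\<Phi> p) (E p) UNIV)) \<and>
     (\<forall>(U, \<Phi>)\<in>\<B>. \<forall>(V, \<Psi>)\<in>\<B>. \<forall>p\<in>U \<inter> V.
        smooth_at \<A> (\<lambda>q. matrix (\<Psi> q \<circ> inv_into (E q) (\<Phi> q))) p)"

definition sections ::
    "('m, 'a::euclidean_space) atlas \<Rightarrow> ('m \<Rightarrow> 'v set) \<Rightarrow> ('m, 'v, 'k::finite) trivs \<Rightarrow>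
     'm set \<Rightarrow> ('m \<Rightarrow> 'v) set" where
  "sections \<A> E \<B> W = {s. (\<forall>p\<in>W. s p \<in> E p) \<and>
     (\<forall>(U, \<Phi>)\<in>\<B>. \<forall>p\<in>W \<inter> U. smooth_at \<A> (\<lambda>q. \<Phi> q (s q)) p)}"

definition bundle_metric ::
    "('m::topological_space, 'a::euclidean_space) atlas \<Rightarrow> ('m \<Rightarrow> 'v::real_vector set) \<Rightarrow>
     ('m, 'v, 'k::finite) trivs \<Rightarrow> ('m \<Rightarrow> 'v \<Rightarrow> 'v \<Rightarrow> real) \<Rightarrow> bool" where
  "bundle_metric \<A> E \<B> g \<longleftrightarrow>
     (\<forall>p. \<forall>v\<in>E p. linear_on_set (E p) (g p v) \<and> (\<forall>w\<in>E p. g p v w = g p w v) \<and>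
        (v \<noteq> 0 \<longrightarrow> g p v v > 0)) \<and>
     (\<forall>W. open W \<longrightarrow> (\<forall>s\<in>sections \<A> E \<B> W. \<forall>s'\<in>sections \<A> E \<B> W.
        \<forall>p\<in>W. smooth_at \<A> (\<lambda>q. g q (s q) (s' q)) p))"

text \<open>Endomorphisms of a fibre are extended by zero outside the fibre.\<close>

definition End_fibre :: "'v::real_vector set \<Rightarrow> ('v \<Rightarrow> 'v) set" where
  "End_fibre F = {A. linear_on_set F A \<and> A ` F \<subseteq> F \<and> (\<forall>v. v \<notin> F \<longrightarrow> A v = 0)}"

text \<open>The manifold structure of the total space of \<open>End E\<close>.\<close>

definition End_atlas ::
    "('m, 'a::euclidean_space) atlas \<Rightarrow> ('m \<Rightarrow> 'v::real_vector set) \<Rightarrow>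
     ('m, 'v, 'k::finite) trivs \<Rightarrow> ('m \<times> ('v \<Rightarrow> 'v), 'a \<times> (real^'k^'k)) atlas" where
  "End_atlas \<A> E \<B> =
     {({(p, A). p \<in> U \<inter> V \<and> A \<in> End_fibre (E p)},
       \<lambda>(p, A). (\<phi> p, matrix (\<Phi> p \<circ> A \<circ> inv_into (E p) (\<Phi> p)))) | U \<phi> V \<Phi>.
      (U, \<phi>) \<in> \<A> \<and> (V, \<Phi>) \<in> \<B>}"


section \<open>Connections\<close>

text \<open>\<open>D p X s\<close> is the covariant derivative at \<open>p\<close> of a section \<open>s\<close>, smooth near \<open>p\<close>, in the
  direction \<open>X\<close>, a tangent vector at \<open>p\<close>. It acts on germs of sections.\<close>

type_synonym ('m, 'v) conn = "'m \<Rightarrow> 'm tvec \<Rightarrow> ('m \<Rightarrow> 'v) \<Rightarrow> 'v"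

definition connection ::
    "('m::topological_space, 'a::euclidean_space) atlas \<Rightarrow> ('m \<Rightarrow> 'v::real_vector set) \<Rightarrow>
     ('m, 'v, 'k::finite) trivs \<Rightarrow> ('m, 'v) conn \<Rightarrow> bool" where
  "connection \<A> E \<B> D \<longleftrightarrow>
     (\<forall>W. open W \<longrightarrow> (\<forall>s\<in>sections \<A> E \<B> W. \<forall>p\<in>W. \<forall>X\<in>tangent_space \<A> UNIV p.
        D p X s \<in> E p \<and>
        (\<forall>Y\<in>tangent_space \<A> UNIV p. \<forall>a b.
           D p (\<lambda>f. a * X f + b * Y f) s = a *\<^sub>R D p X s + b *\<^sub>R D p Y s) \<and>
        (\<forall>s'\<in>sections \<A> E \<B> W. D p X (\<lambda>q. s q + s' q) = D p X s + D p X s') \<and>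
        (\<forall>f. smooth_at \<A> f p \<longrightarrow>
           D p X (\<lambda>q. f q *\<^sub>R s q) = X f *\<^sub>R s p + f p *\<^sub>R D p X s) \<and>
        (\<forall>s'. (\<forall>q\<in>W. s' q = s q) \<longrightarrow> D p X s' = D p X s))) \<and>
     (\<forall>W X. open W \<and> vector_field \<A> W X \<longrightarrow>
        (\<forall>s\<in>sections \<A> E \<B> W. (\<lambda>q. D q (X q) s) \<in> sections \<A> E \<B> W))"

definition metric_connection ::
    "('m::topological_space, 'a::euclidean_space) atlas \<Rightarrow> ('m \<Rightarrow> 'v::real_vector set) \<Rightarrow>
     ('m, 'v, 'k::finite) trivs \<Rightarrow> ('m \<Rightarrow> 'v \<Rightarrow> 'v \<Rightarrow> real) \<Rightarrow> ('m, 'v) conn \<Rightarrow> bool" where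
  "metric_connection \<A> E \<B> g D \<longleftrightarrow> connection \<A> E \<B> D \<and>
     (\<forall>W. open W \<longrightarrow> (\<forall>s\<in>sections \<A> E \<B> W. \<forall>s'\<in>sections \<A> E \<B> W.
        \<forall>p\<in>W. \<forall>X\<in>tangent_space \<A> UNIV p.
          X (\<lambda>q. g q (s q) (s' q)) = g p (D p X s) (s' p) + g p (s p) (D p X s')))"

definition curvature ::
    "('m, 'a::euclidean_space) atlas \<Rightarrow> ('m, 'v::real_vector) conn \<Rightarrow>
     ('m \<Rightarrow> 'm tvec) \<Rightarrow> ('m \<Rightarrow> 'm tvec) \<Rightarrow> ('m \<Rightarrow> 'v) \<Rightarrow> 'm \<Rightarrow> 'v" where
  "curvature \<A> D X Y s p =
     D p (X p) (\<lambda>q. D q (Y q) s) - D p (Y p) (\<lambda>q. D q (X q) s) - D p (lie_bracket \<A> X Y p) s"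

definition curvature_type_11 ::
    "('m::topological_space, complex^'d) atlas \<Rightarrow> ('m \<Rightarrow> 'v::real_vector set) \<Rightarrow>
     ('m, 'v, 'k::finite) trivs \<Rightarrow> ('m, 'v) conn \<Rightarrow> bool" where
  "curvature_type_11 \<A> E \<B> D \<longleftrightarrow>
     (\<forall>W X Y. open W \<and> vector_field \<A> W X \<and> vector_field \<A> W Y \<longrightarrow>
        (\<forall>s\<in>sections \<A> E \<B> W. \<forall>p\<in>W.
          curvature \<A> D (\<lambda>q. cplx_structure \<A> q (X q)) (\<lambda>q. cplx_structure \<A> q (Y q)) s p =
          curvature \<A> D X Y s p))"

definition local_frame :: "('m \<Rightarrow> 'v set) \<Rightarrow> ('m \<Rightarrow> 'v \<Rightarrow> real^'k::finite) \<Rightarrow> 'k \<Rightarrow> 'm \<Rightarrow> 'v" where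
  "local_frame E \<Phi> i = (\<lambda>q. inv_into (E q) (\<Phi> q) (axis i 1))"

definition sections_along ::
    "('m \<Rightarrow> 'v set) \<Rightarrow> ('m, 'v, 'k::finite) trivs \<Rightarrow> (real \<Rightarrow> 'm) \<Rightarrow> real set \<Rightarrow> (real \<Rightarrow> 'v) set" where
  "sections_along E \<B> \<gamma> T = {s. (\<forall>t\<in>T. s t \<in> E (\<gamma> t)) \<and>
     (\<forall>(U, \<Phi>)\<in>\<B>. \<forall>t\<in>T. \<gamma> t \<in> U \<longrightarrow>
        (\<exists>\<delta>>0. smooth_on {t-\<delta><..<t+\<delta>} (\<lambda>u. \<Phi> (\<gamma> u) (s u))))}"

text \<open>The covariant derivative along \<open>\<gamma>\<close> (that is, for the connection pulled back by \<open>\<gamma>\<close>) of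
  \<open>s = \<Sum>\<^sub>i s\<^sub>i (e\<^sub>i \<circ> \<gamma>)\<close>, with \<open>e\<^sub>i\<close> the frame of the trivialisation \<open>\<Phi>\<close>, is
  \<open>\<Sum>\<^sub>i s\<^sub>i' (e\<^sub>i \<circ> \<gamma>) + s\<^sub>i D\<^bsub>\<gamma>'\<^esub> e\<^sub>i\<close>. It does not depend on the choice of \<open>\<Phi>\<close>.\<close>

definition cov_deriv_along ::
    "('m, 'a::euclidean_space) atlas \<Rightarrow> ('m \<Rightarrow> 'v::real_vector set) \<Rightarrow> ('m, 'v) conn \<Rightarrow>
     ('m \<Rightarrow> 'v \<Rightarrow> real^'k::finite) \<Rightarrow> (real \<Rightarrow> 'm) \<Rightarrow> (real \<Rightarrow> 'v) \<Rightarrow> real \<Rightarrow> 'v" where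
  "cov_deriv_along \<A> E D \<Phi> \<gamma> s t = (\<Sum>i\<in>UNIV.
     deriv (\<lambda>u. \<Phi> (\<gamma> u) (s u) $ i) t *\<^sub>R local_frame E \<Phi> i (\<gamma> t) +
     (\<Phi> (\<gamma> t) (s t) $ i) *\<^sub>R D (\<gamma> t) (velocity \<A> \<gamma> t) (local_frame E \<Phi> i))"

text \<open>\<open>L\<close> is a smooth section of \<open>End E\<close> along \<open>\<gamma>\<close> that is parallel for the connection induced
  on \<open>End E\<close>, i.e. \<open>D(L s) - L (D s) = 0\<close> for all local sections \<open>s\<close> along \<open>\<gamma>\<close>.\<close>

definition parallel_End_along ::
    "('m, 'a::euclidean_space) atlas \<Rightarrow> ('m \<Rightarrow> 'v::real_vector set) \<Rightarrow>
     ('m, 'v, 'k::finite) trivs \<Rightarrow> ('m, 'v) conn \<Rightarrow> real set \<Rightarrow> (real \<Rightarrow> 'm) \<Rightarrow>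
     (real \<Rightarrow> 'v \<Rightarrow> 'v) \<Rightarrow> bool" where
  "parallel_End_along \<A> E \<B> D T \<gamma> L \<longleftrightarrow>
     smooth_curve (End_atlas \<A> E \<B>) T (\<lambda>t. (\<gamma> t, L t)) \<and>
     (\<forall>a b. {a<..<b} \<subseteq> T \<longrightarrow> (\<forall>s\<in>sections_along E \<B> \<gamma> {a<..<b}.
        \<forall>t\<in>{a<..<b}. \<forall>(U, \<Phi>)\<in>\<B>. \<gamma> t \<in> U \<longrightarrow>
          cov_deriv_along \<A> E D \<Phi> \<gamma> (\<lambda>u. L u (s u)) t =
          L t (cov_deriv_along \<A> E D \<Phi> \<gamma> s t)))"


section \<open>The twistor space\<close>

definition twistor_fibre :: "'v::real_vector set \<Rightarrow> ('v \<Rightarrow> 'v \<Rightarrow> real) \<Rightarrow> ('v \<Rightarrow> 'v) set" where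
  "twistor_fibre F h = {j \<in> End_fibre F. (\<forall>v\<in>F. j (j v) = - v) \<and>
     (\<forall>v\<in>F. \<forall>w\<in>F. h (j v) (j w) = h v w)}"

definition twistor_space ::
    "('m \<Rightarrow> 'v::real_vector set) \<Rightarrow> ('m \<Rightarrow> 'v \<Rightarrow> 'v \<Rightarrow> real) \<Rightarrow> ('m \<times> ('v \<Rightarrow> 'v)) set" where
  "twistor_space E g = {(p, K). K \<in> twistor_fibre (E p) (g p)}"

definition twistor_section ::
    "('m::topological_space, 'a::euclidean_space) atlas \<Rightarrow> ('m \<Rightarrow> 'v::real_vector set) \<Rightarrow>
     ('m, 'v, 'k::finite) trivs \<Rightarrow> ('m \<Rightarrow> 'v \<Rightarrow> 'v \<Rightarrow> real) \<Rightarrow> ('m \<Rightarrow> 'v \<Rightarrow> 'v) \<Rightarrow> bool" where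
  "twistor_section \<A> E \<B> g J \<longleftrightarrow> (\<forall>p. (p, J p) \<in> twistor_space E g) \<and>
     (\<forall>W. open W \<longrightarrow> (\<forall>s\<in>sections \<A> E \<B> W. (\<lambda>q. J q (s q)) \<in> sections \<A> E \<B> W))"

definition parallel_End ::
    "('m::topological_space, 'a::euclidean_space) atlas \<Rightarrow> ('m \<Rightarrow> 'v::real_vector set) \<Rightarrow>
     ('m, 'v, 'k::finite) trivs \<Rightarrow> ('m, 'v) conn \<Rightarrow> ('m \<Rightarrow> 'v \<Rightarrow> 'v) \<Rightarrow> bool" where
  "parallel_End \<A> E \<B> D J \<longleftrightarrow>
     (\<forall>W. open W \<longrightarrow> (\<forall>s\<in>sections \<A> E \<B> W. \<forall>p\<in>W. \<forall>X\<in>tangent_space \<A> UNIV p.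
        D p X (\<lambda>q. J q (s q)) - J p (D p X s) = 0))"

definition twistor_plus ::
    "('m \<Rightarrow> 'v::real_vector set) \<Rightarrow> ('m \<Rightarrow> 'v \<Rightarrow> 'v \<Rightarrow> real) \<Rightarrow> ('m \<Rightarrow> 'v \<Rightarrow> 'v) \<Rightarrow> nat \<Rightarrow>
     ('m \<times> ('v \<Rightarrow> 'v)) set" where
  "twistor_plus E g J m\<^sub>1 =
     {(p, K) \<in> twistor_space E g. dim {v \<in> E p. J p v + K v = 0} = 2 * m\<^sub>1}"

definition twistor_minus ::
    "('m \<Rightarrow> 'v::real_vector set) \<Rightarrow> ('m \<Rightarrow> 'v \<Rightarrow> 'v \<Rightarrow> real) \<Rightarrow> ('m \<Rightarrow> 'v \<Rightarrow> 'v) \<Rightarrow> nat \<Rightarrow>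
     ('m \<times> ('v \<Rightarrow> 'v)) set" where
  "twistor_minus E g J m\<^sub>2 =
     {(p, K) \<in> twistor_space E g. dim {v \<in> E p. J p v - K v = 0} = 2 * m\<^sub>2}"

definition vertical_space ::
    "('m, 'a::euclidean_space) atlas \<Rightarrow> ('m \<Rightarrow> 'v::real_vector set) \<Rightarrow>
     ('m, 'v, 'k::finite) trivs \<Rightarrow> ('m \<times> ('v \<Rightarrow> 'v)) set \<Rightarrow> 'm \<times> ('v \<Rightarrow> 'v) \<Rightarrow>
     ('m \<times> ('v \<Rightarrow> 'v)) tvec set" where
  "vertical_space \<A> E \<B> S K = tangent_space (End_atlas \<A> E \<B>) {K' \<in> S. fst K' = fst K} K"

definition horizontal_space ::
    "('m, 'a::euclidean_space) atlas \<Rightarrow> ('m \<Rightarrow> 'v::real_vector set) \<Rightarrow>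
     ('m, 'v, 'k::finite) trivs \<Rightarrow> ('m, 'v) conn \<Rightarrow> 'm \<times> ('v \<Rightarrow> 'v) \<Rightarrow>
     ('m \<times> ('v \<Rightarrow> 'v)) tvec set" where
  "horizontal_space \<A> E \<B> D K =
     {velocity (End_atlas \<A> E \<B>) (\<lambda>t. (\<gamma> t, L t)) 0 | \<gamma> L \<epsilon>. \<epsilon> > 0 \<and>
        smooth_curve \<A> {-\<epsilon><..<\<epsilon>} \<gamma> \<and> (\<gamma> 0, L 0) = K \<and>
        parallel_End_along \<A> E \<B> D {-\<epsilon><..<\<epsilon>} \<gamma> L}"

end

theory Submission imports Defs begin

text \<open>
  Over a chart of \<open>M\<close> on which \<open>E\<close> is trivial, a point of \<open>End E\<close> is a pair of a point of the chart and a
  matrix, the metric and \<open>J\<close> become matrix-valued functions, and the connection becomes a matrix-valued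
  form \<open>\<Gamma>\<close>. Tangent vectors of \<open>End E\<close> at \<open>K\<close> correspond linearly and injectively to pairs \<open>(v, B)\<close> of a
  vector and a matrix (\<open>chart_vec_linear\<close>, \<open>chart_vec_inj\<close>), so the theorem is an equation between sets of
  such pairs. Two arguments carry it.

  The first is parallel transport. As \<open>\<nabla>g = 0\<close> and \<open>\<nabla>J = 0\<close>, the parallel transport \<open>P\<close> along a curve
  consists of isometries of the fibres that intertwine the values of \<open>J\<close> (\<open>parallel_transport\<close>). Hence
  conjugation by \<open>P\<close> maps orthogonal complex structures to orthogonal complex structures and preserves the
  dimensions of the kernels of \<open>J + K\<close> and \<open>J - K\<close>. A curve in the given subspace of the twistor space is
  therefore the same as its base curve \<open>\<gamma>\<close> together with a curve \<open>k\<close> in one fibre of the subspace, the two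
  being related by \<open>P k P\<inverse>\<close>. The derivative of the latter at \<open>0\<close> is \<open>(v, A + [K, \<Gamma>(v)])\<close>, where \<open>v\<close> and \<open>A\<close>
  are the velocities of \<open>\<gamma>\<close> and \<open>k\<close>. Constant \<open>k\<close> give the horizontal vectors \<open>(v, [K, \<Gamma>(v)])\<close> and constant
  \<open>\<gamma>\<close> the vertical vectors \<open>(0, A)\<close>; both families contain a common vector only for \<open>v = 0\<close>. See
  \<open>lift_curve\<close>, \<open>tangent_space_twistor_sub\<close>, \<open>vertical_space_twistor_sub\<close> and
  \<open>horizontal_space_twistor_sub\<close>.

  The second is linear algebra in one fibre: the velocities \<open>A\<close> of the curves \<open>k\<close> form a linear space
  (\<open>velocities_twistor_mat\<close>). Such an \<open>A\<close> is skew and anticommutes with \<open>K\<close>, and \<open>\<langle>A u, w\<rangle> = 0\<close> for \<open>u\<close>, \<open>w\<close>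
  in \<open>Ker (J + K)\<close> because the kernel of the skew map \<open>J + k(t)\<close> has constant dimension
  (\<open>constant_kernel_dim_derivative\<close>); likewise for \<open>J - K\<close>. Conversely, let \<open>A\<close> satisfy these linear
  conditions. The part of \<open>A\<close> that mixes the kernel and its complement is a commutator \<open>[B, K]\<close> with \<open>B\<close> skew
  and commuting with \<open>J\<close> (\<open>off_diagonal_part\<close>), so it comes from conjugation by \<open>exp (t B)\<close>, which preserves
  all the conditions on \<open>K\<close>. The rest of \<open>A\<close> kills the kernel and equals \<open>[C, K]\<close> for \<open>C = K A / 2\<close>. The curve
  of conjugates of \<open>K\<close> by \<open>exp (t C)\<close> agrees with \<open>K\<close> on the kernel, so the kernel of \<open>J + k(t)\<close> does not
  shrink, and it does not grow for small \<open>t\<close> by semicontinuity (\<open>velocities_diagonal\<close>).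

  Parallel transport and the exponential curves are both obtained from the local existence theorem for
  linear differential equations.
\<close>

section \<open>Calculus of smooth maps\<close>

lemma Ck_on_cong:
  assumes "open W" "\<And>x. x \<in> W \<Longrightarrow> f x = g x"
  shows "Ck_on k W f \<longleftrightarrow> Ck_on k W g"
  using assms(2)
proof (induction k arbitrary: f g)
  case 0
  then show ?case by (simp cong: continuous_on_cong)
next
  case (Suc k)
  have fd: "frechet_derivative f (at x) = frechet_derivative g (at x)"
    "f differentiable (at x) \<longleftrightarrow> g differentiable (at x)" if "x \<in> W" for x
  proof -
    have *: "(f has_derivative D) (at x) \<longleftrightarrow> (g has_derivative D) (at x)" for D
      using has_derivative_transform_within_open[of f D x UNIV W g]
        has_derivative_transform_within_open[of g D x UNIV W f] assms(1) that Suc.prems by auto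
    then show "frechet_derivative f (at x) = frechet_derivative g (at x)"
      "f differentiable (at x) \<longleftrightarrow> g differentiable (at x)"
      by (simp_all add: frechet_derivative_def differentiable_def)
  qed
  have "Ck_on k W (\<lambda>x. frechet_derivative f (at x) v) \<longleftrightarrow>
        Ck_on k W (\<lambda>x. frechet_derivative g (at x) v)" for v
    by (rule Suc.IH) (simp add: fd)
  then show ?case by (simp add: fd)
qed

lemma Ck_on_SucI:
  assumes "open W" "\<And>x. x \<in> W \<Longrightarrow> (f has_derivative f' x) (at x)" "\<And>v. Ck_on k W (\<lambda>x. f' x v)"
  shows "Ck_on (Suc k) W f"
proof -
  have "Ck_on k W (\<lambda>x. frechet_derivative f (at x) v) \<longleftrightarrow> Ck_on k W (\<lambda>x. f' x v)" for v
    by (rule Ck_on_cong[OF assms(1)]) (simp add: frechet_derivative_at[OF assms(2), symmetric])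
  with assms(2,3) show ?thesis by (auto simp: differentiable_def)
qed

lemma Ck_on_subset: "Ck_on k W f \<Longrightarrow> W' \<subseteq> W \<Longrightarrow> Ck_on k W' f"
  by (induction k arbitrary: f) (auto intro: continuous_on_subset)

lemma Ck_on_SucD: "Ck_on (Suc k) W f \<Longrightarrow> Ck_on k W f"
proof (induction k arbitrary: f)
  case 0
  then show ?case
    by (auto intro!: continuous_at_imp_continuous_on differentiable_imp_continuous_within)
next
  case (Suc k)
  then show ?case by (metis Ck_on.simps(2))
qed

lemma Ck_on_const: "Ck_on k W (\<lambda>x. c)"
  by (induction k arbitrary: c) auto

lemma Ck_on_local:
  assumes "\<And>x. x \<in> W \<Longrightarrow> \<exists>W'. open W' \<and> x \<in> W' \<and> Ck_on k W' f"
  shows "Ck_on k W f"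
  using assms
proof (induction k arbitrary: f)
  case 0
  have "continuous (at x) f" if "x \<in> W" for x
    using 0[OF that] by (auto simp: continuous_on_eq_continuous_at)
  then show ?case by (simp add: continuous_at_imp_continuous_on)
next
  case (Suc k)
  have "f differentiable (at x)" if "x \<in> W" for x
    using Suc.prems[OF that] by auto
  moreover have "Ck_on k W (\<lambda>x. frechet_derivative f (at x) v)" for v
    by (rule Suc.IH) (use Suc.prems in force)
  ultimately show ?case by simp
qed

lemma Ck_on_bounded_linear:
  assumes "bounded_linear h" "open W" "Ck_on k W f"
  shows "Ck_on k W (\<lambda>x. h (f x))"
  using assms(3)
proof (induction k arbitrary: f)
  case 0
  then show ?case using assms(1)
    by (simp add: bounded_linear.continuous_on)
next
  case (Suc k)
  have der: "((\<lambda>x. h (f x)) has_derivative (\<lambda>v. h (frechet_derivative f (at x) v))) (at x)"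
    if "x \<in> W" for x
    using Suc.prems that by (auto simp: frechet_derivative_works
        intro!: bounded_linear.has_derivative[OF assms(1)])
  have "Ck_on k W (\<lambda>x. h (frechet_derivative f (at x) v))" for v
    by (rule Suc.IH) (use Suc.prems in auto)
  with der show ?case by (intro Ck_on_SucI[OF assms(2)])
qed

lemma Ck_on_add:
  assumes "open W" "Ck_on k W f" "Ck_on k W g"
  shows "Ck_on k W (\<lambda>x. f x + g x)"
  using assms(2,3)
proof (induction k arbitrary: f g)
  case 0
  then show ?case by (simp add: continuous_on_add)
next
  case (Suc k)
  have der: "((\<lambda>x. f x + g x) has_derivative
      (\<lambda>v. frechet_derivative f (at x) v + frechet_derivative g (at x) v)) (at x)"
    if "x \<in> W" for x
    using Suc.prems that by (auto simp: frechet_derivative_works intro!: has_derivative_add)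
  have "Ck_on k W (\<lambda>x. frechet_derivative f (at x) v + frechet_derivative g (at x) v)" for v
    by (rule Suc.IH) (use Suc.prems in auto)
  with der show ?case by (intro Ck_on_SucI[OF assms(1)])
qed

lemma Ck_on_sum:
  assumes "open W" "finite I" "\<And>i. i \<in> I \<Longrightarrow> Ck_on k W (f i)"
  shows "Ck_on k W (\<lambda>x. \<Sum>i\<in>I. f i x)"
  using assms(2,3)
  by (induction I rule: finite_induct) (auto intro!: Ck_on_const Ck_on_add[OF assms(1)])

lemma Ck_on_bilinear:
  assumes "bounded_bilinear p" "open W" "Ck_on k W f" "Ck_on k W g"
  shows "Ck_on k W (\<lambda>x. p (f x) (g x))"
  using assms(3,4)
proof (induction k arbitrary: f g)
  case 0
  then show ?case using assms(1) by (simp add: bounded_bilinear.continuous_on)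
next
  case (Suc k)
  have der: "((\<lambda>x. p (f x) (g x)) has_derivative
      (\<lambda>v. p (f x) (frechet_derivative g (at x) v) + p (frechet_derivative f (at x) v) (g x))) (at x)"
    if "x \<in> W" for x
    using Suc.prems that
    by (auto simp: frechet_derivative_works intro!: bounded_bilinear.FDERIV[OF assms(1)])
  have "Ck_on k W (\<lambda>x. p (f x) (frechet_derivative g (at x) v) + p (frechet_derivative f (at x) v) (g x))" for v
    by (intro Ck_on_add assms Suc.IH) (use Suc.prems Ck_on_SucD[of k W] in auto)
  with der show ?case by (intro Ck_on_SucI[OF assms(2)])
qed

text \<open>Expanding in the basis of the middle space turns the chain rule into a finite sum of products of
  derivatives of \<open>f\<close> with derivatives of \<open>g\<close> composed with \<open>f\<close>, to which the induction hypothesis applies.\<close>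

lemma Ck_on_compose:
  fixes f :: "'a::euclidean_space \<Rightarrow> 'b::euclidean_space" and g :: "'b \<Rightarrow> 'c::real_normed_vector"
  assumes "open W" "open V" "f ` W \<subseteq> V" "Ck_on k W f" "Ck_on k V g"
  shows "Ck_on k W (\<lambda>x. g (f x))"
  using assms(4,5)
proof (induction k arbitrary: g)
  case 0
  then show ?case using assms(3) by (auto intro: continuous_on_compose2)
next
  case (Suc k)
  let ?Df = "\<lambda>x. frechet_derivative f (at x)" and ?Dg = "\<lambda>x. frechet_derivative g (at x)"
  have der: "((\<lambda>x. g (f x)) has_derivative (\<lambda>v. \<Sum>b\<in>Basis. (?Df x v \<bullet> b) *\<^sub>R ?Dg (f x) b)) (at x)"
    if "x \<in> W" for x
  proof -
    have g: "(g has_derivative ?Dg (f x)) (at (f x))"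
      using Suc.prems(2) assms(3) that by (auto simp: frechet_derivative_works)
    have f: "(f has_derivative ?Df x) (at x)"
      using Suc.prems(1) that by (auto simp: frechet_derivative_works)
    have lin: "linear (?Dg (f x))"
      using g has_derivative_linear by blast
    have "?Dg (f x) \<circ> ?Df x = (\<lambda>v. \<Sum>b\<in>Basis. (?Df x v \<bullet> b) *\<^sub>R ?Dg (f x) b)"
    proof
      fix v let ?w = "?Df x v"
      have "?Dg (f x) ?w = ?Dg (f x) (\<Sum>b\<in>Basis. (?w \<bullet> b) *\<^sub>R b)"
        by (simp add: euclidean_representation)
      also have "\<dots> = (\<Sum>b\<in>Basis. (?w \<bullet> b) *\<^sub>R ?Dg (f x) b)"
        using lin by (simp add: linear_sum linear_scale o_def del: euclidean_representation)
      finally show "(?Dg (f x) \<circ> ?Df x) v = (\<Sum>b\<in>Basis. (?w \<bullet> b) *\<^sub>R ?Dg (f x) b)" by simp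
    qed
    with diff_chain_at[OF f g] show ?thesis
      unfolding o_def by metis
  qed
  have "Ck_on k W (\<lambda>x. \<Sum>b\<in>Basis. (?Df x v \<bullet> b) *\<^sub>R ?Dg (f x) b)" for v
    using Suc.prems Ck_on_SucD[OF Suc.prems(1)]
    by (intro Ck_on_sum assms Ck_on_bilinear[OF bounded_bilinear_scaleR]
        Ck_on_bounded_linear[OF bounded_linear_inner_left] Suc.IH) auto
  with der show ?case by (intro Ck_on_SucI[OF assms(1)])
qed

lemma smooth_on_cong:
  "open W \<Longrightarrow> (\<And>x. x \<in> W \<Longrightarrow> f x = g x) \<Longrightarrow> smooth_on W f \<longleftrightarrow> smooth_on W g"
  unfolding smooth_on_def using Ck_on_cong by blast

lemma smooth_on_eqI:
  "smooth_on W g \<Longrightarrow> open W \<Longrightarrow> (\<And>x. x \<in> W \<Longrightarrow> f x = g x) \<Longrightarrow> smooth_on W f"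
  using smooth_on_cong by blast

lemma smooth_on_subset: "smooth_on W f \<Longrightarrow> W' \<subseteq> W \<Longrightarrow> smooth_on W' f"
  unfolding smooth_on_def using Ck_on_subset by blast

lemma smooth_on_const: "smooth_on W (\<lambda>x. c)"
  unfolding smooth_on_def using Ck_on_const by blast

lemma smooth_on_local:
  "(\<And>x. x \<in> W \<Longrightarrow> \<exists>W'. open W' \<and> x \<in> W' \<and> smooth_on W' f) \<Longrightarrow> smooth_on W f"
  unfolding smooth_on_def by (intro allI Ck_on_local) blast

lemma smooth_on_bounded_linear:
  "bounded_linear h \<Longrightarrow> open W \<Longrightarrow> smooth_on W f \<Longrightarrow> smooth_on W (\<lambda>x. h (f x))"
  unfolding smooth_on_def using Ck_on_bounded_linear by blast

lemma smooth_on_add: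
  "open W \<Longrightarrow> smooth_on W f \<Longrightarrow> smooth_on W g \<Longrightarrow> smooth_on W (\<lambda>x. f x + g x)"
  unfolding smooth_on_def using Ck_on_add by blast

lemma smooth_on_sum:
  "open W \<Longrightarrow> finite I \<Longrightarrow> (\<And>i. i \<in> I \<Longrightarrow> smooth_on W (f i)) \<Longrightarrow> smooth_on W (\<lambda>x. \<Sum>i\<in>I. f i x)"
  unfolding smooth_on_def by (intro allI Ck_on_sum) blast+

lemma smooth_on_bilinear:
  "bounded_bilinear p \<Longrightarrow> open W \<Longrightarrow> smooth_on W f \<Longrightarrow> smooth_on W g \<Longrightarrow>
    smooth_on W (\<lambda>x. p (f x) (g x))"
  unfolding smooth_on_def using Ck_on_bilinear by blast

lemma smooth_on_minus:
  "open W \<Longrightarrow> smooth_on W f \<Longrightarrow> smooth_on W (\<lambda>x. - f x)"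
  using smooth_on_bounded_linear[OF bounded_linear_minus[OF bounded_linear_ident]] .

lemma smooth_on_compose:
  fixes f :: "'a::euclidean_space \<Rightarrow> 'b::euclidean_space"
  shows "open W \<Longrightarrow> open V \<Longrightarrow> f ` W \<subseteq> V \<Longrightarrow> smooth_on W f \<Longrightarrow> smooth_on V g \<Longrightarrow>
    smooth_on W (\<lambda>x. g (f x))"
  unfolding smooth_on_def using Ck_on_compose by blast

lemma smooth_on_imp_differentiable:
  "smooth_on W f \<Longrightarrow> x \<in> W \<Longrightarrow> f differentiable (at x)"
  unfolding smooth_on_def by (metis Ck_on.simps(2))

lemma smooth_on_imp_continuous_on: "smooth_on W f \<Longrightarrow> continuous_on W f"
  unfolding smooth_on_def by (metis Ck_on.simps(1))

lemma smooth_on_frechet_derivative: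
  "smooth_on W f \<Longrightarrow> smooth_on W (\<lambda>x. frechet_derivative f (at x) v)"
  unfolding smooth_on_def by (metis Ck_on.simps(2))

lemma smooth_on_linear:
  assumes "bounded_linear f" shows "smooth_on W f"
proof -
  have "Ck_on k W f" for k
  proof (cases k)
    case 0 then show ?thesis using assms by (simp add: linear_continuous_on)
  next
    case (Suc k')
    have der: "(f has_derivative f) (at x)" for x
      using assms by (simp add: bounded_linear_imp_has_derivative)
    then have "frechet_derivative f (at x) = f" for x
      using frechet_derivative_at by metis
    then show ?thesis
      using der by (auto simp: Suc differentiable_def intro: Ck_on_const)
  qed
  then show ?thesis by (simp add: smooth_on_def)
qed

lemma smooth_on_Pair:
  assumes "open W" "smooth_on W f" "smooth_on W g"
  shows "smooth_on W (\<lambda>x. (f x, g x))"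
proof -
  have "smooth_on W (\<lambda>x. (f x, 0) + (0, g x))"
    using assms by (intro smooth_on_add
        smooth_on_bounded_linear[where h = "\<lambda>y. (y, 0)"] smooth_on_bounded_linear[where h = "\<lambda>y. (0, y)"]
        bounded_linear_Pair bounded_linear_ident bounded_linear_zero)
  then show ?thesis by simp
qed

lemma bounded_linear_axis: "bounded_linear (\<lambda>y::'b::real_normed_vector. axis i y :: 'b^'n::finite)"
proof (rule bounded_linear_intro[where K = 1])
  fix y :: 'b
  have "norm (axis i y :: 'b^'n) \<le> (\<Sum>j\<in>UNIV. norm ((axis i y :: 'b^'n) $ j))"
    unfolding norm_vec_def by (rule L2_set_le_sum) simp
  also have "\<dots> = norm y * 1"
    by (simp add: axis_def if_distrib cong: if_cong)
  finally show "norm (axis i y :: 'b^'n) \<le> norm y * 1" .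
qed (auto simp: vec_eq_iff axis_def)

lemma smooth_on_vector_derivative:
  "smooth_on W f \<Longrightarrow> x \<in> W \<Longrightarrow> (f has_vector_derivative vector_derivative f (at x)) (at x)"
  using smooth_on_imp_differentiable vector_derivative_works by blast

lemma smooth_on_derivative_curve:
  assumes "open T" "smooth_on T y"
  shows "smooth_on T (\<lambda>t. vector_derivative y (at t))"
proof -
  have eq: "frechet_derivative y (at t) 1 = vector_derivative y (at t)" if "t \<in> T" for t
    using frechet_derivative_eq_vector_derivative[OF smooth_on_imp_differentiable[OF assms(2) that]]
    by simp
  have "smooth_on T (\<lambda>t. vector_derivative y (at t)) \<longleftrightarrow> smooth_on T (\<lambda>t. frechet_derivative y (at t) 1)"
    by (rule smooth_on_cong[OF assms(1)]) (simp add: eq)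
  then show ?thesis using smooth_on_frechet_derivative[OF assms(2)] by blast
qed

lemma has_vector_derivative_vec:
  fixes y :: "real \<Rightarrow> 'b::real_normed_vector^'n::finite"
  assumes "\<And>i. ((\<lambda>u. y u $ i) has_vector_derivative z $ i) (at t)"
  shows "(y has_vector_derivative z) (at t)"
proof -
  have eq: "y = (\<lambda>u. \<Sum>i\<in>UNIV. axis i (y u $ i))" "z = (\<Sum>i\<in>UNIV. axis i (z $ i))"
    by (simp_all add: fun_eq_iff vec_eq_iff axis_def if_distrib cong: if_cong)
  have "((\<lambda>u. \<Sum>i\<in>UNIV. axis i (y u $ i)) has_vector_derivative (\<Sum>i\<in>UNIV. axis i (z $ i))) (at t)"
    by (intro has_vector_derivative_sum bounded_linear.has_vector_derivative[OF bounded_linear_axis] assms)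
  then show ?thesis using eq by metis
qed

lemma has_vector_derivative_0_const:
  fixes f :: "real \<Rightarrow> 'b::real_normed_vector"
  assumes "\<And>t. t \<in> {-\<delta><..<\<delta>} \<Longrightarrow> (f has_vector_derivative 0) (at t)" "t \<in> {-\<delta><..<\<delta>}"
  shows "f t = f 0"
proof -
  have "(f has_vector_derivative 0) (at u within {-\<delta><..<\<delta>})" if "u \<in> {-\<delta><..<\<delta>}" for u
    using assms(1)[OF that] by (rule has_vector_derivative_at_within)
  then obtain c where "\<And>u. u \<in> {-\<delta><..<\<delta>} \<Longrightarrow> f u = c"
    using has_vector_derivative_zero_constant[of "{-\<delta><..<\<delta>}" f] by auto
  moreover have "0 \<in> {-\<delta><..<\<delta>}" using assms(2) by auto
  ultimately show ?thesis using assms(2) by metis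
qed

lemma constant_derivative_0:
  fixes f :: "real \<Rightarrow> 'b::real_normed_vector"
  assumes "(f has_vector_derivative d) (at 0)" "\<epsilon> > 0" "\<And>t. t \<in> {-\<epsilon><..<\<epsilon>} \<Longrightarrow> f t = c"
  shows "d = 0"
proof -
  have "(f has_vector_derivative 0) (at 0)"
    by (rule has_vector_derivative_transform_within_open[OF has_vector_derivative_const[of c], of "{-\<epsilon><..<\<epsilon>}"])
      (use assms in auto)
  then show ?thesis using assms(1) vector_derivative_unique_at by blast
qed

section \<open>Matrices\<close>

lemma bounded_bilinear_matrix_mult:
  "bounded_bilinear (\<lambda>(A::real^'m^'n) (B::real^'l^'m). A ** B)"
proof -
  have "bilinear (\<lambda>(A::real^'m^'n) (B::real^'l^'m). A ** B)"
    unfolding bilinear_def linear_iff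
    by (auto simp: vec_eq_iff matrix_matrix_mult_def sum.distrib sum_distrib_left algebra_simps)
  then show ?thesis by (simp add: bilinear_conv_bounded_bilinear)
qed

lemma bounded_bilinear_matrix_vector_mult:
  "bounded_bilinear (\<lambda>(A::real^'m^'n) (x::real^'m). A *v x)"
proof -
  have "bilinear (\<lambda>(A::real^'m^'n) (x::real^'m). A *v x)"
    unfolding bilinear_def linear_iff
    by (auto simp: vec_eq_iff matrix_vector_mult_def sum.distrib sum_distrib_left algebra_simps)
  then show ?thesis by (simp add: bilinear_conv_bounded_bilinear)
qed

lemma matrix_mult_linear: "linear f \<Longrightarrow> matrix f *v x = f x" for f :: "real^'n \<Rightarrow> real^'m"
  by (rule matrix_works) (simp add: linear_matrix_vector_mul_eq)

lemmas smooth_on_matrix_mult = smooth_on_bilinear[OF bounded_bilinear_matrix_mult]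
lemma has_vector_derivative_matrix_mult:
  fixes A B :: "real \<Rightarrow> real^'k::finite^'k"
  assumes "(A has_vector_derivative A') (at t)" "(B has_vector_derivative B') (at t)"
  shows "((\<lambda>t. A t ** B t) has_vector_derivative (A t ** B' + A' ** B t)) (at t)"
  by (rule bounded_bilinear.has_vector_derivative[OF bounded_bilinear_matrix_mult assms])

lemma matrix_minus_mult: "(- A) ** B = - (A ** B)" "A ** (- B) = - (A ** B)"
  for A :: "real^'m^'n" and B :: "real^'l^'m"
  by (simp_all add: matrix_matrix_mult_def vec_eq_iff sum_negf)

lemma matrix_diff_mult: "(A - B) ** C = A ** C - B ** C" "D ** (A - B) = D ** A - D ** B"
  for A B :: "real^'m^'n"
  by (simp_all add: matrix_matrix_mult_def vec_eq_iff sum_subtractf algebra_simps)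

lemma matrix_add_mult: "(A + B) ** C = A ** C + B ** C" "D ** (A + B) = D ** A + D ** B"
  for A B :: "real^'m^'n"
  by (simp_all add: matrix_matrix_mult_def vec_eq_iff sum.distrib algebra_simps)

lemma matrix_scaleR_mult: "(c *\<^sub>R A) ** B = c *\<^sub>R (A ** B)" "A ** (c *\<^sub>R B) = c *\<^sub>R (A ** B)"
  for A :: "real^'m^'n" and B :: "real^'l^'m"
  by (simp_all add: matrix_matrix_mult_def vec_eq_iff sum_distrib_left algebra_simps)

lemmas matrix_ring = matrix_minus_mult matrix_diff_mult matrix_add_mult matrix_scaleR_mult

lemma bounded_linear_transpose: "bounded_linear (transpose :: real^'n^'m \<Rightarrow> real^'m^'n)"
  by (intro linear_conv_bounded_linear[THEN iffD1] linearI) (simp_all add: transpose_def vec_eq_iff)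

lemma matrix_vector_mult_minus: "(- A) *v x = - (A *v x)" "A *v (- x) = - (A *v x)"
  for A :: "real^'m^'n"
  by (simp_all add: matrix_vector_mult_def vec_eq_iff sum_negf)

lemma inner_transpose_mult: "x \<bullet> (transpose M *v z) = (M *v x) \<bullet> z" for M :: "real^'m^'n"
  by (metis dot_lmul_matrix inner_commute transpose_matrix_vector)

lemma matrix_entry: "A $ i $ j = axis i 1 \<bullet> (A *v axis j 1)" for A :: "real^'m^'n"
  by (simp add: inner_axis' matrix_vector_mult_basis column_def)

lemma matrix_mult_0: "A ** 0 = 0" "0 ** B = 0" for A :: "real^'m^'n" and B :: "real^'l^'m"
  by (simp_all add: matrix_matrix_mult_def vec_eq_iff)

lemmas mv_simps = matrix_vector_right_distrib matrix_vector_mult_diff_distrib matrix_vector_mult_minus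
  matrix_vector_mult_add_rdistrib matrix_vector_mult_diff_rdistrib matrix_vector_mult_scaleR

section \<open>Linear ordinary differential equations\<close>

text \<open>Bootstrapping: the derivative of \<open>Y\<close> is a product of \<open>A\<close> and \<open>Y\<close>, so it is as smooth as \<open>Y\<close> itself.\<close>

lemma smooth_on_linear_ODE_solution:
  fixes Y :: "real \<Rightarrow> 'b::real_normed_vector" and p :: "'c::real_normed_vector \<Rightarrow> 'b \<Rightarrow> 'b"
  assumes p: "bounded_bilinear p" and T: "open T" and A: "smooth_on T A"
    and Y: "\<And>t. t \<in> T \<Longrightarrow> (Y has_vector_derivative p (A t) (Y t)) (at t)"
  shows "smooth_on T Y"
proof -
  have "Ck_on k T Y" for k
  proof (induction k)
    case 0
    show ?case using Y
      by (auto intro!: continuous_at_imp_continuous_on dest: has_vector_derivative_continuous)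
  next
    case (Suc k)
    have "Ck_on k T (\<lambda>t. v *\<^sub>R p (A t) (Y t))" for v
      using A Suc by (intro Ck_on_bounded_linear[OF bounded_linear_scaleR_right] T
          Ck_on_bilinear[OF p]) (auto simp: smooth_on_def)
    with Y show ?case
      by (intro Ck_on_SucI[OF T]) (auto simp: has_vector_derivative_def)
  qed
  then show ?thesis by (simp add: smooth_on_def)
qed

text \<open>Picard iteration, written as a series. The summands solve \<open>y (n + 1)' = A y n\<close> with
  \<open>y (n + 1) 0 = 0\<close>. On a sufficiently short interval they decrease like \<open>1/2\<^sup>n\<close>, so the series may be
  differentiated term by term.\<close>

lemma linear_ODE_local_solution:
  fixes p :: "'c::real_normed_vector \<Rightarrow> 'b::banach \<Rightarrow> 'b"
  assumes p: "bounded_bilinear p" and \<epsilon>: "\<epsilon> > 0" and A: "continuous_on {-\<epsilon><..<\<epsilon>} A"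
  obtains \<delta> Y where "0 < \<delta>" "\<delta> \<le> \<epsilon>" "Y 0 = y\<^sub>0"
    "\<And>t. t \<in> {-\<delta><..<\<delta>} \<Longrightarrow> (Y has_vector_derivative p (A t) (Y t)) (at t)"
proof -
  interpret p: bounded_bilinear p by fact
  have A2: "continuous_on {-\<epsilon>/2..\<epsilon>/2} A"
    by (rule continuous_on_subset[OF A]) (use \<epsilon> in auto)
  then obtain L where L: "\<And>t. t \<in> {-\<epsilon>/2..\<epsilon>/2} \<Longrightarrow> norm (A t) \<le> L"
    using compact_continuous_image[OF A2] compact_imp_bounded[of "A ` {-\<epsilon>/2..\<epsilon>/2}"]
    by (force simp: bounded_iff)
  obtain C where C: "C > 0" "\<And>a b. norm (p a b) \<le> norm a * norm b * C"
    using p.pos_bounded by auto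
  define M where "M = \<bar>L\<bar> * C + 1"
  have M: "M > 0" using C(1) by (simp add: M_def add_nonneg_pos)
  \<comment> \<open>With \<open>M \<delta> \<le> 1/2\<close>, one integration against \<open>A\<close> at least halves the supremum norm.\<close>
  define \<delta> where "\<delta> = min (\<epsilon>/2) (1 / (2 * M))"
  define I where "I = {-\<delta>..\<delta>}"
  have \<delta>: "\<delta> > 0" "\<delta> \<le> \<epsilon>/2" "M * \<delta> \<le> 1/2"
    using \<epsilon> M by (auto simp: \<delta>_def min_def field_simps)
  have I0: "0 \<in> I" using \<delta> by (simp add: I_def)
  have AI: "continuous_on I A"
    by (rule continuous_on_subset[OF A2]) (use \<delta> in \<open>auto simp: I_def\<close>)
  have pM: "norm (p (A t) y) \<le> M * norm y" if "t \<in> I" for t y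
  proof -
    have "norm (A t) \<le> \<bar>L\<bar>" using L[of t] that \<delta> by (auto simp: I_def)
    then have "norm (A t) * C * norm y \<le> (\<bar>L\<bar> * C + 1) * norm y"
      using C(1) by (intro mult_right_mono) (auto intro: add_increasing2 mult_right_mono)
    with C(2)[of "A t" y] show ?thesis by (simp add: M_def mult_ac)
  qed
  define anti where "anti h = (SOME g. g 0 = (0::'b) \<and>
     (\<forall>t\<in>I. (g has_vector_derivative h t) (at t within I)))" for h
  have anti: "anti h 0 = 0 \<and> (\<forall>t\<in>I. (anti h has_vector_derivative h t) (at t within I))"
    if h: "continuous_on I h" for h
  proof -
    obtain g where g: "\<And>t. t \<in> I \<Longrightarrow> (g has_vector_derivative h t) (at t within I)"
      using antiderivative_continuous[of "-\<delta>" \<delta> h] h unfolding I_def by blast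
    have "((\<lambda>t. g t - g 0) has_vector_derivative h t) (at t within I)" if "t \<in> I" for t
      using has_vector_derivative_diff[OF g[OF that] has_vector_derivative_const] by simp
    then have "\<exists>g. g 0 = 0 \<and> (\<forall>t\<in>I. (g has_vector_derivative h t) (at t within I))"
      by (intro exI[of _ "\<lambda>t. g t - g 0"]) auto
    from someI_ex[OF this] show ?thesis unfolding anti_def .
  qed
  define y where "y = rec_nat (\<lambda>_. y\<^sub>0) (\<lambda>n f. anti (\<lambda>s. p (A s) (f s)))"
  have y0: "y 0 = (\<lambda>_. y\<^sub>0)" and ySuc: "y (Suc n) = anti (\<lambda>s. p (A s) (y n s))" for n
    by (simp_all add: y_def)
  have y: "continuous_on I (y n) \<and> (\<forall>t\<in>I. norm (y n t) \<le> norm y\<^sub>0 * (1/2)^n)" for n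
  proof (induction n)
    case 0 then show ?case by (simp add: y0)
  next
    case (Suc n)
    define h where "h = (\<lambda>s. p (A s) (y n s))"
    have "continuous_on I h"
      unfolding h_def using Suc AI by (intro p.continuous_on) auto
    then have a: "y (Suc n) 0 = 0" "\<And>t. t \<in> I \<Longrightarrow> (y (Suc n) has_vector_derivative h t) (at t within I)"
      using anti by (auto simp: ySuc h_def)
    have hb: "norm (h t) \<le> M * (norm y\<^sub>0 * (1/2)^n)" if "t \<in> I" for t
      using pM[OF that, of "y n t"] Suc that M unfolding h_def
      by (meson mult_left_mono less_imp_le order_trans)
    have "norm (y (Suc n) t) \<le> norm y\<^sub>0 * (1/2)^Suc n" if t: "t \<in> I" for t
    proof -
      have "norm (y (Suc n) t - y (Suc n) 0) \<le> M * (norm y\<^sub>0 * (1/2)^n) * norm (t - 0)"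
      proof (rule differentiable_bound[of I _ "\<lambda>t r. r *\<^sub>R h t"])
        show "convex I" by (simp add: I_def)
        show "(y (Suc n) has_derivative (\<lambda>r. r *\<^sub>R h s)) (at s within I)" if "s \<in> I" for s
          using a(2)[OF that] by (simp add: has_vector_derivative_def)
        show "onorm (\<lambda>r. r *\<^sub>R h s) \<le> M * (norm y\<^sub>0 * (1/2)^n)" if "s \<in> I" for s
          using hb[OF that] by (intro onorm_le) (simp add: mult.commute mult_left_mono)
      qed (use t I0 in auto)
      also have "\<dots> \<le> M * (norm y\<^sub>0 * (1/2)^n) * \<delta>"
        using t M by (intro mult_left_mono) (auto simp: I_def)
      also have "\<dots> = (M * \<delta>) * (norm y\<^sub>0 * (1/2)^n)" by simp
      also have "\<dots> \<le> 1/2 * (norm y\<^sub>0 * (1/2)^n)"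
        using \<delta> by (intro mult_right_mono) auto
      finally show ?thesis using a(1) by simp
    qed
    moreover have "continuous_on I (y (Suc n))"
      using a(2) by (meson continuous_on_eq_continuous_within has_vector_derivative_continuous)
    ultimately show ?case by blast
  qed
  have yder: "(y (Suc n) has_vector_derivative p (A t) (y n t)) (at t within I)" if "t \<in> I" for n t
    using anti[of "\<lambda>s. p (A s) (y n s)"] y[of n] AI that
    by (auto simp: ySuc intro: p.continuous_on)
  define Y where "Y t = (\<Sum>n. y n t)" for t
  have geo: "summable (\<lambda>n. norm y\<^sub>0 * (1/2::real)^n)"
    by (intro summable_mult summable_geometric) simp
  have ul: "uniform_limit I (\<lambda>n t. \<Sum>i<n. y i t) Y sequentially"
    unfolding Y_def by (rule Weierstrass_m_test[OF _ geo]) (use y in auto)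
  have Ysums: "(\<lambda>n. y n t) sums Y t" if "t \<in> I" for t
    using tendsto_uniform_limitI[OF ul that] by (simp add: sums_def)
  \<comment> \<open>The derivatives of the summands; the first summand is constant.\<close>
  define d where "d n t = (case n of 0 \<Rightarrow> 0 | Suc m \<Rightarrow> p (A t) (y m t))" for n t
  have "\<exists>G. \<forall>t\<in>I. (\<lambda>n. y n t) sums (G t) \<and>
      (G has_derivative (\<lambda>r. r *\<^sub>R p (A t) (Y t))) (at t within I)"
  proof (rule has_derivative_series[of I y "\<lambda>n t r. r *\<^sub>R d n t"])
    show "convex I" by (simp add: I_def)
    show "(y n has_derivative (\<lambda>r. r *\<^sub>R d n t)) (at t within I)" if "t \<in> I" for n t
      using yder[OF that]
      by (cases n) (auto simp: d_def y0 has_vector_derivative_def)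
    show "\<forall>\<^sub>F n in sequentially. \<forall>t\<in>I. \<forall>r. norm ((\<Sum>i<n. r *\<^sub>R d i t) - r *\<^sub>R p (A t) (Y t)) \<le> e * norm r"
      if e: "e > 0" for e
    proof -
      have "\<forall>\<^sub>F n in sequentially. \<forall>t\<in>I. dist (\<Sum>i<n. y i t) (Y t) < e / M"
        using ul e M by (simp add: uniform_limit_iff)
      then obtain N where N: "\<And>n t. n \<ge> N \<Longrightarrow> t \<in> I \<Longrightarrow> dist (\<Sum>i<n. y i t) (Y t) < e / M"
        by (auto simp: eventually_sequentially)
      have "norm ((\<Sum>i<n. r *\<^sub>R d i t) - r *\<^sub>R p (A t) (Y t)) \<le> e * norm r"
        if n: "n \<ge> Suc N" and t: "t \<in> I" for n t r
      proof -
        obtain m where m: "n = Suc m" "m \<ge> N" using n by (cases n) auto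
        have "(\<Sum>i<n. d i t) = p (A t) (\<Sum>i<m. y i t)"
          unfolding m(1) sum.lessThan_Suc_shift by (simp add: d_def p.sum_right)
        then have "(\<Sum>i<n. r *\<^sub>R d i t) - r *\<^sub>R p (A t) (Y t) = r *\<^sub>R p (A t) ((\<Sum>i<m. y i t) - Y t)"
          by (simp add: p.diff_right scaleR_diff_right flip: scaleR_right.sum)
        moreover have "norm (p (A t) ((\<Sum>i<m. y i t) - Y t)) \<le> e"
        proof -
          have "M * norm ((\<Sum>i<m. y i t) - Y t) \<le> M * (e / M)"
            using N[OF m(2) t] M by (intro mult_left_mono) (auto simp: dist_norm)
          then show ?thesis using pM[OF t, of "(\<Sum>i<m. y i t) - Y t"] M by simp
        qed
        ultimately show ?thesis by (simp add: mult.commute[of e] mult_left_mono)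
      qed
      then show ?thesis unfolding eventually_sequentially by blast
    qed
    show "0 \<in> I" by (rule I0)
    show "(\<lambda>n. y n 0) sums Y 0" by (rule Ysums[OF I0])
  qed
  then obtain G where G: "\<And>t. t \<in> I \<Longrightarrow> (\<lambda>n. y n t) sums (G t)"
    "\<And>t. t \<in> I \<Longrightarrow> (G has_derivative (\<lambda>r. r *\<^sub>R p (A t) (Y t))) (at t within I)"
    by blast
  have GY: "G t = Y t" if "t \<in> I" for t
    using sums_unique2[OF G(1)[OF that] Ysums[OF that]] .
  show thesis
  proof (rule that[of \<delta> G])
    show "0 < \<delta>" "\<delta> \<le> \<epsilon>" using \<delta> \<epsilon> by auto
    have "y n 0 = (if n = 0 then y\<^sub>0 else 0)" for n
    proof (cases n)
      case (Suc m)
      then show ?thesis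
        using anti[of "\<lambda>s. p (A s) (y m s)"] y[of m] AI by (auto simp: ySuc intro: p.continuous_on)
    qed (simp add: y0)
    then have "(\<lambda>n. y n 0) sums y\<^sub>0"
      using sums_single[of 0 "\<lambda>_. y\<^sub>0"] by (simp cong: if_cong)
    then show "G 0 = y\<^sub>0" using G(1)[OF I0] sums_unique2 by blast
    fix t assume t: "t \<in> {-\<delta><..<\<delta>}"
    then have tI: "t \<in> I" by (simp add: I_def)
    have "(G has_vector_derivative p (A t) (G t)) (at t within I)"
      using G(2)[OF tI] GY[OF tI] by (simp add: has_vector_derivative_def)
    moreover have "at t within I = at t"
      by (rule at_within_interior) (use t in \<open>simp add: I_def\<close>)
    ultimately show "(G has_vector_derivative p (A t) (G t)) (at t)" by simp
  qed
qed

text \<open>For \<open>A\<close> the connection matrix along a curve, \<open>P\<close> is parallel transport from time \<open>0\<close> and \<open>Q\<close>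
  its inverse; for constant \<open>A = -C\<close> they are \<open>exp (t C)\<close> and \<open>exp (-t C)\<close>.\<close>

definition inverse_flows ::
    "real \<Rightarrow> (real \<Rightarrow> real^'k::finite^'k) \<Rightarrow> (real \<Rightarrow> real^'k^'k) \<Rightarrow> (real \<Rightarrow> real^'k^'k) \<Rightarrow> bool" where
  "inverse_flows d A P Q \<longleftrightarrow> d > 0 \<and> P 0 = mat 1 \<and> Q 0 = mat 1 \<and>
     smooth_on {-d<..<d} P \<and> smooth_on {-d<..<d} Q \<and>
     (\<forall>t\<in>{-d<..<d}. (P has_vector_derivative - (A t ** P t)) (at t) \<and>
        (Q has_vector_derivative Q t ** A t) (at t) \<and> Q t ** P t = mat 1 \<and> P t ** Q t = mat 1)"

lemma inverse_flowsD:
  assumes "inverse_flows d A P Q"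
  shows "d > 0" "P 0 = mat 1" "Q 0 = mat 1" "smooth_on {-d<..<d} P" "smooth_on {-d<..<d} Q"
    and "\<And>t. t \<in> {-d<..<d} \<Longrightarrow> (P has_vector_derivative - (A t ** P t)) (at t)"
    and "\<And>t. t \<in> {-d<..<d} \<Longrightarrow> (Q has_vector_derivative Q t ** A t) (at t)"
    and "\<And>t. t \<in> {-d<..<d} \<Longrightarrow> Q t ** P t = mat 1" "\<And>t. t \<in> {-d<..<d} \<Longrightarrow> P t ** Q t = mat 1"
  using assms by (simp_all add: inverse_flows_def)

lemma inverse_flows_exist:
  fixes A :: "real \<Rightarrow> real^'k::finite^'k"
  assumes \<epsilon>: "\<epsilon> > 0" and A: "smooth_on {-\<epsilon><..<\<epsilon>} A"
  obtains d P Q where "d \<le> \<epsilon>" "inverse_flows d A P Q"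
proof -
  note bb = bounded_bilinear_matrix_mult[where 'm='k and 'n='k and 'l='k]
  have A': "smooth_on {-\<epsilon><..<\<epsilon>} (\<lambda>t. - A t)" by (rule smooth_on_minus[OF _ A]) simp
  obtain \<delta>\<^sub>1 P where P: "0 < \<delta>\<^sub>1" "\<delta>\<^sub>1 \<le> \<epsilon>" "P 0 = mat 1"
    "\<And>t. t \<in> {-\<delta>\<^sub>1<..<\<delta>\<^sub>1} \<Longrightarrow> (P has_vector_derivative (- A t) ** P t) (at t)"
    using linear_ODE_local_solution[OF bb \<epsilon> smooth_on_imp_continuous_on[OF A'], of "mat 1"] by blast
  obtain \<delta>\<^sub>2 Q where Q: "0 < \<delta>\<^sub>2" "\<delta>\<^sub>2 \<le> \<epsilon>" "Q 0 = mat 1"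
    "\<And>t. t \<in> {-\<delta>\<^sub>2<..<\<delta>\<^sub>2} \<Longrightarrow> (Q has_vector_derivative Q t ** A t) (at t)"
    using linear_ODE_local_solution[OF bounded_bilinear.flip[OF bb] \<epsilon> smooth_on_imp_continuous_on[OF A],
        of "mat 1"] by blast
  define d where "d = min \<delta>\<^sub>1 \<delta>\<^sub>2"
  have d: "0 < d" "d \<le> \<epsilon>" using P Q by (auto simp: d_def)
  have dP: "(P has_vector_derivative (- A t) ** P t) (at t)"
    and dQ: "(Q has_vector_derivative Q t ** A t) (at t)" if "t \<in> {-d<..<d}" for t
    using P(4) Q(4) that by (auto simp: d_def)
  have sub: "{-d<..<d} \<subseteq> {-\<epsilon><..<\<epsilon>}" using d by auto
  have QP: "Q t ** P t = mat 1" if t: "t \<in> {-d<..<d}" for t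
  proof -
    have "((\<lambda>t. Q t ** P t) has_vector_derivative 0) (at u)" if "u \<in> {-d<..<d}" for u
      using has_vector_derivative_matrix_mult[OF dQ[OF that] dP[OF that]]
      by (simp add: matrix_ring matrix_mul_assoc)
    from has_vector_derivative_0_const[OF this t] show ?thesis by (simp add: P Q)
  qed
  have "smooth_on {-d<..<d} P"
    by (rule smooth_on_linear_ODE_solution[OF bb _ smooth_on_subset[OF A' sub] dP]) simp_all
  moreover have "smooth_on {-d<..<d} Q"
    by (rule smooth_on_linear_ODE_solution[OF bounded_bilinear.flip[OF bb] _ smooth_on_subset[OF A sub] dQ])
      simp_all
  moreover have "P t ** Q t = mat 1" if "t \<in> {-d<..<d}" for t
    using QP[OF that] matrix_left_right_inverse by blast
  ultimately show thesis
    using d P(3) Q(3) dP dQ QP by (intro that[of d P Q]) (simp_all add: inverse_flows_def matrix_ring)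
qed

text \<open>The hypothesis on \<open>G\<close> says that the family of forms \<open>G\<close> is parallel. It makes the derivative of
  \<open>P\<^sup>T G P\<close> vanish.\<close>

lemma flow_preserves_form:
  assumes F: "inverse_flows d A P Q" and t: "t \<in> {-d<..<d}"
    and G: "\<And>t. t \<in> {-d<..<d} \<Longrightarrow> (G has_vector_derivative transpose (A t) ** G t + G t ** A t) (at t)"
  shows "transpose (P t) ** G t ** P t = G 0"
proof -
  note F = inverse_flowsD[OF F]
  have "((\<lambda>t. transpose (P t) ** G t ** P t) has_vector_derivative 0) (at u)" if u: "u \<in> {-d<..<d}" for u
  proof -
    have tP: "((\<lambda>t. transpose (P t)) has_vector_derivative transpose (- (A u ** P u))) (at u)"
      by (rule bounded_linear.has_vector_derivative[OF bounded_linear_transpose F(6)[OF u]])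
    have "transpose (- (A u ** P u)) = - (transpose (P u) ** transpose (A u))"
      using linear_neg[OF bounded_linear.linear[OF bounded_linear_transpose], of "A u ** P u"]
      by (simp add: matrix_transpose_mul)
    then show ?thesis
      using has_vector_derivative_matrix_mult[OF has_vector_derivative_matrix_mult[OF tP G[OF u]] F(6)[OF u]]
      by (simp add: matrix_ring matrix_mul_assoc)
  qed
  from has_vector_derivative_0_const[OF this t] show ?thesis by (simp add: F(2))
qed

lemma flow_intertwines:
  assumes F: "inverse_flows d A P Q" and t: "t \<in> {-d<..<d}"
    and J: "\<And>t. t \<in> {-d<..<d} \<Longrightarrow> (J has_vector_derivative J t ** A t - A t ** J t) (at t)"
  shows "Q t ** J t ** P t = J 0"
proof -
  note F = inverse_flowsD[OF F]
  have "((\<lambda>t. Q t ** J t ** P t) has_vector_derivative 0) (at u)" if u: "u \<in> {-d<..<d}" for u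
    using has_vector_derivative_matrix_mult[OF has_vector_derivative_matrix_mult[OF F(7)[OF u] J[OF u]] F(6)[OF u]]
    by (simp add: matrix_ring matrix_mul_assoc)
  from has_vector_derivative_0_const[OF this t] show ?thesis by (simp add: F(2,3))
qed

section \<open>Manifolds in coordinates\<close>

lemma smooth_at_bounded_linear:
  fixes \<A> :: "('x, 'a::euclidean_space) atlas" and f :: "'x \<Rightarrow> 'b::real_normed_vector"
  assumes "bounded_linear h" "smooth_at \<A> f p"
  shows "smooth_at \<A> (\<lambda>q. h (f q)) p"
proof -
  obtain U \<phi> W where U: "(U, \<phi>) \<in> \<A>" "p \<in> U" "open W" "\<phi> p \<in> W" "W \<subseteq> \<phi> ` U"
    "smooth_on W (f \<circ> inv_into U \<phi>)"
    using assms(2) unfolding smooth_at_def by blast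
  have "smooth_on W ((\<lambda>q. h (f q)) \<circ> inv_into U \<phi>)"
    using smooth_on_bounded_linear[OF assms(1) U(3,6)] by (simp add: o_def)
  with U show ?thesis unfolding smooth_at_def by blast
qed

lemma smooth_curve_subset:
  assumes "smooth_curve \<A>' T c" "open T'" "T' \<subseteq> T"
  shows "smooth_curve \<A>' T' c"
  unfolding smooth_curve_def
proof
  fix t assume t: "t \<in> T'"
  then obtain U \<phi> \<delta> where 1: "(U, \<phi>) \<in> \<A>'" "\<delta> > 0" "c ` {t-\<delta><..<t+\<delta>} \<subseteq> U"
    "smooth_on {t-\<delta><..<t+\<delta>} (\<phi> \<circ> c)"
    using assms unfolding smooth_curve_def by blast
  obtain \<delta>' where 2: "\<delta>' > 0" "ball t \<delta>' \<subseteq> T'" using assms(2) t open_contains_ball by blast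
  have sub: "{t - min \<delta> \<delta>'<..<t + min \<delta> \<delta>'} \<subseteq> {t-\<delta><..<t+\<delta>}"
    "{t - min \<delta> \<delta>'<..<t + min \<delta> \<delta>'} \<subseteq> ball t \<delta>'"
    by (auto simp: ball_eq_greaterThanLessThan)
  note sub = sub(1) order_trans[OF sub(2) 2(2)]
  show "\<exists>(U, \<phi>)\<in>\<A>'. \<exists>\<delta>>0. {t-\<delta><..<t+\<delta>} \<subseteq> T' \<and> c ` {t-\<delta><..<t+\<delta>} \<subseteq> U \<and>
      smooth_on {t-\<delta><..<t+\<delta>} (\<phi> \<circ> c)"
    using 1 2(1) sub smooth_on_subset[OF 1(4) sub(1)]
    by (intro bexI[of _ "(U, \<phi>)"]) (auto intro!: exI[of _ "min \<delta> \<delta>'"])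
qed

locale smooth_atlas =
  fixes \<A> :: "('x, 'a::euclidean_space) atlas"
  assumes chart_inj: "(U, \<phi>) \<in> \<A> \<Longrightarrow> inj_on \<phi> U"
    and overlap_open: "(U, \<phi>) \<in> \<A> \<Longrightarrow> (V, \<psi>) \<in> \<A> \<Longrightarrow> open (\<phi> ` (U \<inter> V))"
    and transition_smooth:
      "(U, \<phi>) \<in> \<A> \<Longrightarrow> (V, \<psi>) \<in> \<A> \<Longrightarrow> smooth_on (\<phi> ` (U \<inter> V)) (\<psi> \<circ> inv_into U \<phi>)"
begin

lemma chart_open: "(U, \<phi>) \<in> \<A> \<Longrightarrow> open (\<phi> ` U)"
  using overlap_open[of U \<phi> U \<phi>] by simp

lemma inv_chart: "(U, \<phi>) \<in> \<A> \<Longrightarrow> p \<in> U \<Longrightarrow> inv_into U \<phi> (\<phi> p) = p"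
  using chart_inj inv_into_f_f by metis

text \<open>The chart in \<open>smooth_at\<close> may be chosen freely, as the transition maps are smooth. The same
  holds for \<open>smooth_curve\<close> below.\<close>

lemma smooth_at_in_chart:
  assumes f: "smooth_at \<A> f p" and V: "(V, \<psi>) \<in> \<A>" "p \<in> V"
  obtains W where "open W" "\<psi> p \<in> W" "W \<subseteq> \<psi> ` V" "smooth_on W (f \<circ> inv_into V \<psi>)"
proof -
  obtain U \<phi> W\<^sub>0 where U: "(U, \<phi>) \<in> \<A>" "p \<in> U" and W0: "open W\<^sub>0" "\<phi> p \<in> W\<^sub>0" "W\<^sub>0 \<subseteq> \<phi> ` U"
    "smooth_on W\<^sub>0 (f \<circ> inv_into U \<phi>)"
    using f unfolding smooth_at_def by blast
  define \<tau> where "\<tau> = \<phi> \<circ> inv_into V \<psi>"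
  have \<tau>: "smooth_on (\<psi> ` (V \<inter> U)) \<tau>" "open (\<psi> ` (V \<inter> U))"
    using transition_smooth[OF V(1) U(1)] overlap_open[OF V(1) U(1)] by (auto simp: \<tau>_def)
  define W where "W = \<psi> ` (V \<inter> U) \<inter> \<tau> -` W\<^sub>0"
  have W: "open W"
    unfolding W_def using \<tau> W0(1)
    by (intro continuous_open_preimage smooth_on_imp_continuous_on)
  have eq: "(f \<circ> inv_into V \<psi>) x = (f \<circ> inv_into U \<phi>) (\<tau> x)" if "x \<in> W" for x
    using that by (auto simp: W_def \<tau>_def inv_chart[OF U(1)] inv_chart[OF V(1)])
  have "smooth_on W (\<lambda>x. (f \<circ> inv_into U \<phi>) (\<tau> x))"
  proof (rule smooth_on_compose[OF W W0(1) _ _ W0(4)])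
    show "smooth_on W \<tau>" by (rule smooth_on_subset[OF \<tau>(1)]) (simp add: W_def)
  qed (auto simp: W_def)
  then have "smooth_on W (f \<circ> inv_into V \<psi>)"
    by (rule smooth_on_eqI) (use W eq in auto)
  moreover have "\<psi> p \<in> W"
    using V U W0(2) by (auto simp: W_def \<tau>_def inv_chart)
  ultimately show thesis using that W by (auto simp: W_def)
qed

lemma smooth_at_chartI:
  assumes "(U, \<phi>) \<in> \<A>" "p \<in> U" "open W" "\<phi> p \<in> W" "W \<subseteq> \<phi> ` U" "smooth_on W h"
    "\<And>q. q \<in> U \<Longrightarrow> \<phi> q \<in> W \<Longrightarrow> f q = h (\<phi> q)"
  shows "smooth_at \<A> f p"
proof -
  have "(f \<circ> inv_into U \<phi>) x = h x" if "x \<in> W" for x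
    using assms(5,7) that by (auto simp: inv_chart[OF assms(1)])
  then have "smooth_on W (f \<circ> inv_into U \<phi>)"
    by (rule smooth_on_eqI[OF assms(6,3)])
  then show ?thesis using assms unfolding smooth_at_def by blast
qed

lemma smooth_curve_in_chart:
  assumes c: "smooth_curve \<A> T c" "t \<in> T" and V: "(V, \<psi>) \<in> \<A>" "c t \<in> V"
  obtains \<delta> where "\<delta> > 0" "{t-\<delta><..<t+\<delta>} \<subseteq> T" "c ` {t-\<delta><..<t+\<delta>} \<subseteq> V"
    "smooth_on {t-\<delta><..<t+\<delta>} (\<psi> \<circ> c)"
proof -
  obtain U \<phi> \<delta>\<^sub>0 where U: "(U, \<phi>) \<in> \<A>" and \<delta>0: "\<delta>\<^sub>0 > 0" "{t-\<delta>\<^sub>0<..<t+\<delta>\<^sub>0} \<subseteq> T"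
    "c ` {t-\<delta>\<^sub>0<..<t+\<delta>\<^sub>0} \<subseteq> U" "smooth_on {t-\<delta>\<^sub>0<..<t+\<delta>\<^sub>0} (\<phi> \<circ> c)"
    using c unfolding smooth_curve_def by blast
  define I where "I = {t-\<delta>\<^sub>0<..<t+\<delta>\<^sub>0} \<inter> (\<phi> \<circ> c) -` (\<phi> ` (U \<inter> V))"
  have "open I" unfolding I_def
    using \<delta>0(4) overlap_open[OF U V(1)]
    by (intro continuous_open_preimage smooth_on_imp_continuous_on) auto
  moreover have "t \<in> I" using \<delta>0(1,3) V(2) by (auto simp: I_def image_subset_iff)
  ultimately obtain \<delta> where \<delta>: "\<delta> > 0" "ball t \<delta> \<subseteq> I"
    using open_contains_ball by blast
  let ?J = "{t-\<delta><..<t+\<delta>}"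
  have J: "?J \<subseteq> I" using \<delta>(2) by (simp add: ball_eq_greaterThanLessThan)
  have cUV: "c u \<in> U \<inter> V" if "u \<in> ?J" for u
  proof -
    have "u \<in> I" using J that by blast
    then have "\<phi> (c u) \<in> \<phi> ` (U \<inter> V)" and "c u \<in> U"
      using \<delta>0(3) by (auto simp: I_def)
    then obtain q where "q \<in> U \<inter> V" "\<phi> (c u) = \<phi> q" "c u \<in> U"
      by blast
    then show ?thesis using inj_onD[OF chart_inj[OF U], of "c u" q] by auto
  qed
  have "smooth_on ?J (\<lambda>u. (\<psi> \<circ> inv_into U \<phi>) ((\<phi> \<circ> c) u))"
  proof (rule smooth_on_compose[OF _ overlap_open[OF U V(1)] _ _ transition_smooth[OF U V(1)]])
    show "smooth_on ?J (\<phi> \<circ> c)"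
      by (rule smooth_on_subset[OF \<delta>0(4)]) (use J in \<open>auto simp: I_def\<close>)
  qed (use cUV in auto)
  moreover have "(\<psi> \<circ> inv_into U \<phi>) ((\<phi> \<circ> c) u) = (\<psi> \<circ> c) u" if "u \<in> ?J" for u
    using cUV[OF that] by (simp add: inv_chart[OF U])
  ultimately have "smooth_on ?J (\<psi> \<circ> c)"
    by (intro smooth_on_eqI[of ?J "\<lambda>u. (\<psi> \<circ> inv_into U \<phi>) ((\<phi> \<circ> c) u)" "\<psi> \<circ> c"]) simp_all
  then show thesis
  proof (intro that[OF \<delta>(1)])
    show "?J \<subseteq> T" using J \<delta>0(2) by (auto simp: I_def)
    show "c ` ?J \<subseteq> V" using cUV by blast
  qed
qed

lemma smooth_curveI_chart:
  assumes "open T" "(U, \<phi>) \<in> \<A>" "c ` T \<subseteq> U" "smooth_on T (\<phi> \<circ> c)"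
  shows "smooth_curve \<A> T c"
  unfolding smooth_curve_def
proof
  fix t assume "t \<in> T"
  then obtain \<delta> where "\<delta> > 0" "ball t \<delta> \<subseteq> T"
    using assms(1) open_contains_ball by blast
  then show "\<exists>(U, \<phi>)\<in>\<A>. \<exists>\<delta>>0. {t-\<delta><..<t+\<delta>} \<subseteq> T \<and> c ` {t-\<delta><..<t+\<delta>} \<subseteq> U \<and>
      smooth_on {t-\<delta><..<t+\<delta>} (\<phi> \<circ> c)"
    using assms smooth_on_subset[OF assms(4)]
    by (intro bexI[of _ "(U, \<phi>)"]) (auto simp: ball_eq_greaterThanLessThan intro!: exI[of _ \<delta>])
qed

lemma smooth_curve_chartD:
  assumes "smooth_curve \<A> T c" "(U, \<phi>) \<in> \<A>" "c ` T \<subseteq> U"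
  shows "smooth_on T (\<phi> \<circ> c)"
proof (rule smooth_on_local)
  fix t assume t: "t \<in> T"
  obtain \<delta> where "\<delta> > 0" "{t-\<delta><..<t+\<delta>} \<subseteq> T" "c ` {t-\<delta><..<t+\<delta>} \<subseteq> U"
    "smooth_on {t-\<delta><..<t+\<delta>} (\<phi> \<circ> c)"
    using smooth_curve_in_chart[OF assms(1) t assms(2)] assms(3) t by blast
  then show "\<exists>W'. open W' \<and> t \<in> W' \<and> smooth_on W' (\<phi> \<circ> c)"
    by (intro exI[of _ "{t-\<delta><..<t+\<delta>}"]) auto
qed

lemma smooth_curve_of_coords:
  assumes "open T" "(U, \<phi>) \<in> \<A>" "y ` T \<subseteq> \<phi> ` U" "smooth_on T y"
  shows "smooth_curve \<A> T (inv_into U \<phi> \<circ> y)"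
proof (rule smooth_curveI_chart[OF assms(1,2)])
  show "(inv_into U \<phi> \<circ> y) ` T \<subseteq> U"
    using assms(3) by (auto simp: inv_into_into image_subset_iff)
  have "smooth_on T (\<phi> \<circ> (inv_into U \<phi> \<circ> y)) \<longleftrightarrow> smooth_on T y"
    using assms(3) by (intro smooth_on_cong assms) (auto simp: f_inv_into_f)
  then show "smooth_on T (\<phi> \<circ> (inv_into U \<phi> \<circ> y))" using assms(4) by blast
qed

text \<open>The tangent vector whose coordinates are \<open>v\<close>. The value \<open>0\<close> on functions that are not smooth is the
  normalisation chosen for velocities.\<close>

definition chart_vec :: "'x set \<Rightarrow> ('x \<Rightarrow> 'a) \<Rightarrow> 'x \<Rightarrow> 'a \<Rightarrow> 'x tvec" where
  "chart_vec U \<phi> p v =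
     (\<lambda>f. if smooth_at \<A> f p then frechet_derivative (f \<circ> inv_into U \<phi>) (at (\<phi> p)) v else 0)"

lemma smooth_at_differentiable:
  assumes "smooth_at \<A> f p" "(U, \<phi>) \<in> \<A>" "p \<in> U"
  shows "(f \<circ> inv_into U \<phi>) differentiable (at (\<phi> p))"
  using smooth_at_in_chart[OF assms] smooth_on_imp_differentiable by metis

lemma velocity_chart:
  assumes c: "smooth_curve \<A> T c" "t \<in> T" and U: "(U, \<phi>) \<in> \<A>" "c t \<in> U"
  shows "velocity \<A> c t = chart_vec U \<phi> (c t) (vector_derivative (\<phi> \<circ> c) (at t))"
proof
  fix f :: "'x \<Rightarrow> real"
  obtain \<delta> where \<delta>: "\<delta> > 0" "c ` {t-\<delta><..<t+\<delta>} \<subseteq> U" "smooth_on {t-\<delta><..<t+\<delta>} (\<phi> \<circ> c)"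
    using smooth_curve_in_chart[OF assms] by metis
  show "velocity \<A> c t f = chart_vec U \<phi> (c t) (vector_derivative (\<phi> \<circ> c) (at t)) f"
  proof (cases "smooth_at \<A> f (c t)")
    case True
    let ?D = "frechet_derivative (f \<circ> inv_into U \<phi>) (at (\<phi> (c t)))"
    let ?v = "vector_derivative (\<phi> \<circ> c) (at t)"
    have "((f \<circ> inv_into U \<phi>) has_derivative ?D) (at ((\<phi> \<circ> c) t))"
      using smooth_at_differentiable[OF True U] by (simp add: frechet_derivative_works)
    moreover have "((\<phi> \<circ> c) has_vector_derivative ?v) (at t)"
      using \<delta> by (intro smooth_on_vector_derivative) auto
    ultimately have *: "((f \<circ> inv_into U \<phi>) \<circ> (\<phi> \<circ> c) has_vector_derivative ?D ?v) (at t)"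
      using vector_derivative_diff_chain_within[of "\<phi> \<circ> c" ?v t UNIV "f \<circ> inv_into U \<phi>" ?D]
      by (simp add: has_derivative_at_withinI)
    have "((\<lambda>u. f (c u)) has_vector_derivative ?D ?v) (at t)"
    proof (rule has_vector_derivative_transform_within_open[OF *, of "{t-\<delta><..<t+\<delta>}"])
      fix u assume "u \<in> {t-\<delta><..<t+\<delta>}"
      then have "c u \<in> U" using \<delta>(2) by blast
      then show "((f \<circ> inv_into U \<phi>) \<circ> (\<phi> \<circ> c)) u = f (c u)" by (simp add: inv_chart[OF U(1)])
    qed (use \<delta>(1) in auto)
    then have "deriv (\<lambda>u. f (c u)) t = ?D ?v"
      by (intro DERIV_imp_deriv) (simp add: has_real_derivative_iff_has_vector_derivative)
    then show ?thesis using True by (simp add: velocity_def chart_vec_def)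
  qed (simp add: velocity_def chart_vec_def)
qed

lemma chart_vec_linear:
  assumes "(U, \<phi>) \<in> \<A>" "p \<in> U"
  shows "chart_vec U \<phi> p (a *\<^sub>R v + b *\<^sub>R w) = (\<lambda>f. a * chart_vec U \<phi> p v f + b * chart_vec U \<phi> p w f)"
proof
  fix f :: "'x \<Rightarrow> real"
  have "linear (frechet_derivative (f \<circ> inv_into U \<phi>) (at (\<phi> p)))" if "smooth_at \<A> f p"
    using smooth_at_differentiable[OF that assms] by (rule linear_frechet_derivative)
  then show "chart_vec U \<phi> p (a *\<^sub>R v + b *\<^sub>R w) f = a * chart_vec U \<phi> p v f + b * chart_vec U \<phi> p w f"
    by (auto simp: chart_vec_def linear_add linear_scale)
qed

lemma chart_vec_0: "(U, \<phi>) \<in> \<A> \<Longrightarrow> p \<in> U \<Longrightarrow> chart_vec U \<phi> p 0 = (\<lambda>f. 0)"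
  using chart_vec_linear[of U \<phi> p 0 0 0 0] by simp

text \<open>Applied to the coordinate functions, a tangent vector returns its coordinates.\<close>

lemma chart_vec_inj:
  assumes U: "(U, \<phi>) \<in> \<A>" "p \<in> U" and eq: "chart_vec U \<phi> p v = chart_vec U \<phi> p w"
  shows "v = w"
proof (rule euclidean_eqI)
  fix b :: 'a assume "b \<in> Basis"
  define f where "f q = \<phi> q \<bullet> b" for q
  have sm: "smooth_at \<A> f p"
    by (rule smooth_at_chartI[OF U chart_open[OF U(1)] _ _
          smooth_on_linear[OF bounded_linear_inner_left[of b]]])
      (use U in \<open>auto simp: f_def\<close>)
  have d: "((f \<circ> inv_into U \<phi>) has_derivative (\<lambda>x. x \<bullet> b)) (at (\<phi> p))"
  proof (rule has_derivative_transform_within_open[OF _ chart_open[OF U(1)]])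
    show "((\<lambda>x. x \<bullet> b) has_derivative (\<lambda>x. x \<bullet> b)) (at (\<phi> p))"
      by (rule bounded_linear_imp_has_derivative[OF bounded_linear_inner_left])
  qed (use U in \<open>auto simp: f_def inv_chart\<close>)
  have "chart_vec U \<phi> p u f = u \<bullet> b" for u
    using sm by (simp add: chart_vec_def frechet_derivative_at[OF d, symmetric])
  then show "v \<bullet> b = w \<bullet> b" using eq by metis
qed

lemma line_in_chart:
  assumes U: "(U, \<phi>) \<in> \<A>" "p \<in> U"
  obtains c \<epsilon> where "\<epsilon> > 0" "smooth_curve \<A> {-\<epsilon><..<\<epsilon>} c" "c 0 = p" "c ` {-\<epsilon><..<\<epsilon>} \<subseteq> U"
    "\<And>t. t \<in> {-\<epsilon><..<\<epsilon>} \<Longrightarrow> (\<phi> \<circ> c) t = \<phi> p + t *\<^sub>R v"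
    "((\<phi> \<circ> c) has_vector_derivative v) (at 0)"
proof -
  define y where "y t = \<phi> p + t *\<^sub>R v" for t :: real
  have ys: "smooth_on T y" if "open T" for T
    unfolding y_def
    by (intro smooth_on_add smooth_on_const smooth_on_linear bounded_linear_scaleR_left that)
  have "open (UNIV \<inter> y -` (\<phi> ` U))"
    by (intro continuous_open_preimage smooth_on_imp_continuous_on ys chart_open[OF U(1)]) auto
  moreover have "0 \<in> UNIV \<inter> y -` (\<phi> ` U)" using U by (simp add: y_def)
  ultimately obtain \<epsilon> where \<epsilon>: "\<epsilon> > 0" "ball 0 \<epsilon> \<subseteq> UNIV \<inter> y -` (\<phi> ` U)"
    using open_contains_ball by blast
  let ?T = "{-\<epsilon><..<\<epsilon>}"
  have yT: "y t \<in> \<phi> ` U" if "t \<in> ?T" for t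
    using \<epsilon>(2) that by (auto simp: ball_eq_greaterThanLessThan)
  define c where "c = inv_into U \<phi> \<circ> y"
  have \<phi>c: "(\<phi> \<circ> c) t = y t" if "t \<in> ?T" for t
    using yT[OF that] by (simp add: c_def f_inv_into_f)
  have d: "(y has_vector_derivative v) (at 0)"
    unfolding y_def by (auto intro!: derivative_eq_intros)
  show thesis
  proof (rule that[OF \<epsilon>(1)])
    show "smooth_curve \<A> ?T c"
      unfolding c_def using yT by (intro smooth_curve_of_coords U ys) auto
    show "c 0 = p" using U by (simp add: c_def y_def inv_chart)
    show "c ` ?T \<subseteq> U" using yT by (auto simp: c_def inv_into_into)
    show "(\<phi> \<circ> c) t = \<phi> p + t *\<^sub>R v" if "t \<in> ?T" for t
      using \<phi>c[OF that] by (simp add: y_def)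
    show "((\<phi> \<circ> c) has_vector_derivative v) (at 0)"
      by (rule has_vector_derivative_transform_within_open[OF d, of ?T]) (use \<epsilon> \<phi>c in auto)
  qed
qed

lemma tangent_space_UNIV:
  assumes U: "(U, \<phi>) \<in> \<A>" "p \<in> U"
  shows "tangent_space \<A> UNIV p = range (chart_vec U \<phi> p)"
proof
  show "tangent_space \<A> UNIV p \<subseteq> range (chart_vec U \<phi> p)"
    unfolding tangent_space_def using velocity_chart[OF _ _ U(1)] U(2) by fastforce
  show "range (chart_vec U \<phi> p) \<subseteq> tangent_space \<A> UNIV p"
  proof
    fix X assume "X \<in> range (chart_vec U \<phi> p)"
    then obtain v where X: "X = chart_vec U \<phi> p v" by blast
    obtain c \<epsilon> where c: "\<epsilon> > 0" "smooth_curve \<A> {-\<epsilon><..<\<epsilon>} c" "c 0 = p"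
      "((\<phi> \<circ> c) has_vector_derivative v) (at 0)"
      using line_in_chart[OF U] by metis
    have "velocity \<A> c 0 = X"
      using velocity_chart[OF c(2) _ U(1)] c U(2) vector_derivative_at[OF c(4)] by (simp add: X)
    then show "X \<in> tangent_space \<A> UNIV p"
      unfolding tangent_space_def using c by blast
  qed
qed

lemma smooth_at_along_curve:
  assumes f: "smooth_at \<A> f (c t)" and c: "smooth_curve \<A> T c" "t \<in> T"
  obtains \<delta> where "\<delta> > 0" "{t-\<delta><..<t+\<delta>} \<subseteq> T" "smooth_on {t-\<delta><..<t+\<delta>} (f \<circ> c)"
proof -
  obtain U \<phi> where U: "(U, \<phi>) \<in> \<A>" "c t \<in> U"
    using f unfolding smooth_at_def by blast
  obtain W where W: "open W" "\<phi> (c t) \<in> W" "W \<subseteq> \<phi> ` U" "smooth_on W (f \<circ> inv_into U \<phi>)"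
    using smooth_at_in_chart[OF f U] by metis
  obtain \<delta>\<^sub>0 where \<delta>0: "\<delta>\<^sub>0 > 0" "{t-\<delta>\<^sub>0<..<t+\<delta>\<^sub>0} \<subseteq> T" "c ` {t-\<delta>\<^sub>0<..<t+\<delta>\<^sub>0} \<subseteq> U"
    "smooth_on {t-\<delta>\<^sub>0<..<t+\<delta>\<^sub>0} (\<phi> \<circ> c)"
    using smooth_curve_in_chart[OF c U] by metis
  let ?I = "{t-\<delta>\<^sub>0<..<t+\<delta>\<^sub>0} \<inter> (\<phi> \<circ> c) -` W"
  have "open ?I"
    by (intro continuous_open_preimage smooth_on_imp_continuous_on \<delta>0 W) auto
  moreover have "t \<in> ?I" using \<delta>0 W by auto
  ultimately obtain \<delta> where \<delta>: "\<delta> > 0" "ball t \<delta> \<subseteq> ?I"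
    using open_contains_ball by blast
  let ?J = "{t-\<delta><..<t+\<delta>}"
  have J: "?J \<subseteq> ?I" using \<delta>(2) by (simp add: ball_eq_greaterThanLessThan)
  have "smooth_on ?J (\<lambda>u. (f \<circ> inv_into U \<phi>) ((\<phi> \<circ> c) u))"
    by (rule smooth_on_compose[OF _ W(1) _ smooth_on_subset[OF \<delta>0(4)] W(4)]) (use J in auto)
  moreover have "(f \<circ> inv_into U \<phi>) ((\<phi> \<circ> c) u) = (f \<circ> c) u" if "u \<in> ?J" for u
  proof -
    have "c u \<in> U" using that J \<delta>0(3) by blast
    then show ?thesis by (simp add: inv_chart[OF U(1)])
  qed
  ultimately have "smooth_on ?J (f \<circ> c)"
    by (intro smooth_on_eqI[of ?J "\<lambda>u. (f \<circ> inv_into U \<phi>) ((\<phi> \<circ> c) u)" "f \<circ> c"]) simp_all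
  then show thesis using that[OF \<delta>(1)] J \<delta>0(2) by blast
qed

lemma smooth_at_on_curve:
  assumes "smooth_curve \<A> T c" "\<And>t. t \<in> T \<Longrightarrow> smooth_at \<A> f (c t)"
  shows "smooth_on T (f \<circ> c)"
proof (rule smooth_on_local)
  fix t assume t: "t \<in> T"
  obtain \<delta> where "\<delta> > 0" "smooth_on {t-\<delta><..<t+\<delta>} (f \<circ> c)"
    using smooth_at_along_curve[OF assms(2)[OF t] assms(1) t] by metis
  then show "\<exists>W. open W \<and> t \<in> W \<and> smooth_on W (f \<circ> c)"
    by (intro exI[of _ "{t-\<delta><..<t+\<delta>}"]) auto
qed

lemma velocity_derivative:
  assumes "smooth_curve \<A> T c" "t \<in> T" "smooth_at \<A> f (c t)"
  shows "((\<lambda>u. f (c u)) has_real_derivative velocity \<A> c t f) (at t)"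
proof -
  obtain \<delta> where "\<delta> > 0" "smooth_on {t-\<delta><..<t+\<delta>} (f \<circ> c)"
    using smooth_at_along_curve[OF assms(3,1,2)] by metis
  then have "(f \<circ> c) differentiable (at t)"
    by (intro smooth_on_imp_differentiable) auto
  then have "(\<lambda>u. f (c u)) field_differentiable (at t)"
    by (metis comp_def field_differentiable_def real_differentiable_def ext)
  then show ?thesis
    using assms(3) by (simp add: velocity_def field_differentiable_derivI)
qed

lemma coordinate_vector_field:
  assumes U: "(U, \<phi>) \<in> \<A>"
  shows "vector_field \<A> U (\<lambda>q. chart_vec U \<phi> q v)"
  unfolding vector_field_def
proof (intro ballI conjI allI impI)
  fix p assume p: "p \<in> U"
  show "chart_vec U \<phi> p v \<in> tangent_space \<A> UNIV p"
    using tangent_space_UNIV[OF U p] by blast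
  fix f :: "'x \<Rightarrow> real" assume f: "smooth_at \<A> f p"
  obtain W where W: "open W" "\<phi> p \<in> W" "W \<subseteq> \<phi> ` U" "smooth_on W (f \<circ> inv_into U \<phi>)"
    using smooth_at_in_chart[OF f U p] by metis
  show "smooth_at \<A> (\<lambda>q. chart_vec U \<phi> q v f) p"
  proof (rule smooth_at_chartI[OF U p W(1-3) smooth_on_frechet_derivative[OF W(4), of v]])
    fix q assume q: "q \<in> U" "\<phi> q \<in> W"
    have "smooth_at \<A> f q"
      by (rule smooth_at_chartI[OF U q(1) W(1) q(2) W(3,4)]) (simp add: inv_chart[OF U])
    then show "chart_vec U \<phi> q v f = frechet_derivative (f \<circ> inv_into U \<phi>) (at (\<phi> q)) v"
      by (simp add: chart_vec_def)
  qed
qed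

lemma smooth_at_chartD:
  assumes U: "(U, \<phi>) \<in> \<A>" and W: "\<And>p. p \<in> U \<inter> W \<Longrightarrow> smooth_at \<A> f p"
  shows "smooth_on (\<phi> ` (U \<inter> W)) (f \<circ> inv_into U \<phi>)"
proof (rule smooth_on_local)
  fix x assume "x \<in> \<phi> ` (U \<inter> W)"
  then obtain p where p: "p \<in> U \<inter> W" "x = \<phi> p" by blast
  then show "\<exists>W'. open W' \<and> x \<in> W' \<and> smooth_on W' (f \<circ> inv_into U \<phi>)"
    using smooth_at_in_chart[OF W[OF p(1)] U] by (metis IntD1)
qed

lemma smooth_at_bilinear:
  assumes b: "bounded_bilinear b" and f: "smooth_at \<A> f p" and g: "smooth_at \<A> g p"
  shows "smooth_at \<A> (\<lambda>q. b (f q) (g q)) p"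
proof -
  obtain U \<phi> where U: "(U, \<phi>) \<in> \<A>" "p \<in> U"
    using f unfolding smooth_at_def by blast
  obtain W where W: "open W" "\<phi> p \<in> W" "W \<subseteq> \<phi> ` U" "smooth_on W (f \<circ> inv_into U \<phi>)"
    using smooth_at_in_chart[OF f U] by metis
  obtain W' where W': "open W'" "\<phi> p \<in> W'" "smooth_on W' (g \<circ> inv_into U \<phi>)"
    using smooth_at_in_chart[OF g U] by metis
  have "smooth_on (W \<inter> W') (\<lambda>x. b ((f \<circ> inv_into U \<phi>) x) ((g \<circ> inv_into U \<phi>) x))"
    by (rule smooth_on_bilinear[OF b open_Int[OF W(1) W'(1)]
          smooth_on_subset[OF W(4) Int_lower1] smooth_on_subset[OF W'(3) Int_lower2]])
  note h = this
  show ?thesis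
    by (rule smooth_at_chartI[OF U _ _ _ h])
      (use W(1-3) W'(1,2) in \<open>auto simp: inv_chart[OF U(1)]\<close>)
qed

lemma smooth_at_const:
  assumes "(U, \<phi>) \<in> \<A>" "p \<in> U" shows "smooth_at \<A> (\<lambda>q. c) p"
  by (rule smooth_at_chartI[OF assms chart_open[OF assms(1)] _ _ smooth_on_const]) (use assms in auto)

lemma smooth_at_add:
  assumes f: "smooth_at \<A> f p" and g: "smooth_at \<A> g p"
  shows "smooth_at \<A> (\<lambda>q. f q + g q) p"
proof -
  obtain U \<phi> where U: "(U, \<phi>) \<in> \<A>" "p \<in> U"
    using f unfolding smooth_at_def by blast
  obtain W where W: "open W" "\<phi> p \<in> W" "W \<subseteq> \<phi> ` U" "smooth_on W (f \<circ> inv_into U \<phi>)"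
    using smooth_at_in_chart[OF f U] by metis
  obtain W' where W': "open W'" "\<phi> p \<in> W'" "smooth_on W' (g \<circ> inv_into U \<phi>)"
    using smooth_at_in_chart[OF g U] by metis
  have "smooth_on (W \<inter> W') (\<lambda>x. (f \<circ> inv_into U \<phi>) x + (g \<circ> inv_into U \<phi>) x)"
    by (rule smooth_on_add[OF open_Int[OF W(1) W'(1)]
          smooth_on_subset[OF W(4) Int_lower1] smooth_on_subset[OF W'(3) Int_lower2]])
  note h = this
  show ?thesis
    by (rule smooth_at_chartI[OF U _ _ _ h])
      (use W(1-3) W'(1,2) in \<open>auto simp: inv_chart[OF U(1)]\<close>)
qed

lemma smooth_at_sum:
  assumes U: "(U, \<phi>) \<in> \<A>" "p \<in> U" and "finite I" "\<And>i. i \<in> I \<Longrightarrow> smooth_at \<A> (f i) p"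
  shows "smooth_at \<A> (\<lambda>q. \<Sum>i\<in>I. f i q) p"
  using assms(3,4)
  by (induction I rule: finite_induct) (auto intro: smooth_at_add smooth_at_const[OF U])

lemma smooth_at_vec:
  fixes f :: "'x \<Rightarrow> 'b::real_normed_vector^'n::finite"
  assumes "\<And>i. smooth_at \<A> (\<lambda>q. f q $ i) p"
  shows "smooth_at \<A> f p"
proof -
  obtain U \<phi> where U: "(U, \<phi>) \<in> \<A>" "p \<in> U"
    using assms[of undefined] unfolding smooth_at_def by blast
  have eq: "f = (\<lambda>x. \<Sum>i\<in>UNIV. axis i (f x $ i))"
    by (simp add: fun_eq_iff vec_eq_iff axis_def if_distrib cong: if_cong)
  have "smooth_at \<A> (\<lambda>x. \<Sum>i\<in>UNIV. axis i (f x $ i)) p"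
    by (intro smooth_at_sum[OF U] smooth_at_bounded_linear[OF bounded_linear_axis] assms) auto
  then show ?thesis by (subst eq)
qed

lemma smooth_at_nth: "smooth_at \<A> f p \<Longrightarrow> smooth_at \<A> (\<lambda>q. f q $ i) p"
  by (rule smooth_at_bounded_linear[OF bounded_linear_vec_nth])

definition tvec_deriv :: "'x tvec \<Rightarrow> ('x \<Rightarrow> real^'n::finite) \<Rightarrow> real^'n" where
  "tvec_deriv X y = (\<chi> i. X (\<lambda>q. y q $ i))"

lemma velocity_vec_derivative:
  assumes "smooth_curve \<A> T c" "t \<in> T" "smooth_at \<A> y (c t)"
  shows "((\<lambda>u. y (c u)) has_vector_derivative tvec_deriv (velocity \<A> c t) y) (at t)"
  by (rule has_vector_derivative_vec)
    (simp add: tvec_deriv_def velocity_derivative[OF assms(1,2) smooth_at_nth[OF assms(3)]]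
      flip: has_real_derivative_iff_has_vector_derivative)

lemma velocity_in_tangent_space:
  assumes "smooth_curve \<A> T c" "t \<in> T"
  shows "velocity \<A> c t \<in> tangent_space \<A> UNIV (c t)"
proof -
  obtain U \<phi> \<delta> where U: "(U, \<phi>) \<in> \<A>" "\<delta> > 0" "c ` {t-\<delta><..<t+\<delta>} \<subseteq> U"
    using assms unfolding smooth_curve_def by blast
  then have U: "(U, \<phi>) \<in> \<A>" "c t \<in> U" by auto
  show ?thesis
    using velocity_chart[OF assms U] tangent_space_UNIV[OF U] by blast
qed

end

section \<open>The manifold of endomorphisms of a bundle\<close>

locale smooth_vector_bundle = smooth_atlas \<A>
  for \<A> :: "('m::topological_space, 'a::euclidean_space) atlas" +
  fixes E :: "'m \<Rightarrow> 'v::real_vector set" and \<B> :: "('m, 'v, 'k::finite) trivs"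
  assumes chart_dom_open: "(U, \<phi>) \<in> \<A> \<Longrightarrow> open U"
    and chart_image_open: "(U, \<phi>) \<in> \<A> \<Longrightarrow> open W \<Longrightarrow> open (\<phi> ` (U \<inter> W))"
    and charts_cover: "\<exists>(U, \<phi>)\<in>\<A>. p \<in> U"
    and vector_bundle: "vector_bundle \<A> E \<B>"
begin

lemma fibre_subspace: "subspace (E p)"
  and triv_open: "(V, \<Phi>) \<in> \<B> \<Longrightarrow> open V"
  and triv_linear: "(V, \<Phi>) \<in> \<B> \<Longrightarrow> p \<in> V \<Longrightarrow> linear_on_set (E p) (\<Phi> p)"
  and triv_bij: "(V, \<Phi>) \<in> \<B> \<Longrightarrow> p \<in> V \<Longrightarrow> bij_betw (\<Phi> p) (E p) UNIV"
  and trivs_cover: "\<exists>(V, \<Phi>)\<in>\<B>. p \<in> V"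
  and triv_transition: "(V, \<Phi>) \<in> \<B> \<Longrightarrow> (V', \<Phi>') \<in> \<B> \<Longrightarrow> p \<in> V \<Longrightarrow> p \<in> V' \<Longrightarrow>
    smooth_at \<A> (\<lambda>q. matrix (\<Phi>' q \<circ> inv_into (E q) (\<Phi> q))) p"
  using vector_bundle unfolding vector_bundle_def by fast+

abbreviation untriv :: "('m \<Rightarrow> 'v \<Rightarrow> real^'k) \<Rightarrow> 'm \<Rightarrow> real^'k \<Rightarrow> 'v" where
  "untriv \<Phi> p \<equiv> inv_into (E p) (\<Phi> p)"

lemma untriv_in: "(V, \<Phi>) \<in> \<B> \<Longrightarrow> p \<in> V \<Longrightarrow> untriv \<Phi> p y \<in> E p"
  using triv_bij[of V \<Phi> p] by (metis UNIV_I bij_betw_def inv_into_into)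

lemma triv_untriv: "(V, \<Phi>) \<in> \<B> \<Longrightarrow> p \<in> V \<Longrightarrow> \<Phi> p (untriv \<Phi> p y) = y"
  using triv_bij[of V \<Phi> p] by (metis UNIV_I bij_betw_def f_inv_into_f)

lemma untriv_triv: "(V, \<Phi>) \<in> \<B> \<Longrightarrow> p \<in> V \<Longrightarrow> v \<in> E p \<Longrightarrow> untriv \<Phi> p (\<Phi> p v) = v"
  using triv_bij[of V \<Phi> p] by (metis bij_betw_def inv_into_f_f)

lemma triv_inject: "(V, \<Phi>) \<in> \<B> \<Longrightarrow> p \<in> V \<Longrightarrow> v \<in> E p \<Longrightarrow> w \<in> E p \<Longrightarrow> \<Phi> p v = \<Phi> p w \<Longrightarrow> v = w"
  using untriv_triv by metis

lemma triv_add: "(V, \<Phi>) \<in> \<B> \<Longrightarrow> p \<in> V \<Longrightarrow> v \<in> E p \<Longrightarrow> w \<in> E p \<Longrightarrow> \<Phi> p (v + w) = \<Phi> p v + \<Phi> p w"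
  and triv_scale: "(V, \<Phi>) \<in> \<B> \<Longrightarrow> p \<in> V \<Longrightarrow> v \<in> E p \<Longrightarrow> \<Phi> p (c *\<^sub>R v) = c *\<^sub>R \<Phi> p v"
  using triv_linear unfolding linear_on_set_def by blast+

lemma linear_untriv:
  assumes "(V, \<Phi>) \<in> \<B>" "p \<in> V"
  shows "linear (untriv \<Phi> p)"
proof (rule linearI)
  fix x y c
  show "untriv \<Phi> p (x + y) = untriv \<Phi> p x + untriv \<Phi> p y"
    by (rule triv_inject[OF assms])
      (simp_all add: untriv_in[OF assms] triv_untriv[OF assms] triv_add[OF assms] subspace_add[OF fibre_subspace])
  show "untriv \<Phi> p (c *\<^sub>R x) = c *\<^sub>R untriv \<Phi> p x"
    by (rule triv_inject[OF assms])
      (simp_all add: untriv_in[OF assms] triv_untriv[OF assms] triv_scale[OF assms] subspace_scale[OF fibre_subspace])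
qed

lemma inj_untriv: "(V, \<Phi>) \<in> \<B> \<Longrightarrow> p \<in> V \<Longrightarrow> inj (untriv \<Phi> p)"
  by (rule inj_on_inverseI[where g = "\<Phi> p"]) (simp add: triv_untriv)

lemma triv_sum:
  assumes "(V, \<Phi>) \<in> \<B>" "p \<in> V" "\<And>i. i \<in> I \<Longrightarrow> v i \<in> E p"
  shows "\<Phi> p (\<Sum>i\<in>I. v i) = (\<Sum>i\<in>I. \<Phi> p (v i))"
proof -
  have "(\<Sum>i\<in>I. v i) = untriv \<Phi> p (\<Sum>i\<in>I. \<Phi> p (v i))"
    using assms by (simp add: linear_sum[OF linear_untriv[OF assms(1,2)]] untriv_triv)
  then show ?thesis using triv_untriv[OF assms(1,2)] by simp
qed

lemma local_frame_in: "(V, \<Phi>) \<in> \<B> \<Longrightarrow> p \<in> V \<Longrightarrow> local_frame E \<Phi> i p \<in> E p"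
  by (simp add: local_frame_def untriv_in)

lemma triv_local_frame: "(V, \<Phi>) \<in> \<B> \<Longrightarrow> p \<in> V \<Longrightarrow> \<Phi> p (local_frame E \<Phi> i p) = axis i 1"
  by (simp add: local_frame_def triv_untriv)

lemma untriv_frame:
  assumes "(V, \<Phi>) \<in> \<B>" "p \<in> V"
  shows "untriv \<Phi> p y = (\<Sum>i\<in>UNIV. y $ i *\<^sub>R local_frame E \<Phi> i p)"
proof -
  have "y = (\<Sum>i\<in>UNIV. y $ i *\<^sub>R axis i 1)"
    by (simp add: vec_eq_iff axis_def if_distrib cong: if_cong)
  then have "untriv \<Phi> p y = untriv \<Phi> p (\<Sum>i\<in>UNIV. y $ i *\<^sub>R axis i 1)" by simp
  then show ?thesis
    by (simp add: linear_sum[OF linear_untriv[OF assms]] linear_scale[OF linear_untriv[OF assms]] local_frame_def)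
qed

definition transition :: "('m \<Rightarrow> 'v \<Rightarrow> real^'k) \<Rightarrow> ('m \<Rightarrow> 'v \<Rightarrow> real^'k) \<Rightarrow> 'm \<Rightarrow> real^'k^'k" where
  "transition \<Phi> \<Phi>' q = matrix (\<Phi>' q \<circ> untriv \<Phi> q)"

lemma linear_triv_comp:
  assumes "(V, \<Phi>) \<in> \<B>" "p \<in> V" "linear f" "\<And>y. f y \<in> E p"
  shows "linear (\<lambda>y. \<Phi> p (f y))"
  by (rule linearI) (simp_all add: linear_add[OF assms(3)] linear_scale[OF assms(3)]
      triv_add[OF assms(1,2)] triv_scale[OF assms(1,2)] assms(4))

lemma transition_mult:
  assumes "(V, \<Phi>) \<in> \<B>" "(V', \<Phi>') \<in> \<B>" "p \<in> V" "p \<in> V'"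
  shows "transition \<Phi> \<Phi>' p *v y = \<Phi>' p (untriv \<Phi> p y)"
  using matrix_mult_linear[OF linear_triv_comp[OF assms(2,4) linear_untriv[OF assms(1,3)] untriv_in[OF assms(1,3)]]]
  by (simp add: transition_def o_def)

definition End_mat :: "('m \<Rightarrow> 'v \<Rightarrow> real^'k) \<Rightarrow> 'm \<Rightarrow> ('v \<Rightarrow> 'v) \<Rightarrow> real^'k^'k" where
  "End_mat \<Phi> p A = matrix (\<Phi> p \<circ> A \<circ> untriv \<Phi> p)"

definition End_of :: "('m \<Rightarrow> 'v \<Rightarrow> real^'k) \<Rightarrow> 'm \<Rightarrow> real^'k^'k \<Rightarrow> 'v \<Rightarrow> 'v" where
  "End_of \<Phi> p M v = (if v \<in> E p then untriv \<Phi> p (M *v \<Phi> p v) else 0)"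

lemma End_fibre_in: "A \<in> End_fibre (E p) \<Longrightarrow> v \<in> E p \<Longrightarrow> A v \<in> E p"
  by (auto simp: End_fibre_def)

lemma End_mat_mult:
  assumes "(V, \<Phi>) \<in> \<B>" "p \<in> V" "A \<in> End_fibre (E p)"
  shows "End_mat \<Phi> p A *v y = \<Phi> p (A (untriv \<Phi> p y))"
proof -
  have "linear (\<lambda>y. A (untriv \<Phi> p y))"
    using assms(3) untriv_in[OF assms(1,2)]
    by (intro linearI) (simp_all add: linear_add[OF linear_untriv[OF assms(1,2)]]
        linear_scale[OF linear_untriv[OF assms(1,2)]] End_fibre_def linear_on_set_def)
  from linear_triv_comp[OF assms(1,2) this] show ?thesis
    using End_fibre_in[OF assms(3) untriv_in[OF assms(1,2)]] matrix_mult_linear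
    by (simp add: End_mat_def o_def)
qed

lemma End_mat_apply:
  assumes "(V, \<Phi>) \<in> \<B>" "p \<in> V" "A \<in> End_fibre (E p)" "v \<in> E p"
  shows "\<Phi> p (A v) = End_mat \<Phi> p A *v \<Phi> p v"
  by (simp add: End_mat_mult[OF assms(1-3)] untriv_triv[OF assms(1,2,4)])

lemma End_of_in:
  assumes "(V, \<Phi>) \<in> \<B>" "p \<in> V"
  shows "End_of \<Phi> p M \<in> End_fibre (E p)"
  using linear_untriv[OF assms] untriv_in[OF assms]
  by (auto simp: End_fibre_def linear_on_set_def End_of_def subspace_add[OF fibre_subspace]
      subspace_scale[OF fibre_subspace] triv_add[OF assms] triv_scale[OF assms] linear_add linear_scale
      matrix_vector_right_distrib matrix_vector_mult_scaleR)

lemma End_mat_of: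
  assumes "(V, \<Phi>) \<in> \<B>" "p \<in> V"
  shows "End_mat \<Phi> p (End_of \<Phi> p M) = M"
  by (simp add: matrix_eq End_mat_mult[OF assms End_of_in[OF assms]] End_of_def untriv_in[OF assms]
      triv_untriv[OF assms])

lemma End_of_mat:
  assumes "(V, \<Phi>) \<in> \<B>" "p \<in> V" "A \<in> End_fibre (E p)"
  shows "End_of \<Phi> p (End_mat \<Phi> p A) = A"
proof
  fix v show "End_of \<Phi> p (End_mat \<Phi> p A) v = A v"
    using assms(3) untriv_triv[OF assms(1,2) End_fibre_in[OF assms(3)]]
    by (cases "v \<in> E p") (auto simp: End_of_def End_mat_apply[OF assms, symmetric] End_fibre_def)
qed

definition End_dom :: "'m set \<Rightarrow> 'm set \<Rightarrow> ('m \<times> ('v \<Rightarrow> 'v)) set" where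
  "End_dom U V = {(p, A). p \<in> U \<inter> V \<and> A \<in> End_fibre (E p)}"

definition End_chart :: "('m \<Rightarrow> 'a) \<Rightarrow> ('m \<Rightarrow> 'v \<Rightarrow> real^'k) \<Rightarrow> 'm \<times> ('v \<Rightarrow> 'v) \<Rightarrow> 'a \<times> (real^'k^'k)" where
  "End_chart \<phi> \<Phi> = (\<lambda>(p, A). (\<phi> p, End_mat \<Phi> p A))"

lemma End_atlas_eq:
  "End_atlas \<A> E \<B> = {(End_dom U V, End_chart \<phi> \<Phi>) | U \<phi> V \<Phi>. (U, \<phi>) \<in> \<A> \<and> (V, \<Phi>) \<in> \<B>}"
  unfolding End_atlas_def End_dom_def End_chart_def End_mat_def ..

lemma End_chart_in_atlas:
  "(U, \<phi>) \<in> \<A> \<Longrightarrow> (V, \<Phi>) \<in> \<B> \<Longrightarrow> (End_dom U V, End_chart \<phi> \<Phi>) \<in> End_atlas \<A> E \<B>"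
  unfolding End_atlas_eq by blast

lemma End_chart_inj:
  assumes "(U, \<phi>) \<in> \<A>" "(V, \<Phi>) \<in> \<B>"
  shows "inj_on (End_chart \<phi> \<Phi>) (End_dom U V)"
proof (rule inj_onI)
  fix P Q assume P: "P \<in> End_dom U V" and Q: "Q \<in> End_dom U V"
    and eq: "End_chart \<phi> \<Phi> P = End_chart \<phi> \<Phi> Q"
  obtain p A q B where PQ: "P = (p, A)" "Q = (q, B)" by fastforce
  have "p = q"
    using P Q eq chart_inj[OF assms(1)] by (auto simp: PQ End_chart_def End_dom_def dest: inj_onD)
  then have "A = B"
    using P Q eq End_of_mat[OF assms(2), of p A] End_of_mat[OF assms(2), of p B]
    by (auto simp: PQ End_chart_def End_dom_def)
  with \<open>p = q\<close> show "P = Q" by (simp add: PQ)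
qed

lemma End_chart_inv:
  assumes "(U, \<phi>) \<in> \<A>" "(V, \<Phi>) \<in> \<B>" "p \<in> U" "p \<in> V"
  shows "inv_into (End_dom U V) (End_chart \<phi> \<Phi>) (\<phi> p, M) = (p, End_of \<Phi> p M)"
proof -
  have "(p, End_of \<Phi> p M) \<in> End_dom U V"
    using assms End_of_in[OF assms(2,4)] by (simp add: End_dom_def)
  moreover have "End_chart \<phi> \<Phi> (p, End_of \<Phi> p M) = (\<phi> p, M)"
    by (simp add: End_chart_def End_mat_of[OF assms(2,4)])
  ultimately show ?thesis
    using inv_into_f_f[OF End_chart_inj[OF assms(1,2)]] by metis
qed

lemma End_chart_image:
  assumes "(U, \<phi>) \<in> \<A>" "(V, \<Phi>) \<in> \<B>"
  shows "End_chart \<phi> \<Phi> ` (End_dom U V \<inter> End_dom U' V') = \<phi> ` (U \<inter> (V \<inter> U' \<inter> V')) \<times> UNIV"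
proof
  show "End_chart \<phi> \<Phi> ` (End_dom U V \<inter> End_dom U' V') \<subseteq> \<phi> ` (U \<inter> (V \<inter> U' \<inter> V')) \<times> UNIV"
    by (auto simp: End_chart_def End_dom_def)
  show "\<phi> ` (U \<inter> (V \<inter> U' \<inter> V')) \<times> UNIV \<subseteq> End_chart \<phi> \<Phi> ` (End_dom U V \<inter> End_dom U' V')"
  proof clarify
    fix p M assume p: "p \<in> U" "p \<in> V" "p \<in> U'" "p \<in> V'"
    have "End_chart \<phi> \<Phi> (p, End_of \<Phi> p M) = (\<phi> p, M)"
      by (simp add: End_chart_def End_mat_of[OF assms(2) p(2)])
    moreover have "(p, End_of \<Phi> p M) \<in> End_dom U V \<inter> End_dom U' V'"
      using p End_of_in[OF assms(2) p(2)] by (simp add: End_dom_def)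
    ultimately show "(\<phi> p, M) \<in> End_chart \<phi> \<Phi> ` (End_dom U V \<inter> End_dom U' V')"
      by (metis image_eqI)
  qed
qed

lemma End_mat_change:
  assumes "(V, \<Phi>) \<in> \<B>" "(V', \<Phi>') \<in> \<B>" "p \<in> V" "p \<in> V'" "A \<in> End_fibre (E p)"
  shows "End_mat \<Phi>' p A = transition \<Phi> \<Phi>' p ** End_mat \<Phi> p A ** transition \<Phi>' \<Phi> p"
  using untriv_in[OF assms(2,4)] End_fibre_in[OF assms(5)]
  by (simp add: matrix_eq flip: matrix_vector_mul_assoc)
    (simp add: End_mat_mult[OF assms(1,3,5)] End_mat_mult[OF assms(2,4,5)]
      transition_mult[OF assms(1-4)] transition_mult[OF assms(2,1,4,3)]
      untriv_triv[OF assms(1,3)])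

text \<open>In two trivialisations with transition matrix \<open>T\<close>, the matrices of an endomorphism are related by
  conjugation with \<open>T\<close>. Both \<open>T\<close> and its inverse, the transition matrix in the opposite direction, are
  smooth.\<close>

sublocale End: smooth_atlas "End_atlas \<A> E \<B>"
proof
  fix C \<kappa> assume "(C, \<kappa>) \<in> End_atlas \<A> E \<B>"
  then obtain U \<phi> V \<Phi> where 1: "(U, \<phi>) \<in> \<A>" "(V, \<Phi>) \<in> \<B>" "C = End_dom U V" "\<kappa> = End_chart \<phi> \<Phi>"
    unfolding End_atlas_eq by blast
  show "inj_on \<kappa> C" using End_chart_inj[OF 1(1,2)] by (simp add: 1)
  fix C' \<kappa>' assume "(C', \<kappa>') \<in> End_atlas \<A> E \<B>"
  then obtain U' \<phi>' V' \<Phi>' where 2: "(U', \<phi>') \<in> \<A>" "(V', \<Phi>') \<in> \<B>" "C' = End_dom U' V'" "\<kappa>' = End_chart \<phi>' \<Phi>'"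
    unfolding End_atlas_eq by blast
  define W where "W = V \<inter> U' \<inter> V'"
  have W: "open W"
    using triv_open[OF 1(2)] triv_open[OF 2(2)] chart_dom_open[OF 2(1)] by (auto simp: W_def)
  have im: "\<kappa> ` (C \<inter> C') = \<phi> ` (U \<inter> W) \<times> UNIV"
    unfolding 1 2 W_def by (rule End_chart_image[OF 1(1,2)])
  have oW: "open (\<phi> ` (U \<inter> W))" by (rule chart_image_open[OF 1(1) W])
  then have oim: "open (\<kappa> ` (C \<inter> C'))" unfolding im by (intro open_Times) auto
  then show "open (\<kappa> ` (C \<inter> C'))" .
  define i where "i = inv_into U \<phi>"
  define f where "f = (\<lambda>x. (\<phi>' (i (fst x)),
     transition \<Phi> \<Phi>' (i (fst x)) ** snd x ** transition \<Phi>' \<Phi> (i (fst x))))"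
  have sm_fst: "smooth_on (\<phi> ` (U \<inter> W) \<times> (UNIV :: (real^'k^'k) set)) (\<lambda>x. h (fst x))"
    if "smooth_on (\<phi> ` (U \<inter> W)) h" for h :: "'a \<Rightarrow> 'z::real_normed_vector"
    by (rule smooth_on_compose[OF _ oW _ smooth_on_linear that])
      (auto simp: oW open_Times bounded_linear_fst)
  have sm_tr: "smooth_on (\<phi> ` (U \<inter> W)) (\<lambda>x. h (i x))"
    if "\<And>p. p \<in> U \<inter> W \<Longrightarrow> smooth_at \<A> h p" for h :: "'m \<Rightarrow> real^'k^'k"
    using smooth_at_chartD[OF 1(1) that] by (simp add: o_def i_def)
  have "smooth_on (\<kappa> ` (C \<inter> C')) f"
    unfolding f_def
  proof (intro smooth_on_Pair smooth_on_matrix_mult oim)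
    show "smooth_on (\<kappa> ` (C \<inter> C')) snd"
      by (rule smooth_on_linear[OF bounded_linear_snd])
    have "smooth_on (\<phi> ` (U \<inter> W)) (\<phi>' \<circ> inv_into U \<phi>)"
      by (rule smooth_on_subset[OF transition_smooth[OF 1(1) 2(1)]]) (auto simp: W_def)
    then show "smooth_on (\<kappa> ` (C \<inter> C')) (\<lambda>x. \<phi>' (i (fst x)))"
      unfolding im by (intro sm_fst) (simp add: i_def o_def)
    show "smooth_on (\<kappa> ` (C \<inter> C')) (\<lambda>x. transition \<Phi> \<Phi>' (i (fst x)))"
      unfolding im using triv_transition[OF 1(2) 2(2)]
      by (intro sm_fst sm_tr) (auto simp: W_def transition_def[abs_def])
    show "smooth_on (\<kappa> ` (C \<inter> C')) (\<lambda>x. transition \<Phi>' \<Phi> (i (fst x)))"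
      unfolding im using triv_transition[OF 2(2) 1(2)]
      by (intro sm_fst sm_tr) (auto simp: W_def transition_def[abs_def])
  qed
  then show "smooth_on (\<kappa> ` (C \<inter> C')) (\<kappa>' \<circ> inv_into C \<kappa>)"
  proof (rule smooth_on_eqI[OF _ oim])
    fix x assume "x \<in> \<kappa> ` (C \<inter> C')"
    then obtain p M where p: "p \<in> U" "p \<in> W" and x: "x = (\<phi> p, M)"
      unfolding im by auto
    have V: "p \<in> V" "p \<in> V'" using p by (auto simp: W_def)
    have "inv_into C \<kappa> x = (p, End_of \<Phi> p M)"
      unfolding 1 x by (rule End_chart_inv[OF 1(1,2) p(1) V(1)])
    then show "(\<kappa>' \<circ> inv_into C \<kappa>) x = f x"
      using End_mat_change[OF 1(2) 2(2) V End_of_in[OF 1(2) V(1)], of M]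
      by (simp add: 2 f_def x i_def inv_chart[OF 1(1) p(1)] End_chart_def End_mat_of[OF 1(2) V(1)])
  qed
qed

end

lemma complex_manifold_smooth_atlas:
  assumes "complex_manifold \<A>"
  shows "smooth_atlas \<A>"
    and "(U, \<phi>) \<in> \<A> \<Longrightarrow> open U"
    and "(U, \<phi>) \<in> \<A> \<Longrightarrow> open W \<Longrightarrow> open (\<phi> ` (U \<inter> W))"
    and "\<exists>(U, \<phi>)\<in>\<A>. p \<in> U"
proof -
  have *: "open U" "open (\<phi> ` U)" "homeomorphism U (\<phi> ` U) \<phi> (inv_into U \<phi>)"
    if "(U, \<phi>) \<in> \<A>" for U \<phi>
    using assms that unfolding complex_manifold_def by fast+
  have hol: "holomorphic_map_on (\<phi> ` (U \<inter> V)) (\<psi> \<circ> inv_into U \<phi>)"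
    if "(U, \<phi>) \<in> \<A>" "(V, \<psi>) \<in> \<A>" for U \<phi> V \<psi>
    using assms that unfolding complex_manifold_def by fast
  show "(U, \<phi>) \<in> \<A> \<Longrightarrow> open U" using * by blast
  show op: "open (\<phi> ` (U \<inter> W))" if U: "(U, \<phi>) \<in> \<A>" and W: "open W" for U \<phi> W
  proof -
    have "openin (top_of_set (\<phi> ` U)) (\<phi> ` (U \<inter> W))"
      by (rule homeomorphism_imp_open_map[OF *(3)[OF U]]) (use W in \<open>simp add: openin_open_Int\<close>)
    then show ?thesis using *(2)[OF U] by (metis openin_open_trans)
  qed
  show "\<exists>(U, \<phi>)\<in>\<A>. p \<in> U"
    using assms unfolding complex_manifold_def by fast
  show "smooth_atlas \<A>"
  proof
    fix U \<phi> assume U: "(U, \<phi>) \<in> \<A>"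
    show "inj_on \<phi> U"
      using *(3)[OF U] unfolding homeomorphism_def by (metis inj_on_inverseI)
    fix V \<psi> assume V: "(V, \<psi>) \<in> \<A>"
    show "open (\<phi> ` (U \<inter> V))" by (rule op[OF U *(1)[OF V]])
    show "smooth_on (\<phi> ` (U \<inter> V)) (\<psi> \<circ> inv_into U \<phi>)"
      using hol[OF U V] by (simp add: holomorphic_map_on_def)
  qed
qed

section \<open>Connections in coordinates\<close>

context smooth_vector_bundle begin

lemma smooth_at_cong:
  assumes f: "smooth_at \<A> f p" and N: "open N" "p \<in> N" "\<And>q. q \<in> N \<Longrightarrow> h q = f q"
  shows "smooth_at \<A> h p"
proof -
  obtain U \<phi> where U: "(U, \<phi>) \<in> \<A>" "p \<in> U"
    using f unfolding smooth_at_def by blast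
  obtain W where W: "open W" "\<phi> p \<in> W" "W \<subseteq> \<phi> ` U" "smooth_on W (f \<circ> inv_into U \<phi>)"
    using smooth_at_in_chart[OF f U] by metis
  let ?W = "W \<inter> \<phi> ` (U \<inter> N)"
  show ?thesis
  proof (rule smooth_at_chartI[OF U])
    show "open ?W" using W(1) chart_image_open[OF U(1) N(1)] by blast
    show "\<phi> p \<in> ?W" "?W \<subseteq> \<phi> ` U" using W U N by auto
    show "smooth_on ?W (f \<circ> inv_into U \<phi>)" by (rule smooth_on_subset[OF W(4)]) simp
    fix q assume q: "q \<in> U" "\<phi> q \<in> ?W"
    then have "\<phi> q \<in> \<phi> ` (U \<inter> N)" by blast
    then obtain q' where q': "\<phi> q = \<phi> q'" "q' \<in> U" "q' \<in> N" by blast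
    then have "q \<in> N"
      using inj_onD[OF chart_inj[OF U(1)] q'(1) q(1) q'(2)] by simp
    then show "h q = (f \<circ> inv_into U \<phi>) (\<phi> q)" using N(3) q by (simp add: inv_chart[OF U(1)])
  qed
qed

lemma curve_stays_in_open:
  assumes \<gamma>: "smooth_curve \<A> T \<gamma>" "t \<in> T" and N: "open N" "\<gamma> t \<in> N"
  obtains \<delta> where "\<delta> > 0" "{t-\<delta><..<t+\<delta>} \<subseteq> T" "\<gamma> ` {t-\<delta><..<t+\<delta>} \<subseteq> N"
proof -
  obtain U \<phi> where U: "(U, \<phi>) \<in> \<A>" "\<gamma> t \<in> U" using charts_cover by blast
  obtain \<delta>\<^sub>0 where \<delta>0: "\<delta>\<^sub>0 > 0" "{t-\<delta>\<^sub>0<..<t+\<delta>\<^sub>0} \<subseteq> T" "\<gamma> ` {t-\<delta>\<^sub>0<..<t+\<delta>\<^sub>0} \<subseteq> U"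
    "smooth_on {t-\<delta>\<^sub>0<..<t+\<delta>\<^sub>0} (\<phi> \<circ> \<gamma>)"
    using smooth_curve_in_chart[OF \<gamma> U] by metis
  let ?I = "{t-\<delta>\<^sub>0<..<t+\<delta>\<^sub>0} \<inter> (\<phi> \<circ> \<gamma>) -` (\<phi> ` (U \<inter> N))"
  have "open ?I"
    by (intro continuous_open_preimage smooth_on_imp_continuous_on \<delta>0 chart_image_open[OF U(1) N(1)]) auto
  moreover have "t \<in> ?I" using \<delta>0 U N by auto
  ultimately obtain \<delta> where \<delta>: "\<delta> > 0" "ball t \<delta> \<subseteq> ?I"
    using open_contains_ball by blast
  have J: "{t-\<delta><..<t+\<delta>} \<subseteq> ?I" using \<delta>(2) by (simp add: ball_eq_greaterThanLessThan)
  have "\<gamma> u \<in> N" if u: "u \<in> {t-\<delta><..<t+\<delta>}" for u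
  proof -
    have "u \<in> ?I" using J u by (rule subsetD)
    then have "\<phi> (\<gamma> u) \<in> \<phi> ` (U \<inter> N)" "\<gamma> u \<in> U" using \<delta>0(3) by auto
    then obtain q where "q \<in> U \<inter> N" "\<phi> (\<gamma> u) = \<phi> q" "\<gamma> u \<in> U" by blast
    then show ?thesis using inj_onD[OF chart_inj[OF U(1)], of "\<gamma> u" q] by auto
  qed
  then show thesis using that[OF \<delta>(1)] J \<delta>0(2) by blast
qed

lemma tvec_deriv_cong:
  assumes X: "X \<in> tangent_space \<A> UNIV p" and N: "open N" "p \<in> N" "\<And>q. q \<in> N \<Longrightarrow> y q = z q"
  shows "tvec_deriv X y = tvec_deriv X z"
proof -
  obtain c \<epsilon> where c: "\<epsilon> > 0" "smooth_curve \<A> {-\<epsilon><..<\<epsilon>} c" "c 0 = p" "X = velocity \<A> c 0"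
    using X unfolding tangent_space_def by blast
  obtain \<delta> where \<delta>: "\<delta> > 0" "c ` {0-\<delta><..<0+\<delta>} \<subseteq> N"
  proof (rule curve_stays_in_open[OF c(2) _ N(1)])
    show "0 \<in> {-\<epsilon><..<\<epsilon>}" "c 0 \<in> N" using c N by auto
  qed blast
  have "X (\<lambda>q. y q $ i) = X (\<lambda>q. z q $ i)" for i
  proof -
    have "smooth_at \<A> (\<lambda>q. y q $ i) p \<longleftrightarrow> smooth_at \<A> (\<lambda>q. z q $ i) p"
      using N smooth_at_cong[OF _ N(1,2)] by fastforce
    moreover have "deriv (\<lambda>u. y (c u) $ i) 0 = deriv (\<lambda>u. z (c u) $ i) 0"
    proof (rule deriv_cong_ev)
      show "\<forall>\<^sub>F u in nhds 0. y (c u) $ i = z (c u) $ i"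
      proof (rule eventually_mono[OF eventually_nhds_in_open[of "{-\<delta><..<\<delta>}"]])
        fix u assume "u \<in> {-\<delta><..<\<delta>}"
        then have "c u \<in> N" using \<delta>(2) by auto
        then show "y (c u) $ i = z (c u) $ i" using N(3) by simp
      qed (use \<delta>(1) in auto)
    qed simp
    ultimately show ?thesis by (simp add: c(3,4) velocity_def)
  qed
  then show ?thesis by (simp add: tvec_deriv_def)
qed

lemma transition_smooth_at:
  "(V, \<Phi>) \<in> \<B> \<Longrightarrow> (V', \<Phi>') \<in> \<B> \<Longrightarrow> p \<in> V \<Longrightarrow> p \<in> V' \<Longrightarrow> smooth_at \<A> (transition \<Phi> \<Phi>') p"
  using triv_transition unfolding transition_def[abs_def] by blast

lemma transition_triv:
  assumes "(V, \<Phi>) \<in> \<B>" "(V', \<Phi>') \<in> \<B>" "p \<in> V" "p \<in> V'" "v \<in> E p"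
  shows "\<Phi>' p v = transition \<Phi> \<Phi>' p *v \<Phi> p v"
  by (simp add: transition_mult[OF assms(1-4)] untriv_triv[OF assms(1,3,5)])

text \<open>The coordinates of a section in two trivialisations differ by the smooth transition matrix, so one
  trivialisation decides smoothness.\<close>

lemma section_coordI:
  assumes V: "(V, \<Phi>) \<in> \<B>" and W: "open W" "W \<subseteq> V" and s: "\<And>p. p \<in> W \<Longrightarrow> s p \<in> E p"
    and sm: "\<And>p. p \<in> W \<Longrightarrow> smooth_at \<A> (\<lambda>q. \<Phi> q (s q)) p"
  shows "s \<in> sections \<A> E \<B> W"
  unfolding sections_def
proof (intro CollectI conjI ballI)
  show "s p \<in> E p" if "p \<in> W" for p using s that .
  have "smooth_at \<A> (\<lambda>q. \<Phi>' q (s q)) p"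
    if V': "(V', \<Phi>') \<in> \<B>" and p: "p \<in> W" "p \<in> V'" for V' \<Phi>' p
  proof (rule smooth_at_cong)
    show "smooth_at \<A> (\<lambda>q. transition \<Phi> \<Phi>' q *v \<Phi> q (s q)) p"
      using p W(2) by (intro smooth_at_bilinear[OF bounded_bilinear_matrix_vector_mult]
          transition_smooth_at[OF V V'] sm) auto
    show "open (W \<inter> V')" "p \<in> W \<inter> V'" using W(1) triv_open[OF V'] p by auto
    show "\<Phi>' q (s q) = transition \<Phi> \<Phi>' q *v \<Phi> q (s q)" if "q \<in> W \<inter> V'" for q
      using that W(2) s by (intro transition_triv[OF V V']) auto
  qed
  then show "case x of (V', \<Phi>') \<Rightarrow> \<forall>p\<in>W \<inter> V'. smooth_at \<A> (\<lambda>q. \<Phi>' q (s q)) p" if "x \<in> \<B>" for x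
    using that by auto
qed

lemma section_in: "s \<in> sections \<A> E \<B> W \<Longrightarrow> p \<in> W \<Longrightarrow> s p \<in> E p"
  by (simp add: sections_def)

lemma section_smooth:
  "s \<in> sections \<A> E \<B> W \<Longrightarrow> (V, \<Phi>) \<in> \<B> \<Longrightarrow> p \<in> W \<Longrightarrow> p \<in> V \<Longrightarrow> smooth_at \<A> (\<lambda>q. \<Phi> q (s q)) p"
  unfolding sections_def by blast

lemma section_restrict: "s \<in> sections \<A> E \<B> W \<Longrightarrow> W' \<subseteq> W \<Longrightarrow> s \<in> sections \<A> E \<B> W'"
  unfolding sections_def by blast

lemma local_frame_section:
  assumes "(V, \<Phi>) \<in> \<B>"
  shows "local_frame E \<Phi> i \<in> sections \<A> E \<B> V"
proof (rule section_coordI[OF assms triv_open[OF assms]])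
  fix p assume p: "p \<in> V"
  show "local_frame E \<Phi> i p \<in> E p" using local_frame_in[OF assms p] .
  obtain U \<phi> where U: "(U, \<phi>) \<in> \<A>" "p \<in> U" using charts_cover by blast
  show "smooth_at \<A> (\<lambda>q. \<Phi> q (local_frame E \<Phi> i q)) p"
    by (rule smooth_at_cong[OF smooth_at_const[OF U, of "axis i 1"] triv_open[OF assms] p])
      (simp add: triv_local_frame[OF assms])
qed simp

lemma section_scale_frame:
  assumes V: "(V, \<Phi>) \<in> \<B>" and W: "open W" "W \<subseteq> V" and f: "\<And>p. p \<in> W \<Longrightarrow> smooth_at \<A> f p"
  shows "(\<lambda>q. f q *\<^sub>R local_frame E \<Phi> i q) \<in> sections \<A> E \<B> W"
proof (rule section_coordI[OF V W])
  fix p assume p: "p \<in> W"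
  show "f p *\<^sub>R local_frame E \<Phi> i p \<in> E p"
    using local_frame_in[OF V] p W by (intro subspace_scale[OF fibre_subspace]) blast
  obtain U \<phi> where U: "(U, \<phi>) \<in> \<A>" "p \<in> U" using charts_cover by blast
  show "smooth_at \<A> (\<lambda>q. \<Phi> q (f q *\<^sub>R local_frame E \<Phi> i q)) p"
  proof (rule smooth_at_cong[OF _ W(1) p])
    show "smooth_at \<A> (\<lambda>q. f q *\<^sub>R (axis i 1 :: real^'k)) p"
      by (rule smooth_at_bilinear[OF bounded_bilinear_scaleR f[OF p] smooth_at_const[OF U]])
    show "\<Phi> q (f q *\<^sub>R local_frame E \<Phi> i q) = f q *\<^sub>R axis i 1" if "q \<in> W" for q
      using that W(2) local_frame_in[OF V, of q i]
      by (subst triv_scale[OF V]) (auto simp: triv_local_frame[OF V])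
  qed
qed

lemma section_add:
  assumes V: "(V, \<Phi>) \<in> \<B>" and W: "open W" "W \<subseteq> V"
    and s: "s \<in> sections \<A> E \<B> W" "s' \<in> sections \<A> E \<B> W"
  shows "(\<lambda>q. s q + s' q) \<in> sections \<A> E \<B> W"
proof (rule section_coordI[OF V W])
  fix p assume p: "p \<in> W"
  show "s p + s' p \<in> E p"
    using s p by (intro subspace_add[OF fibre_subspace] section_in)
  show "smooth_at \<A> (\<lambda>q. \<Phi> q (s q + s' q)) p"
  proof (rule smooth_at_cong[OF _ W(1) p])
    show "smooth_at \<A> (\<lambda>q. \<Phi> q (s q) + \<Phi> q (s' q)) p"
      using p W(2) by (intro smooth_at_add section_smooth[OF _ V p] s) auto
    show "\<Phi> q (s q + s' q) = \<Phi> q (s q) + \<Phi> q (s' q)" if "q \<in> W" for q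
      using that W(2) s by (intro triv_add[OF V] section_in) auto
  qed
qed

end

locale bundle_with_connection = smooth_vector_bundle \<A> E \<B>
  for \<A> :: "('m::topological_space, 'a::euclidean_space) atlas"
    and E :: "'m \<Rightarrow> 'v::real_vector set" and \<B> :: "('m, 'v, 'k::finite) trivs" +
  fixes D :: "('m, 'v) conn"
  assumes connection: "connection \<A> E \<B> D"
begin

lemma D_props:
  assumes "open W" "s \<in> sections \<A> E \<B> W" "p \<in> W" "X \<in> tangent_space \<A> UNIV p"
  shows D_in: "D p X s \<in> E p"
    and D_lin: "Y \<in> tangent_space \<A> UNIV p \<Longrightarrow>
           D p (\<lambda>f. a * X f + b * Y f) s = a *\<^sub>R D p X s + b *\<^sub>R D p Y s"
    and D_add: "s' \<in> sections \<A> E \<B> W \<Longrightarrow> D p X (\<lambda>q. s q + s' q) = D p X s + D p X s'"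
    and D_leibniz: "smooth_at \<A> f p \<Longrightarrow>
           D p X (\<lambda>q. f q *\<^sub>R s q) = X f *\<^sub>R s p + f p *\<^sub>R D p X s"
    and D_cong: "(\<And>q. q \<in> W \<Longrightarrow> s' q = s q) \<Longrightarrow> D p X s' = D p X s"
proof -
  note * = connection[unfolded connection_def, THEN conjunct1, THEN spec, THEN mp, OF assms(1),
      THEN bspec, OF assms(2), THEN bspec, OF assms(3), THEN bspec, OF assms(4)]
  note ** = *[THEN conjunct2] and *** = *[THEN conjunct2, THEN conjunct2]
  show "D p X s \<in> E p" using * by (rule conjunct1)
  show "Y \<in> tangent_space \<A> UNIV p \<Longrightarrow>
      D p (\<lambda>f. a * X f + b * Y f) s = a *\<^sub>R D p X s + b *\<^sub>R D p Y s"
    using **[THEN conjunct1] by blast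
  show "s' \<in> sections \<A> E \<B> W \<Longrightarrow> D p X (\<lambda>q. s q + s' q) = D p X s + D p X s'"
    using ***[THEN conjunct1] by blast
  show "smooth_at \<A> f p \<Longrightarrow> D p X (\<lambda>q. f q *\<^sub>R s q) = X f *\<^sub>R s p + f p *\<^sub>R D p X s"
    using ***[THEN conjunct2, THEN conjunct1] by blast
  show "(\<And>q. q \<in> W \<Longrightarrow> s' q = s q) \<Longrightarrow> D p X s' = D p X s"
    using ***[THEN conjunct2, THEN conjunct2] by blast
qed

lemma D_vector_field:
  assumes "open W" "vector_field \<A> W X" "s \<in> sections \<A> E \<B> W"
  shows "(\<lambda>q. D q (X q) s) \<in> sections \<A> E \<B> W"
  by (rule connection[unfolded connection_def, THEN conjunct2, THEN spec, THEN spec, THEN mp,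
        OF conjI[OF assms(1,2)], THEN bspec, OF assms(3)])

text \<open>The connection form of the trivialisation: column \<open>j\<close> is the derivative of the \<open>j\<close>-th frame
  section, so that the covariant derivative becomes \<open>X y + \<Gamma>(X) y\<close>.\<close>

definition conn_mat :: "('m \<Rightarrow> 'v \<Rightarrow> real^'k) \<Rightarrow> 'm \<Rightarrow> 'm tvec \<Rightarrow> real^'k^'k" where
  "conn_mat \<Phi> p X = (\<chi> i j. \<Phi> p (D p X (local_frame E \<Phi> j)) $ i)"

lemma conn_mat_mult:
  assumes V: "(V, \<Phi>) \<in> \<B>" "p \<in> V" and X: "X \<in> tangent_space \<A> UNIV p"
  shows "conn_mat \<Phi> p X *v y = \<Phi> p (\<Sum>j\<in>UNIV. y $ j *\<^sub>R D p X (local_frame E \<Phi> j))"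
proof -
  have in_E: "D p X (local_frame E \<Phi> j) \<in> E p" for j
    by (rule D_in[OF triv_open[OF V(1)] local_frame_section[OF V(1)] V(2) X])
  show ?thesis
    by (simp add: triv_sum[OF V] triv_scale[OF V] in_E subspace_scale[OF fibre_subspace]
        vec_eq_iff matrix_vector_mult_def conn_mat_def mult.commute)
qed

text \<open>The Leibniz rule for the expansion of \<open>s\<close> in the local frame.\<close>

lemma D_in_coords:
  assumes V: "(V, \<Phi>) \<in> \<B>" and W: "open W" "W \<subseteq> V" "p \<in> W" and s: "s \<in> sections \<A> E \<B> W"
    and X: "X \<in> tangent_space \<A> UNIV p"
  shows "\<Phi> p (D p X s) = tvec_deriv X (\<lambda>q. \<Phi> q (s q)) + conn_mat \<Phi> p X *v \<Phi> p (s p)"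
proof -
  let ?e = "local_frame E \<Phi>" and ?y = "\<lambda>q. \<Phi> q (s q)"
  have pV: "p \<in> V" using W by blast
  have e: "?e i \<in> sections \<A> E \<B> W" for i
    by (rule section_restrict[OF local_frame_section[OF V] W(2)])
  have y: "smooth_at \<A> (\<lambda>q. ?y q $ i) q" if "q \<in> W" for i q
    using that W(2) by (intro smooth_at_nth section_smooth[OF s V]) auto
  have ye: "(\<lambda>q. ?y q $ i *\<^sub>R ?e i q) \<in> sections \<A> E \<B> W" for i
    by (rule section_scale_frame[OF V W(1,2) y])
  have zero: "D p X (\<lambda>q. 0) = 0" "(\<lambda>q. 0) \<in> sections \<A> E \<B> W"
  proof -
    obtain U \<phi> where U: "(U, \<phi>) \<in> \<A>" "p \<in> U" using charts_cover by blast
    show "(\<lambda>q. 0) \<in> sections \<A> E \<B> W"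
    proof -
      have "smooth_at \<A> (\<lambda>q. 0::real) q" for q
        using charts_cover[of q] smooth_at_const by blast
      from section_scale_frame[OF V W(1,2) this] show ?thesis by simp
    qed
    from D_add[OF W(1) this W(3) X this] show "D p X (\<lambda>q. 0) = 0" by simp
  qed
  have "(\<lambda>q. \<Sum>i\<in>I. ?y q $ i *\<^sub>R ?e i q) \<in> sections \<A> E \<B> W \<and>
      D p X (\<lambda>q. \<Sum>i\<in>I. ?y q $ i *\<^sub>R ?e i q) =
        (\<Sum>i\<in>I. X (\<lambda>q. ?y q $ i) *\<^sub>R ?e i p + ?y p $ i *\<^sub>R D p X (?e i))" if "finite I" for I
    using that
  proof (induction I rule: finite_induct)
    case empty then show ?case using zero by simp
  next
    case (insert i I)
    have "D p X (\<lambda>q. ?y q $ i *\<^sub>R ?e i q + (\<Sum>i\<in>I. ?y q $ i *\<^sub>R ?e i q)) =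
        D p X (\<lambda>q. ?y q $ i *\<^sub>R ?e i q) + D p X (\<lambda>q. \<Sum>i\<in>I. ?y q $ i *\<^sub>R ?e i q)"
      using insert by (intro D_add[OF W(1) ye W(3) X]) auto
    also have "D p X (\<lambda>q. ?y q $ i *\<^sub>R ?e i q) = X (\<lambda>q. ?y q $ i) *\<^sub>R ?e i p + ?y p $ i *\<^sub>R D p X (?e i)"
      by (rule D_leibniz[OF W(1) e W(3) X y[OF W(3)]])
    finally show ?case
      using insert section_add[OF V W(1,2) ye] by auto
  qed
  from this[of UNIV] have sec: "(\<lambda>q. \<Sum>i\<in>UNIV. ?y q $ i *\<^sub>R ?e i q) \<in> sections \<A> E \<B> W"
    and D: "D p X (\<lambda>q. \<Sum>i\<in>UNIV. ?y q $ i *\<^sub>R ?e i q) =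
        (\<Sum>i\<in>UNIV. X (\<lambda>q. ?y q $ i) *\<^sub>R ?e i p + ?y p $ i *\<^sub>R D p X (?e i))" by auto
  have "s q = (\<Sum>i\<in>UNIV. ?y q $ i *\<^sub>R ?e i q)" if "q \<in> W" for q
    using untriv_frame[OF V, of q "?y q"] untriv_triv[OF V _ section_in[OF s that]] that W(2) by auto
  then have "D p X s = D p X (\<lambda>q. \<Sum>i\<in>UNIV. ?y q $ i *\<^sub>R ?e i q)"
    by (rule D_cong[OF W(1) sec W(3) X])
  also have "\<dots> = (\<Sum>i\<in>UNIV. X (\<lambda>q. ?y q $ i) *\<^sub>R ?e i p) + (\<Sum>i\<in>UNIV. ?y p $ i *\<^sub>R D p X (?e i))"
    unfolding D by (rule sum.distrib)
  also have "(\<Sum>i\<in>UNIV. X (\<lambda>q. ?y q $ i) *\<^sub>R ?e i p) = untriv \<Phi> p (tvec_deriv X ?y)"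
    by (simp add: untriv_frame[OF V pV] tvec_deriv_def)
  finally have Ds: "D p X s = untriv \<Phi> p (tvec_deriv X ?y) + (\<Sum>i\<in>UNIV. ?y p $ i *\<^sub>R D p X (?e i))" .
  have "(\<Sum>i\<in>UNIV. ?y p $ i *\<^sub>R D p X (?e i)) \<in> E p"
    by (intro subspace_sum[OF fibre_subspace] subspace_scale[OF fibre_subspace] D_in[OF W(1) e W(3) X])
  then show ?thesis
    by (simp add: Ds triv_add[OF V pV untriv_in[OF V pV]] triv_untriv[OF V pV] conn_mat_mult[OF V pV X])
qed

lemma conn_mat_chart_linear:
  assumes V: "(V, \<Phi>) \<in> \<B>" "p \<in> V" and U: "(U, \<phi>) \<in> \<A>" "p \<in> U"
  shows "linear (\<lambda>v. conn_mat \<Phi> p (chart_vec U \<phi> p v))"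
proof -
  have T: "chart_vec U \<phi> p v \<in> tangent_space \<A> UNIV p" for v
    using tangent_space_UNIV[OF U] by blast
  note e = D_props[OF triv_open[OF V(1)] local_frame_section[OF V(1)] V(2) T]
  have *: "\<Phi> p (D p (chart_vec U \<phi> p (a *\<^sub>R v + b *\<^sub>R w)) (local_frame E \<Phi> j)) =
      a *\<^sub>R \<Phi> p (D p (chart_vec U \<phi> p v) (local_frame E \<Phi> j)) +
      b *\<^sub>R \<Phi> p (D p (chart_vec U \<phi> p w) (local_frame E \<Phi> j))" for a b v w j
    by (simp add: chart_vec_linear[OF U] e(2)[OF T] triv_add[OF V] triv_scale[OF V] e(1)
        subspace_scale[OF fibre_subspace])
  show ?thesis
  proof (rule linearI)
    fix v w c
    show "conn_mat \<Phi> p (chart_vec U \<phi> p (v + w)) =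
        conn_mat \<Phi> p (chart_vec U \<phi> p v) + conn_mat \<Phi> p (chart_vec U \<phi> p w)"
      using *[of 1 v 1 w] by (simp add: conn_mat_def vec_eq_iff)
    show "conn_mat \<Phi> p (chart_vec U \<phi> p (c *\<^sub>R v)) = c *\<^sub>R conn_mat \<Phi> p (chart_vec U \<phi> p v)"
      using *[of c v 0 v] by (simp add: conn_mat_def vec_eq_iff)
  qed
qed

text \<open>The definition of a connection asserts smoothness for derivatives along vector fields on open sets.
  The velocity of a curve is a combination of the coordinate vector fields with smooth coefficients; by
  linearity of the connection form this is enough.\<close>

lemma conn_mat_smooth_along_curve:
  assumes V: "(V, \<Phi>) \<in> \<B>" and U: "(U, \<phi>) \<in> \<A>"
    and T: "open T" and c: "smooth_curve \<A> T c" "c ` T \<subseteq> U \<inter> V"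
  shows "smooth_on T (\<lambda>t. conn_mat \<Phi> (c t) (velocity \<A> c t))"
proof -
  define N where "N b q = conn_mat \<Phi> q (chart_vec U \<phi> q b)" for b q
  have oUV: "open (U \<inter> V)" using chart_dom_open[OF U] triv_open[OF V] by blast
  have N: "smooth_at \<A> (N b) p" if p: "p \<in> U \<inter> V" for b p
  proof -
    have "vector_field \<A> (U \<inter> V) (\<lambda>q. chart_vec U \<phi> q b)"
      using coordinate_vector_field[OF U, of b] unfolding vector_field_def by blast
    from D_vector_field[OF oUV this section_restrict[OF local_frame_section[OF V]]]
    have "(\<lambda>q. D q (chart_vec U \<phi> q b) (local_frame E \<Phi> j)) \<in> sections \<A> E \<B> (U \<inter> V)" for j by simp
    from section_smooth[OF this V p]
    have "smooth_at \<A> (\<lambda>q. \<Phi> q (D q (chart_vec U \<phi> q b) (local_frame E \<Phi> j)) $ i) p" for i j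
      using p by (intro smooth_at_nth) auto
    then show ?thesis
      unfolding N_def conn_mat_def by (intro smooth_at_vec) simp
  qed
  have y: "smooth_on T (\<phi> \<circ> c)"
    by (rule smooth_curve_chartD[OF c(1) U]) (use c in auto)
  have "smooth_on T (\<lambda>t. \<Sum>b\<in>Basis. (vector_derivative (\<phi> \<circ> c) (at t) \<bullet> b) *\<^sub>R (N b \<circ> c) t)"
    using c by (intro smooth_on_sum T smooth_on_bilinear[OF bounded_bilinear_scaleR]
        smooth_on_bounded_linear[OF bounded_linear_inner_left] smooth_on_derivative_curve y
        smooth_at_on_curve[OF c(1) N]) auto
  then show ?thesis
  proof (rule smooth_on_eqI[OF _ T])
    fix t assume t: "t \<in> T"
    then have ct: "c t \<in> U" "c t \<in> V" using c by auto
    let ?v = "vector_derivative (\<phi> \<circ> c) (at t)"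
    have lin: "linear (\<lambda>v. N v (c t))"
      unfolding N_def by (rule conn_mat_chart_linear[OF V ct(2) U ct(1)])
    have "conn_mat \<Phi> (c t) (velocity \<A> c t) = N ?v (c t)"
      by (simp add: N_def velocity_chart[OF c(1) t U ct(1)])
    also have "\<dots> = N (\<Sum>b\<in>Basis. (?v \<bullet> b) *\<^sub>R b) (c t)"
      by (simp add: euclidean_representation)
    also have "\<dots> = (\<Sum>b\<in>Basis. (?v \<bullet> b) *\<^sub>R N b (c t))"
      by (simp add: linear_sum[OF lin] linear_scale[OF lin] del: euclidean_representation)
    finally show "conn_mat \<Phi> (c t) (velocity \<A> c t) = (\<Sum>b\<in>Basis. (?v \<bullet> b) *\<^sub>R (N b \<circ> c) t)"
      by simp
  qed
qed

lemma cov_deriv_in_coords: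
  assumes V: "(V, \<Phi>) \<in> \<B>" "\<gamma> t \<in> V" and \<gamma>: "smooth_curve \<A> T \<gamma>" "t \<in> T"
    and y: "((\<lambda>u. \<Phi> (\<gamma> u) (s u)) has_vector_derivative y') (at t)"
  shows "\<Phi> (\<gamma> t) (cov_deriv_along \<A> E D \<Phi> \<gamma> s t) =
      y' + conn_mat \<Phi> (\<gamma> t) (velocity \<A> \<gamma> t) *v \<Phi> (\<gamma> t) (s t)"
    and "cov_deriv_along \<A> E D \<Phi> \<gamma> s t \<in> E (\<gamma> t)"
proof -
  let ?X = "velocity \<A> \<gamma> t" and ?e = "local_frame E \<Phi>"
  have X: "?X \<in> tangent_space \<A> UNIV (\<gamma> t)" by (rule velocity_in_tangent_space[OF \<gamma>])
  have De: "D (\<gamma> t) ?X (?e j) \<in> E (\<gamma> t)" for j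
    by (rule D_in[OF triv_open[OF V(1)] local_frame_section[OF V(1)] V(2) X])
  have d: "deriv (\<lambda>u. \<Phi> (\<gamma> u) (s u) $ i) t = y' $ i" for i
    using bounded_linear.has_vector_derivative[OF bounded_linear_vec_nth y, of i]
    by (intro DERIV_imp_deriv) (simp add: has_real_derivative_iff_has_vector_derivative)
  have sum_in: "(\<Sum>j\<in>UNIV. (\<Phi> (\<gamma> t) (s t) $ j) *\<^sub>R D (\<gamma> t) ?X (?e j)) \<in> E (\<gamma> t)"
    by (intro subspace_sum[OF fibre_subspace] subspace_scale[OF fibre_subspace] De)
  have eq: "cov_deriv_along \<A> E D \<Phi> \<gamma> s t =
      untriv \<Phi> (\<gamma> t) y' + (\<Sum>j\<in>UNIV. (\<Phi> (\<gamma> t) (s t) $ j) *\<^sub>R D (\<gamma> t) ?X (?e j))"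
    unfolding cov_deriv_along_def d by (simp add: sum.distrib untriv_frame[OF V])
  show "\<Phi> (\<gamma> t) (cov_deriv_along \<A> E D \<Phi> \<gamma> s t) =
      y' + conn_mat \<Phi> (\<gamma> t) (velocity \<A> \<gamma> t) *v \<Phi> (\<gamma> t) (s t)"
    by (simp add: eq triv_add[OF V untriv_in[OF V] sum_in] triv_untriv[OF V] conn_mat_mult[OF V X])
  show "cov_deriv_along \<A> E D \<Phi> \<gamma> s t \<in> E (\<gamma> t)"
    unfolding eq by (intro subspace_add[OF fibre_subspace] sum_in untriv_in[OF V])
qed

text \<open>The formula of \<open>D_in_coords\<close> in the trivialisation \<open>\<Phi>'\<close>, for the frame of \<open>\<Phi>\<close>: the coordinates of its
  members are the columns of the transition matrix.\<close>

lemma conn_mat_change: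
  assumes V: "(V, \<Phi>) \<in> \<B>" "(V', \<Phi>') \<in> \<B>" "p \<in> V" "p \<in> V'" and X: "X \<in> tangent_space \<A> UNIV p"
  shows "transition \<Phi> \<Phi>' p *v (conn_mat \<Phi> p X *v axis j 1) =
    tvec_deriv X (\<lambda>q. transition \<Phi> \<Phi>' q *v axis j 1) +
    conn_mat \<Phi>' p X *v (transition \<Phi> \<Phi>' p *v axis j 1)"
proof -
  let ?W = "V \<inter> V'"
  have W: "open ?W" "?W \<subseteq> V" "?W \<subseteq> V'" "p \<in> ?W"
    using triv_open[OF V(1)] triv_open[OF V(2)] V(3,4) by auto
  let ?e = "local_frame E \<Phi> j"
  have e: "?e \<in> sections \<A> E \<B> ?W"
    by (rule section_restrict[OF local_frame_section[OF V(1)] W(2)])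
  have frame: "\<Phi>' q (?e q) = transition \<Phi> \<Phi>' q *v axis j 1" if "q \<in> ?W" for q
    using that by (simp add: local_frame_def transition_mult[OF V(1,2)])
  have "tvec_deriv X (\<lambda>q. \<Phi>' q (?e q)) = tvec_deriv X (\<lambda>q. transition \<Phi> \<Phi>' q *v axis j 1)"
    by (rule tvec_deriv_cong[OF X W(1,4)]) (simp_all add: frame)
  then have "\<Phi>' p (D p X ?e) = tvec_deriv X (\<lambda>q. transition \<Phi> \<Phi>' q *v axis j 1) +
      conn_mat \<Phi>' p X *v (transition \<Phi> \<Phi>' p *v axis j 1)"
    using D_in_coords[OF V(2) W(1,3,4) e X] frame[OF W(4)] by simp
  moreover have "\<Phi>' p (D p X ?e) = transition \<Phi> \<Phi>' p *v \<Phi> p (D p X ?e)"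
    by (rule transition_triv[OF V D_in[OF W(1) e W(4) X]])
  moreover have "\<Phi> p (D p X ?e) = conn_mat \<Phi> p X *v axis j 1"
    by (simp add: conn_mat_def vec_eq_iff matrix_vector_mult_basis column_def)
  ultimately show ?thesis by simp
qed

lemma transition_derivative:
  assumes V: "(V, \<Phi>) \<in> \<B>" "(V', \<Phi>') \<in> \<B>" "\<gamma> t \<in> V" "\<gamma> t \<in> V'"
    and \<gamma>: "smooth_curve \<A> T \<gamma>" "t \<in> T"
  shows "((\<lambda>u. transition \<Phi> \<Phi>' (\<gamma> u)) has_vector_derivative
    transition \<Phi> \<Phi>' (\<gamma> t) ** conn_mat \<Phi> (\<gamma> t) (velocity \<A> \<gamma> t) -
    conn_mat \<Phi>' (\<gamma> t) (velocity \<A> \<gamma> t) ** transition \<Phi> \<Phi>' (\<gamma> t)) (at t)"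
proof -
  let ?G = "transition \<Phi> \<Phi>'" and ?X = "velocity \<A> \<gamma> t"
  have sm: "smooth_at \<A> ?G (\<gamma> t)" by (rule transition_smooth_at[OF V])
  obtain \<delta> where "\<delta> > 0" "smooth_on {t-\<delta><..<t+\<delta>} (?G \<circ> \<gamma>)"
    using smooth_at_along_curve[OF sm \<gamma>] by metis
  then have G: "((\<lambda>u. ?G (\<gamma> u)) has_vector_derivative vector_derivative (?G \<circ> \<gamma>) (at t)) (at t)"
    using smooth_on_vector_derivative[of _ "?G \<circ> \<gamma>" t] by (simp add: o_def)
  let ?G' = "vector_derivative (?G \<circ> \<gamma>) (at t)"
  have "?G' *v axis j 1 = (?G (\<gamma> t) ** conn_mat \<Phi> (\<gamma> t) ?X - conn_mat \<Phi>' (\<gamma> t) ?X ** ?G (\<gamma> t)) *v axis j 1" for j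
  proof -
    have bl: "bounded_linear (\<lambda>A::real^'k^'k. A *v axis j 1)"
      by (rule bounded_bilinear.bounded_linear_left[OF bounded_bilinear_matrix_vector_mult])
    have "((\<lambda>u. ?G (\<gamma> u) *v axis j 1) has_vector_derivative ?G' *v axis j 1) (at t)"
      by (rule bounded_linear.has_vector_derivative[OF bl G])
    moreover have "((\<lambda>u. ?G (\<gamma> u) *v axis j 1) has_vector_derivative
        tvec_deriv ?X (\<lambda>q. ?G q *v axis j 1)) (at t)"
      by (rule velocity_vec_derivative[OF \<gamma> smooth_at_bounded_linear[OF bl sm]])
    ultimately have "?G' *v axis j 1 = tvec_deriv ?X (\<lambda>q. ?G q *v axis j 1)"
      by (rule vector_derivative_unique_at)
    then show ?thesis
      using conn_mat_change[OF V velocity_in_tangent_space[OF \<gamma>], of j]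
      by (simp add: matrix_vector_mult_diff_rdistrib flip: matrix_vector_mul_assoc)
  qed
  then have "?G' = ?G (\<gamma> t) ** conn_mat \<Phi> (\<gamma> t) ?X - conn_mat \<Phi>' (\<gamma> t) ?X ** ?G (\<gamma> t)"
    by (simp add: vec_eq_iff matrix_vector_mult_basis column_def)
  with G show ?thesis by simp
qed

text \<open>The frame formula for the derivative along a curve does not depend on the frame. Hence the equation
  that defines parallel endomorphisms only has to be checked in one trivialisation.\<close>

lemma cov_deriv_change:
  assumes V: "(V, \<Phi>) \<in> \<B>" "(V', \<Phi>') \<in> \<B>" "\<gamma> t \<in> V" "\<gamma> t \<in> V'"
    and \<gamma>: "smooth_curve \<A> T \<gamma>" "t \<in> T"
    and s: "\<And>u. u \<in> T \<Longrightarrow> s u \<in> E (\<gamma> u)"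
    and y: "((\<lambda>u. \<Phi> (\<gamma> u) (s u)) has_vector_derivative y') (at t)"
  shows "cov_deriv_along \<A> E D \<Phi>' \<gamma> s t = cov_deriv_along \<A> E D \<Phi> \<gamma> s t"
proof -
  let ?G = "\<lambda>u. transition \<Phi> \<Phi>' (\<gamma> u)" and ?y = "\<lambda>u. \<Phi> (\<gamma> u) (s u)"
  let ?C = "conn_mat \<Phi> (\<gamma> t) (velocity \<A> \<gamma> t)" and ?C' = "conn_mat \<Phi>' (\<gamma> t) (velocity \<A> \<gamma> t)"
  obtain \<delta> where \<delta>: "\<delta> > 0" "{t-\<delta><..<t+\<delta>} \<subseteq> T" "\<gamma> ` {t-\<delta><..<t+\<delta>} \<subseteq> V \<inter> V'"
    using curve_stays_in_open[OF \<gamma>, of "V \<inter> V'"] triv_open[OF V(1)] triv_open[OF V(2)] V by blast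
  have "((\<lambda>u. ?G u *v ?y u) has_vector_derivative (?G t *v y' + (?G t ** ?C - ?C' ** ?G t) *v ?y t)) (at t)"
    by (rule bounded_bilinear.has_vector_derivative[OF bounded_bilinear_matrix_vector_mult
          transition_derivative[OF V \<gamma>] y])
  then have y2: "((\<lambda>u. \<Phi>' (\<gamma> u) (s u)) has_vector_derivative
      (?G t *v y' + (?G t ** ?C - ?C' ** ?G t) *v ?y t)) (at t)"
  proof (rule has_vector_derivative_transform_within_open[of _ _ _ "{t-\<delta><..<t+\<delta>}"])
    fix u assume "u \<in> {t-\<delta><..<t+\<delta>}"
    then have "\<gamma> u \<in> V \<inter> V'" "u \<in> T" using \<delta> by blast+
    then show "?G u *v ?y u = \<Phi>' (\<gamma> u) (s u)"
      using transition_triv[OF V(1,2) _ _ s] by simp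
  qed (use \<delta> in auto)
  note c = cov_deriv_in_coords[OF V(1,3) \<gamma> y] and c' = cov_deriv_in_coords[OF V(2,4) \<gamma> y2]
  show ?thesis
  proof (rule triv_inject[OF V(2,4) c'(2) c(2)])
    have "\<Phi>' (\<gamma> t) (s t) = ?G t *v ?y t" by (rule transition_triv[OF V s[OF \<gamma>(2)]])
    moreover have "\<Phi>' (\<gamma> t) (cov_deriv_along \<A> E D \<Phi> \<gamma> s t) = ?G t *v (y' + ?C *v ?y t)"
      using transition_triv[OF V c(2)] c(1) by simp
    ultimately show "\<Phi>' (\<gamma> t) (cov_deriv_along \<A> E D \<Phi>' \<gamma> s t) = \<Phi>' (\<gamma> t) (cov_deriv_along \<A> E D \<Phi> \<gamma> s t)"
      by (simp add: c'(1) matrix_vector_mult_diff_rdistrib matrix_vector_right_distrib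
          flip: matrix_vector_mul_assoc)
  qed
qed

end

section \<open>Curves of endomorphisms in coordinates\<close>

context smooth_vector_bundle begin

lemma End_curve_base:
  assumes "smooth_curve (End_atlas \<A> E \<B>) T (\<lambda>t. (\<gamma> t, L t))"
  shows "smooth_curve \<A> T \<gamma>" and "t \<in> T \<Longrightarrow> L t \<in> End_fibre (E (\<gamma> t))"
proof -
  have *: "\<exists>U \<phi> V \<Phi> \<delta>. (U, \<phi>) \<in> \<A> \<and> (V, \<Phi>) \<in> \<B> \<and> \<delta> > 0 \<and> {t-\<delta><..<t+\<delta>} \<subseteq> T \<and>
     (\<lambda>t. (\<gamma> t, L t)) ` {t-\<delta><..<t+\<delta>} \<subseteq> End_dom U V \<and>
     smooth_on {t-\<delta><..<t+\<delta>} (End_chart \<phi> \<Phi> \<circ> (\<lambda>t. (\<gamma> t, L t)))" if "t \<in> T" for t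
    using assms that unfolding smooth_curve_def End_atlas_eq by fast
  show "smooth_curve \<A> T \<gamma>"
    unfolding smooth_curve_def
  proof
    fix t assume "t \<in> T"
    then obtain U \<phi> V \<Phi> \<delta> where 1: "(U, \<phi>) \<in> \<A>" "\<delta> > 0" "{t-\<delta><..<t+\<delta>} \<subseteq> T"
      "(\<lambda>t. (\<gamma> t, L t)) ` {t-\<delta><..<t+\<delta>} \<subseteq> End_dom U V"
      "smooth_on {t-\<delta><..<t+\<delta>} (End_chart \<phi> \<Phi> \<circ> (\<lambda>t. (\<gamma> t, L t)))"
      using * by blast
    have "smooth_on {t-\<delta><..<t+\<delta>} (\<lambda>u. fst ((End_chart \<phi> \<Phi> \<circ> (\<lambda>t. (\<gamma> t, L t))) u))"
      by (rule smooth_on_bounded_linear[OF bounded_linear_fst _ 1(5)]) simp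
    then have "smooth_on {t-\<delta><..<t+\<delta>} (\<phi> \<circ> \<gamma>)" by (simp add: End_chart_def o_def)
    moreover have "\<gamma> ` {t-\<delta><..<t+\<delta>} \<subseteq> U" using 1(4) by (force simp: End_dom_def)
    ultimately show "\<exists>(U, \<phi>)\<in>\<A>. \<exists>\<delta>>0. {t-\<delta><..<t+\<delta>} \<subseteq> T \<and> \<gamma> ` {t-\<delta><..<t+\<delta>} \<subseteq> U \<and>
      smooth_on {t-\<delta><..<t+\<delta>} (\<phi> \<circ> \<gamma>)"
      using 1 by blast
  qed
  show "L t \<in> End_fibre (E (\<gamma> t))" if t: "t \<in> T"
  proof -
    obtain U V \<delta> where "\<delta> > 0" "(\<lambda>t. (\<gamma> t, L t)) ` {t-\<delta><..<t+\<delta>} \<subseteq> End_dom U V"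
      using *[OF t] by blast
    then have "(\<gamma> t, L t) \<in> End_dom U V" by (auto simp: image_subset_iff)
    then show ?thesis by (simp add: End_dom_def)
  qed
qed

lemma End_curve_coords:
  assumes c: "smooth_curve (End_atlas \<A> E \<B>) T (\<lambda>t. (\<gamma> t, L t))" "t \<in> T"
    and U: "(U, \<phi>) \<in> \<A>" "\<gamma> t \<in> U" and V: "(V, \<Phi>) \<in> \<B>" "\<gamma> t \<in> V"
  obtains \<delta> where "\<delta> > 0" "{t-\<delta><..<t+\<delta>} \<subseteq> T" "\<gamma> ` {t-\<delta><..<t+\<delta>} \<subseteq> U \<inter> V"
    "smooth_on {t-\<delta><..<t+\<delta>} (\<phi> \<circ> \<gamma>)" "smooth_on {t-\<delta><..<t+\<delta>} (\<lambda>u. End_mat \<Phi> (\<gamma> u) (L u))"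
proof -
  have "(\<gamma> t, L t) \<in> End_dom U V"
    using End_curve_base(2)[OF c] U V by (simp add: End_dom_def)
  then obtain \<delta> where \<delta>: "\<delta> > 0" "{t-\<delta><..<t+\<delta>} \<subseteq> T"
     "(\<lambda>t. (\<gamma> t, L t)) ` {t-\<delta><..<t+\<delta>} \<subseteq> End_dom U V"
     "smooth_on {t-\<delta><..<t+\<delta>} (End_chart \<phi> \<Phi> \<circ> (\<lambda>t. (\<gamma> t, L t)))"
    using End.smooth_curve_in_chart[OF c End_chart_in_atlas[OF U(1) V(1)]] by blast
  show thesis
  proof (rule that[OF \<delta>(1,2)])
    show "\<gamma> ` {t-\<delta><..<t+\<delta>} \<subseteq> U \<inter> V" using \<delta>(3) by (force simp: End_dom_def)
    show "smooth_on {t-\<delta><..<t+\<delta>} (\<phi> \<circ> \<gamma>)"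
      using smooth_on_bounded_linear[OF bounded_linear_fst _ \<delta>(4)] by (simp add: End_chart_def o_def)
    show "smooth_on {t-\<delta><..<t+\<delta>} (\<lambda>u. End_mat \<Phi> (\<gamma> u) (L u))"
      using smooth_on_bounded_linear[OF bounded_linear_snd _ \<delta>(4)] by (simp add: End_chart_def o_def)
  qed
qed

lemma End_curveI:
  assumes "open T" and U: "(U, \<phi>) \<in> \<A>" and V: "(V, \<Phi>) \<in> \<B>" and "\<gamma> ` T \<subseteq> U \<inter> V"
    and L: "\<And>t. t \<in> T \<Longrightarrow> L t \<in> End_fibre (E (\<gamma> t))"
    and "smooth_on T (\<phi> \<circ> \<gamma>)" "smooth_on T (\<lambda>t. End_mat \<Phi> (\<gamma> t) (L t))"
  shows "smooth_curve (End_atlas \<A> E \<B>) T (\<lambda>t. (\<gamma> t, L t))"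
proof (rule End.smooth_curveI_chart[OF assms(1) End_chart_in_atlas[OF U V]])
  show "(\<lambda>t. (\<gamma> t, L t)) ` T \<subseteq> End_dom U V" using assms(4) L by (auto simp: End_dom_def)
  show "smooth_on T (End_chart \<phi> \<Phi> \<circ> (\<lambda>t. (\<gamma> t, L t)))"
    using smooth_on_Pair[OF assms(1,6,7)] by (simp add: End_chart_def o_def)
qed

abbreviation End_vec where
  "End_vec U \<phi> V \<Phi> P \<equiv> End.chart_vec (End_dom U V) (End_chart \<phi> \<Phi>) P"

lemma End_velocity:
  assumes c: "smooth_curve (End_atlas \<A> E \<B>) T (\<lambda>t. (\<gamma> t, L t))" "t \<in> T"
    and U: "(U, \<phi>) \<in> \<A>" "\<gamma> t \<in> U" and V: "(V, \<Phi>) \<in> \<B>" "\<gamma> t \<in> V"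
    and d: "((\<phi> \<circ> \<gamma>) has_vector_derivative v) (at t)"
      "((\<lambda>u. End_mat \<Phi> (\<gamma> u) (L u)) has_vector_derivative B) (at t)"
  shows "velocity (End_atlas \<A> E \<B>) (\<lambda>t. (\<gamma> t, L t)) t = End_vec U \<phi> V \<Phi> (\<gamma> t, L t) (v, B)"
proof -
  have "(\<gamma> t, L t) \<in> End_dom U V"
    using End_curve_base(2)[OF c] U V by (simp add: End_dom_def)
  moreover have "((End_chart \<phi> \<Phi> \<circ> (\<lambda>t. (\<gamma> t, L t))) has_vector_derivative (v, B)) (at t)"
    using has_vector_derivative_Pair[OF d] by (simp add: End_chart_def o_def)
  ultimately show ?thesis
    using End.velocity_chart[OF c End_chart_in_atlas[OF U(1) V(1)]] vector_derivative_at by fastforce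
qed

end

section \<open>Parallel transport\<close>

context bundle_with_connection begin

lemma sections_along_in: "s \<in> sections_along E \<B> \<gamma> T \<Longrightarrow> t \<in> T \<Longrightarrow> s t \<in> E (\<gamma> t)"
  by (simp add: sections_along_def)

lemma sections_along_derivative:
  assumes "s \<in> sections_along E \<B> \<gamma> T" "t \<in> T" "(V, \<Phi>) \<in> \<B>" "\<gamma> t \<in> V"
  obtains y' where "((\<lambda>u. \<Phi> (\<gamma> u) (s u)) has_vector_derivative y') (at t)"
proof -
  obtain \<delta> where "\<delta> > 0" "smooth_on {t-\<delta><..<t+\<delta>} (\<lambda>u. \<Phi> (\<gamma> u) (s u))"
    using assms unfolding sections_along_def by fast
  then show thesis
    using that smooth_on_vector_derivative[of "{t-\<delta><..<t+\<delta>}" "\<lambda>u. \<Phi> (\<gamma> u) (s u)" t] by auto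
qed

text \<open>In coordinates an endomorphism \<open>M\<close> along a curve is parallel if and only if \<open>M' = M \<Gamma> - \<Gamma> M\<close>; this
  is one direction, \<open>parallel_EndD\<close> the other.\<close>

lemma parallel_EndI:
  assumes V: "(V, \<Phi>) \<in> \<B>" and T: "open T"
    and c: "smooth_curve (End_atlas \<A> E \<B>) T (\<lambda>t. (\<gamma> t, L t))" and \<gamma>V: "\<gamma> ` T \<subseteq> V"
    and M: "\<And>t. t \<in> T \<Longrightarrow> ((\<lambda>u. End_mat \<Phi> (\<gamma> u) (L u)) has_vector_derivative
       End_mat \<Phi> (\<gamma> t) (L t) ** conn_mat \<Phi> (\<gamma> t) (velocity \<A> \<gamma> t) -
       conn_mat \<Phi> (\<gamma> t) (velocity \<A> \<gamma> t) ** End_mat \<Phi> (\<gamma> t) (L t)) (at t)"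
  shows "parallel_End_along \<A> E \<B> D T \<gamma> L"
proof -
  have *: "cov_deriv_along \<A> E D \<Phi>' \<gamma> (\<lambda>u. L u (s u)) t = L t (cov_deriv_along \<A> E D \<Phi>' \<gamma> s t)"
    if ab: "{a<..<b} \<subseteq> T" and s: "s \<in> sections_along E \<B> \<gamma> {a<..<b}" and t: "t \<in> {a<..<b}"
      and V': "(V', \<Phi>') \<in> \<B>" "\<gamma> t \<in> V'" for a b s t V' \<Phi>'
  proof -
    let ?I = "{a<..<b}"
    have tT: "t \<in> T" using t ab by blast
    then have tV: "\<gamma> t \<in> V" using \<gamma>V by blast
    have \<gamma>: "smooth_curve \<A> ?I \<gamma>"
      by (rule smooth_curve_subset[OF End_curve_base(1)[OF c] _ ab]) simp
    have sE: "s u \<in> E (\<gamma> u)" if "u \<in> ?I" for u using sections_along_in[OF s that] .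
    have LE: "L u \<in> End_fibre (E (\<gamma> u))" if "u \<in> ?I" for u using End_curve_base(2)[OF c] that ab by blast
    obtain y' where y: "((\<lambda>u. \<Phi> (\<gamma> u) (s u)) has_vector_derivative y') (at t)"
      using sections_along_derivative[OF s t V tV] .
    let ?M = "\<lambda>u. End_mat \<Phi> (\<gamma> u) (L u)" and ?C = "conn_mat \<Phi> (\<gamma> t) (velocity \<A> \<gamma> t)"
    let ?y = "\<lambda>u. \<Phi> (\<gamma> u) (s u)"
    let ?z' = "?M t *v y' + (?M t ** ?C - ?C ** ?M t) *v ?y t"
    have "((\<lambda>u. ?M u *v ?y u) has_vector_derivative ?z') (at t)"
      by (rule bounded_bilinear.has_vector_derivative[OF bounded_bilinear_matrix_vector_mult M[OF tT] y])
    then have z: "((\<lambda>u. \<Phi> (\<gamma> u) (L u (s u))) has_vector_derivative ?z') (at t)"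
    proof (rule has_vector_derivative_transform_within_open[of _ _ _ ?I])
      fix u assume u: "u \<in> ?I"
      then have "\<gamma> u \<in> V" using \<gamma>V ab by blast
      then show "?M u *v ?y u = \<Phi> (\<gamma> u) (L u (s u))"
        using End_mat_apply[OF V _ LE[OF u] sE[OF u]] by simp
    qed (use t in auto)
    have Ls: "L u (s u) \<in> E (\<gamma> u)" if "u \<in> ?I" for u
      using End_fibre_in[OF LE[OF that] sE[OF that]] .
    note cs = cov_deriv_in_coords[OF V tV \<gamma> t y]
    note cLs = cov_deriv_in_coords[OF V tV \<gamma> t z]
    have "cov_deriv_along \<A> E D \<Phi> \<gamma> (\<lambda>u. L u (s u)) t = L t (cov_deriv_along \<A> E D \<Phi> \<gamma> s t)"
      by (rule triv_inject[OF V tV cLs(2) End_fibre_in[OF LE[OF t] cs(2)]])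
        (simp add: End_mat_apply[OF V tV LE[OF t]] cs sE[OF t] t cLs(1) matrix_vector_mult_diff_rdistrib
          matrix_vector_right_distrib flip: matrix_vector_mul_assoc)
    then show ?thesis
      using cov_deriv_change[OF V V'(1) tV V'(2) \<gamma> t sE y] cov_deriv_change[OF V V'(1) tV V'(2) \<gamma> t Ls z]
      by simp
  qed
  then show ?thesis
    unfolding parallel_End_along_def using c by fast
qed

lemma frame_along_curve:
  assumes V: "(V, \<Phi>) \<in> \<B>" and \<gamma>: "smooth_curve \<A> T \<gamma>" "\<gamma> ` T \<subseteq> V"
  shows "(\<lambda>u. local_frame E \<Phi> j (\<gamma> u)) \<in> sections_along E \<B> \<gamma> T"
proof -
  have "\<exists>\<delta>>0. smooth_on {t-\<delta><..<t+\<delta>} (\<lambda>u. \<Phi>' (\<gamma> u) (local_frame E \<Phi> j (\<gamma> u)))"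
    if V': "(V', \<Phi>') \<in> \<B>" and t: "t \<in> T" "\<gamma> t \<in> V'" for V' \<Phi>' t
  proof -
    have "smooth_at \<A> (\<lambda>q. \<Phi>' q (local_frame E \<Phi> j q)) (\<gamma> t)"
      by (rule section_smooth[OF local_frame_section[OF V] V']) (use t \<gamma> in auto)
    from smooth_at_along_curve[OF this \<gamma>(1) t(1)] show ?thesis
      by (metis (no_types, lifting) comp_apply ext)
  qed
  then show ?thesis
    unfolding sections_along_def using local_frame_in[OF V] \<gamma>(2) by fast
qed

text \<open>The equation \<open>D(L s) = L (D s)\<close> is tested on the members of the local frame, whose coordinates are
  constant.\<close>

lemma parallel_EndD:
  assumes V: "(V, \<Phi>) \<in> \<B>" "\<gamma> t \<in> V" and T: "open T" "t \<in> T"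
    and par: "parallel_End_along \<A> E \<B> D T \<gamma> L"
  shows "((\<lambda>u. End_mat \<Phi> (\<gamma> u) (L u)) has_vector_derivative
       End_mat \<Phi> (\<gamma> t) (L t) ** conn_mat \<Phi> (\<gamma> t) (velocity \<A> \<gamma> t) -
       conn_mat \<Phi> (\<gamma> t) (velocity \<A> \<gamma> t) ** End_mat \<Phi> (\<gamma> t) (L t)) (at t)"
proof -
  have c: "smooth_curve (End_atlas \<A> E \<B>) T (\<lambda>t. (\<gamma> t, L t))"
    using par by (simp add: parallel_End_along_def)
  obtain U \<phi> where U: "(U, \<phi>) \<in> \<A>" "\<gamma> t \<in> U" using charts_cover by blast
  obtain \<delta> where \<delta>: "\<delta> > 0" "{t-\<delta><..<t+\<delta>} \<subseteq> T" "\<gamma> ` {t-\<delta><..<t+\<delta>} \<subseteq> U \<inter> V"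
    "smooth_on {t-\<delta><..<t+\<delta>} (\<lambda>u. End_mat \<Phi> (\<gamma> u) (L u))"
    using End_curve_coords[OF c T(2) U V] by metis
  let ?I = "{t-\<delta><..<t+\<delta>}"
  have t: "t \<in> ?I" using \<delta> by simp
  let ?M = "\<lambda>u. End_mat \<Phi> (\<gamma> u) (L u)" and ?C = "conn_mat \<Phi> (\<gamma> t) (velocity \<A> \<gamma> t)"
  let ?M' = "vector_derivative ?M (at t)"
  have M: "(?M has_vector_derivative ?M') (at t)"
    by (rule smooth_on_vector_derivative[OF \<delta>(4) t])
  have \<gamma>: "smooth_curve \<A> ?I \<gamma>"
    by (rule smooth_curve_subset[OF End_curve_base(1)[OF c] _ \<delta>(2)]) simp
  have LE: "L u \<in> End_fibre (E (\<gamma> u))" if "u \<in> ?I" for u using End_curve_base(2)[OF c] that \<delta>(2) by blast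
  have "?M' *v axis j 1 = (?M t ** ?C - ?C ** ?M t) *v axis j 1" for j
  proof -
    let ?s = "\<lambda>u. local_frame E \<Phi> j (\<gamma> u)"
    have s: "?s \<in> sections_along E \<B> \<gamma> ?I"
      by (rule frame_along_curve[OF V(1) \<gamma>]) (use \<delta>(3) in auto)
    have \<gamma>V: "\<gamma> u \<in> V" if "u \<in> ?I" for u using \<delta>(3) that by blast
    have y: "((\<lambda>u. \<Phi> (\<gamma> u) (?s u)) has_vector_derivative 0) (at t)"
      by (rule has_vector_derivative_transform_within_open[OF has_vector_derivative_const _ t, of "axis j 1"])
        (simp_all add: triv_local_frame[OF V(1) \<gamma>V])
    have "((\<lambda>u. ?M u *v axis j 1) has_vector_derivative ?M' *v axis j 1) (at t)"
      by (rule bounded_linear.has_vector_derivative[OF bounded_bilinear.bounded_linear_left[OF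
              bounded_bilinear_matrix_vector_mult] M])
    then have z: "((\<lambda>u. \<Phi> (\<gamma> u) (L u (?s u))) has_vector_derivative ?M' *v axis j 1) (at t)"
      by (rule has_vector_derivative_transform_within_open[OF _ _ t])
        (simp_all add: End_mat_mult[OF V(1) \<gamma>V LE] local_frame_def)
    have sE: "?s t \<in> E (\<gamma> t)" by (rule local_frame_in[OF V])
    note cs = cov_deriv_in_coords[OF V \<gamma> t y]
    note cLs = cov_deriv_in_coords[OF V \<gamma> t z]
    have "cov_deriv_along \<A> E D \<Phi> \<gamma> (\<lambda>u. L u (?s u)) t = L t (cov_deriv_along \<A> E D \<Phi> \<gamma> ?s t)"
      using par[unfolded parallel_End_along_def, THEN conjunct2, THEN spec, THEN spec, THEN mp, OF \<delta>(2),
          THEN bspec, OF s, THEN bspec, OF t, THEN bspec, OF V(1)] V(2) by simp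
    then have "\<Phi> (\<gamma> t) (cov_deriv_along \<A> E D \<Phi> \<gamma> (\<lambda>u. L u (?s u)) t) =
        ?M t *v \<Phi> (\<gamma> t) (cov_deriv_along \<A> E D \<Phi> \<gamma> ?s t)"
      using End_mat_apply[OF V LE[OF t] cs(2)] by simp
    then have "?M' *v axis j 1 + ?C *v (?M t *v axis j 1) = ?M t *v (?C *v axis j 1)"
      by (simp add: cs(1) cLs(1) End_mat_apply[OF V LE[OF t] sE] triv_local_frame[OF V])
    then show ?thesis
      by (simp add: matrix_vector_mult_diff_rdistrib algebra_simps flip: matrix_vector_mul_assoc)
  qed
  then have "?M' = ?M t ** ?C - ?C ** ?M t"
    by (simp add: vec_eq_iff matrix_vector_mult_basis column_def)
  with M show ?thesis by simp
qed

end

section \<open>The twistor space in coordinates\<close>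

text \<open>The matrices of the orthogonal complex structures of one fibre, for the Gram matrix \<open>G\<close>, that meet
  the condition \<open>R\<close> on the dimensions of the two kernels. A general \<open>R\<close> covers the three subspaces at
  once.\<close>

definition twistor_mat ::
    "(nat \<Rightarrow> nat \<Rightarrow> bool) \<Rightarrow> real^'k^'k \<Rightarrow> real^'k^'k \<Rightarrow> (real^'k^'k) set" where
  "twistor_mat R G J = {M. M ** M = - mat 1 \<and> transpose M ** G ** M = G \<and>
     R (dim {y. J *v y + M *v y = 0}) (dim {y. J *v y - M *v y = 0})}"

lemma twistor_mat_conj:
  fixes P Q :: "real^'k::finite^'k"
  assumes PQ: "P ** Q = mat 1" and M: "M \<in> twistor_mat R G J"
  shows "Q ** M ** P \<in> twistor_mat R (transpose P ** G ** P) (Q ** J ** P)"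
proof -
  have QP: "Q ** P = mat 1" using PQ matrix_left_right_inverse by blast
  have PQv: "P *v (Q *v y) = y" and QPv: "Q *v (P *v y) = y" for y
    by (simp_all add: matrix_vector_mul_assoc PQ QP)
  have MM: "M *v (M *v y) = - y" for y
    using M by (simp add: twistor_mat_def matrix_vector_mul_assoc matrix_vector_mult_minus)
  have tr: "transpose Q ** transpose P = mat 1"
    using PQ by (metis matrix_transpose_mul transpose_mat)
  \<comment> \<open>The cases \<open>c = 1\<close> and \<open>c = -1\<close> are the two kernels.\<close>
  have ker: "dim {y. (Q ** J ** P) *v y + c *\<^sub>R ((Q ** M ** P) *v y) = 0} = dim {y. J *v y + c *\<^sub>R (M *v y) = 0}"
    for c
  proof -
    have "{y. (Q ** J ** P) *v y + c *\<^sub>R ((Q ** M ** P) *v y) = 0} = (*v) Q ` {y. J *v y + c *\<^sub>R (M *v y) = 0}"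
    proof (intro set_eqI iffI)
      fix y assume "y \<in> {y. (Q ** J ** P) *v y + c *\<^sub>R ((Q ** M ** P) *v y) = 0}"
      then have "Q *v (J *v (P *v y) + c *\<^sub>R (M *v (P *v y))) = 0"
        by (simp add: matrix_vector_right_distrib matrix_vector_mult_scaleR flip: matrix_vector_mul_assoc)
      then have "J *v (P *v y) + c *\<^sub>R (M *v (P *v y)) = 0"
        using PQv by (metis matrix_vector_mult_0_right)
      then show "y \<in> (*v) Q ` {y. J *v y + c *\<^sub>R (M *v y) = 0}"
        using QPv by (intro image_eqI[of _ _ "P *v y"]) auto
    next
      fix y assume "y \<in> (*v) Q ` {y. J *v y + c *\<^sub>R (M *v y) = 0}"
      then show "y \<in> {y. (Q ** J ** P) *v y + c *\<^sub>R ((Q ** M ** P) *v y) = 0}"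
        by (auto simp: PQv simp flip: matrix_vector_mul_assoc matrix_vector_mult_scaleR matrix_vector_right_distrib)
    qed
    moreover have "inj_on ((*v) Q) (span {y. J *v y + c *\<^sub>R (M *v y) = 0})"
      by (rule inj_on_inverseI[where g = "(*v) P"]) (rule PQv)
    ultimately show ?thesis using dim_image_eq[of "(*v) Q"] by simp
  qed
  have "(Q ** M ** P) ** (Q ** M ** P) = Q ** M ** (P ** Q) ** M ** P" by (simp add: matrix_mul_assoc)
  also have "\<dots> = - mat 1"
    by (simp add: matrix_eq matrix_vector_mult_minus PQ MM QPv flip: matrix_vector_mul_assoc)
  finally have 1: "(Q ** M ** P) ** (Q ** M ** P) = - mat 1" .
  have "transpose (Q ** M ** P) ** (transpose P ** G ** P) ** (Q ** M ** P) =
      transpose P ** transpose M ** (transpose Q ** transpose P) ** G ** (P ** Q) ** M ** P"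
    by (simp add: matrix_transpose_mul matrix_mul_assoc)
  also have "\<dots> = transpose P ** (transpose M ** G ** M) ** P"
    by (simp add: tr PQ matrix_mul_assoc)
  also have "\<dots> = transpose P ** G ** P" using M by (simp add: twistor_mat_def)
  finally show ?thesis
    using 1 M ker[of 1] ker[of "-1"] by (simp add: twistor_mat_def)
qed

lemma twistor_mat_conj_eq:
  fixes P Q :: "real^'k::finite^'k"
  assumes PQ: "P ** Q = mat 1" "Q ** P = mat 1"
    and G: "transpose P ** G ** P = G\<^sub>0" and J: "Q ** J ** P = J\<^sub>0"
  shows "M \<in> twistor_mat R G J \<Longrightarrow> Q ** M ** P \<in> twistor_mat R G\<^sub>0 J\<^sub>0"
    and "M \<in> twistor_mat R G\<^sub>0 J\<^sub>0 \<Longrightarrow> P ** M ** Q \<in> twistor_mat R G J"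
proof -
  show "M \<in> twistor_mat R G J \<Longrightarrow> Q ** M ** P \<in> twistor_mat R G\<^sub>0 J\<^sub>0"
    using twistor_mat_conj[OF PQ(1)] G J by blast
  have tr: "transpose Q ** transpose P = mat 1"
    using PQ by (metis matrix_transpose_mul transpose_mat)
  have "transpose Q ** G\<^sub>0 ** Q = (transpose Q ** transpose P) ** G ** (P ** Q)"
    by (simp add: G[symmetric] matrix_mul_assoc)
  then have "transpose Q ** G\<^sub>0 ** Q = G" by (simp add: tr PQ)
  moreover have "P ** J\<^sub>0 ** Q = (P ** Q) ** J ** (P ** Q)"
    by (simp add: J[symmetric] matrix_mul_assoc)
  then have "P ** J\<^sub>0 ** Q = J" by (simp add: PQ)
  ultimately show "M \<in> twistor_mat R G\<^sub>0 J\<^sub>0 \<Longrightarrow> P ** M ** Q \<in> twistor_mat R G J"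
    using twistor_mat_conj[OF PQ(2)] by metis
qed

locale twistor_bundle = bundle_with_connection \<A> E \<B> D
  for \<A> :: "('m::topological_space, 'a::euclidean_space) atlas"
    and E :: "'m \<Rightarrow> 'v::real_vector set" and \<B> :: "('m, 'v, 'k::finite) trivs"
    and D :: "('m, 'v) conn" +
  fixes g :: "'m \<Rightarrow> 'v \<Rightarrow> 'v \<Rightarrow> real" and J :: "'m \<Rightarrow> 'v \<Rightarrow> 'v"
  assumes metric: "bundle_metric \<A> E \<B> g" "metric_connection \<A> E \<B> g D"
    and J: "twistor_section \<A> E \<B> g J" "parallel_End \<A> E \<B> D J"
begin

lemma g_linear: "v \<in> E p \<Longrightarrow> linear_on_set (E p) (g p v)"
  and g_sym: "v \<in> E p \<Longrightarrow> w \<in> E p \<Longrightarrow> g p v w = g p w v"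
  and g_pos: "v \<in> E p \<Longrightarrow> v \<noteq> 0 \<Longrightarrow> g p v v > 0"
  using metric(1) unfolding bundle_metric_def by blast+

lemma g_smooth:
  "open W \<Longrightarrow> s \<in> sections \<A> E \<B> W \<Longrightarrow> s' \<in> sections \<A> E \<B> W \<Longrightarrow> p \<in> W \<Longrightarrow>
    smooth_at \<A> (\<lambda>q. g q (s q) (s' q)) p"
  using metric(1) unfolding bundle_metric_def by blast

lemma g_connection:
  "open W \<Longrightarrow> s \<in> sections \<A> E \<B> W \<Longrightarrow> s' \<in> sections \<A> E \<B> W \<Longrightarrow> p \<in> W \<Longrightarrow> X \<in> tangent_space \<A> UNIV p \<Longrightarrow>
    X (\<lambda>q. g q (s q) (s' q)) = g p (D p X s) (s' p) + g p (s p) (D p X s')"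
  using metric(2) unfolding metric_connection_def by blast

lemma J_fibre: "J p \<in> twistor_fibre (E p) (g p)"
  using J(1) by (simp add: twistor_section_def twistor_space_def)

lemma J_End: "J p \<in> End_fibre (E p)"
  using J_fibre by (simp add: twistor_fibre_def)

lemma J_section: "open W \<Longrightarrow> s \<in> sections \<A> E \<B> W \<Longrightarrow> (\<lambda>q. J q (s q)) \<in> sections \<A> E \<B> W"
  using J(1) by (simp add: twistor_section_def)

lemma J_parallel:
  "open W \<Longrightarrow> s \<in> sections \<A> E \<B> W \<Longrightarrow> p \<in> W \<Longrightarrow> X \<in> tangent_space \<A> UNIV p \<Longrightarrow>
    D p X (\<lambda>q. J q (s q)) = J p (D p X s)"
  using J(2) unfolding parallel_End_def by force

definition gram :: "('m \<Rightarrow> 'v \<Rightarrow> real^'k) \<Rightarrow> 'm \<Rightarrow> real^'k^'k" where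
  "gram \<Phi> p = (\<chi> i j. g p (local_frame E \<Phi> i p) (local_frame E \<Phi> j p))"

lemma g_gram:
  assumes V: "(V, \<Phi>) \<in> \<B>" "p \<in> V"
  shows "g p (untriv \<Phi> p x) (untriv \<Phi> p y) = x \<bullet> (gram \<Phi> p *v y)"
proof -
  have exp: "g p v (untriv \<Phi> p y) = (\<Sum>j\<in>UNIV. y $ j * g p v (local_frame E \<Phi> j p))"
    if v: "v \<in> E p" for v y
  proof -
    have lin: "linear (\<lambda>y. g p v (untriv \<Phi> p y))"
      using g_linear[OF v] untriv_in[OF V]
      by (intro linearI) (simp_all add: linear_add[OF linear_untriv[OF V]]
          linear_scale[OF linear_untriv[OF V]] linear_on_set_def)
    have "y = (\<Sum>i\<in>UNIV. y $ i *\<^sub>R axis i 1)"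
      by (simp add: vec_eq_iff axis_def if_distrib cong: if_cong)
    then have "g p v (untriv \<Phi> p y) = g p v (untriv \<Phi> p (\<Sum>i\<in>UNIV. y $ i *\<^sub>R axis i 1))" by simp
    then show ?thesis by (simp add: linear_sum[OF lin] linear_scale[OF lin] local_frame_def)
  qed
  have "g p (untriv \<Phi> p x) (untriv \<Phi> p y) =
      (\<Sum>j\<in>UNIV. y $ j * g p (local_frame E \<Phi> j p) (untriv \<Phi> p x))"
    by (simp add: exp untriv_in[OF V] g_sym local_frame_in[OF V])
  also have "\<dots> = (\<Sum>j\<in>UNIV. \<Sum>i\<in>UNIV. x $ i * (gram \<Phi> p $ i $ j * y $ j))"
    by (simp add: exp local_frame_in[OF V] sum_distrib_left gram_def g_sym[OF local_frame_in[OF V] local_frame_in[OF V]] mult_ac)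
  also have "\<dots> = x \<bullet> (gram \<Phi> p *v y)"
    by (subst sum.swap) (simp add: inner_vec_def matrix_vector_mult_def sum_distrib_left)
  finally show ?thesis .
qed

lemma D_frame:
  assumes V: "(V, \<Phi>) \<in> \<B>" "p \<in> V" and X: "X \<in> tangent_space \<A> UNIV p"
  shows "D p X (local_frame E \<Phi> j) = untriv \<Phi> p (conn_mat \<Phi> p X *v axis j 1)"
proof -
  have "\<Phi> p (D p X (local_frame E \<Phi> j)) = conn_mat \<Phi> p X *v axis j 1"
    by (simp add: conn_mat_def vec_eq_iff matrix_vector_mult_basis column_def)
  then show ?thesis
    using untriv_triv[OF V D_in[OF triv_open[OF V(1)] local_frame_section[OF V(1)] V(2) X]] by metis
qed

text \<open>The equation \<open>\<nabla>g = 0\<close> in coordinates.\<close>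

lemma gram_derivative:
  assumes V: "(V, \<Phi>) \<in> \<B>" "\<gamma> t \<in> V" and \<gamma>: "smooth_curve \<A> T \<gamma>" "t \<in> T"
  shows "((\<lambda>u. gram \<Phi> (\<gamma> u)) has_vector_derivative
     transpose (conn_mat \<Phi> (\<gamma> t) (velocity \<A> \<gamma> t)) ** gram \<Phi> (\<gamma> t) +
     gram \<Phi> (\<gamma> t) ** conn_mat \<Phi> (\<gamma> t) (velocity \<A> \<gamma> t)) (at t)"
proof (intro has_vector_derivative_vec)
  fix i j
  let ?X = "velocity \<A> \<gamma> t" and ?e = "local_frame E \<Phi>" let ?C = "conn_mat \<Phi> (\<gamma> t) ?X"
  have X: "?X \<in> tangent_space \<A> UNIV (\<gamma> t)" by (rule velocity_in_tangent_space[OF \<gamma>])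
  note fr = triv_open[OF V(1)] local_frame_section[OF V(1)]
  have local_frame_at: "local_frame E \<Phi> i (\<gamma> t) = untriv \<Phi> (\<gamma> t) (axis i 1)" for i
    by (simp add: local_frame_def)
  have "?X (\<lambda>q. g q (?e i q) (?e j q)) =
      g (\<gamma> t) (D (\<gamma> t) ?X (?e i)) (?e j (\<gamma> t)) + g (\<gamma> t) (?e i (\<gamma> t)) (D (\<gamma> t) ?X (?e j))"
    by (rule g_connection[OF fr fr(2) V(2) X])
  also have "\<dots> = (?C *v axis i 1) \<bullet> (gram \<Phi> (\<gamma> t) *v axis j 1) + axis i 1 \<bullet> (gram \<Phi> (\<gamma> t) *v (?C *v axis j 1))"
    by (simp add: D_frame[OF V X] local_frame_at g_gram[OF V])
  also have "\<dots> = (transpose ?C ** gram \<Phi> (\<gamma> t) + gram \<Phi> (\<gamma> t) ** ?C) $ i $ j"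
    by (simp only: matrix_entry matrix_vector_mult_add_rdistrib inner_add_right inner_transpose_mult
        flip: matrix_vector_mul_assoc)
  finally have "?X (\<lambda>q. g q (?e i q) (?e j q)) = (transpose ?C ** gram \<Phi> (\<gamma> t) + gram \<Phi> (\<gamma> t) ** ?C) $ i $ j" .
  moreover have "((\<lambda>u. g (\<gamma> u) (?e i (\<gamma> u)) (?e j (\<gamma> u))) has_real_derivative ?X (\<lambda>q. g q (?e i q) (?e j q))) (at t)"
    by (rule velocity_derivative[OF \<gamma> g_smooth[OF fr fr(2) V(2)]])
  ultimately show "((\<lambda>u. gram \<Phi> (\<gamma> u) $ i $ j) has_vector_derivative
      (transpose ?C ** gram \<Phi> (\<gamma> t) + gram \<Phi> (\<gamma> t) ** ?C) $ i $ j) (at t)"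
    by (simp add: gram_def has_real_derivative_iff_has_vector_derivative)
qed

definition J_mat :: "('m \<Rightarrow> 'v \<Rightarrow> real^'k) \<Rightarrow> 'm \<Rightarrow> real^'k^'k" where
  "J_mat \<Phi> p = End_mat \<Phi> p (J p)"

text \<open>The equation \<open>\<nabla>J = 0\<close> in coordinates.\<close>

lemma J_mat_derivative:
  assumes V: "(V, \<Phi>) \<in> \<B>" "\<gamma> t \<in> V" and \<gamma>: "smooth_curve \<A> T \<gamma>" "t \<in> T"
  shows "((\<lambda>u. J_mat \<Phi> (\<gamma> u)) has_vector_derivative
     J_mat \<Phi> (\<gamma> t) ** conn_mat \<Phi> (\<gamma> t) (velocity \<A> \<gamma> t) -
     conn_mat \<Phi> (\<gamma> t) (velocity \<A> \<gamma> t) ** J_mat \<Phi> (\<gamma> t)) (at t)"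
proof (intro has_vector_derivative_vec)
  fix i j
  let ?X = "velocity \<A> \<gamma> t" and ?e = "local_frame E \<Phi> j" let ?C = "conn_mat \<Phi> (\<gamma> t) ?X"
  have X: "?X \<in> tangent_space \<A> UNIV (\<gamma> t)" by (rule velocity_in_tangent_space[OF \<gamma>])
  note fr = triv_open[OF V(1)] local_frame_section[OF V(1)]
  let ?Je = "\<lambda>q. J q (?e q)"
  have Je: "?Je \<in> sections \<A> E \<B> V" by (rule J_section[OF fr])
  have Je_coord: "\<Phi> q (?Je q) = J_mat \<Phi> q *v axis j 1" if "q \<in> V" for q
    by (simp add: J_mat_def local_frame_def End_mat_mult[OF V(1) that J_End])
  obtain \<delta> where \<delta>: "\<delta> > 0" "\<gamma> ` {t-\<delta><..<t+\<delta>} \<subseteq> V"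
    using curve_stays_in_open[OF \<gamma> fr(1) V(2)] by metis
  have "((\<lambda>u. \<Phi> (\<gamma> u) (?Je (\<gamma> u))) has_vector_derivative tvec_deriv ?X (\<lambda>q. \<Phi> q (?Je q))) (at t)"
    by (rule velocity_vec_derivative[OF \<gamma> section_smooth[OF Je V(1) V(2) V(2)]])
  then have "((\<lambda>u. J_mat \<Phi> (\<gamma> u) *v axis j 1) has_vector_derivative tvec_deriv ?X (\<lambda>q. \<Phi> q (?Je q))) (at t)"
  proof (rule has_vector_derivative_transform_within_open[of _ _ _ "{t-\<delta><..<t+\<delta>}"])
    fix u assume "u \<in> {t-\<delta><..<t+\<delta>}"
    then have "\<gamma> u \<in> V" using \<delta>(2) by blast
    then show "\<Phi> (\<gamma> u) (?Je (\<gamma> u)) = J_mat \<Phi> (\<gamma> u) *v axis j 1" by (rule Je_coord)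
  qed (use \<delta>(1) in auto)
  from bounded_linear.has_vector_derivative[OF bounded_linear_vec_nth this, of i]
  have d: "((\<lambda>u. J_mat \<Phi> (\<gamma> u) $ i $ j) has_vector_derivative tvec_deriv ?X (\<lambda>q. \<Phi> q (?Je q)) $ i) (at t)"
    by (simp add: matrix_vector_mult_basis column_def)
  have "\<Phi> (\<gamma> t) (D (\<gamma> t) ?X ?Je) = tvec_deriv ?X (\<lambda>q. \<Phi> q (?Je q)) + ?C *v \<Phi> (\<gamma> t) (?Je (\<gamma> t))"
    by (rule D_in_coords[OF V(1) fr(1) order_refl V(2) Je X])
  moreover have "\<Phi> (\<gamma> t) (D (\<gamma> t) ?X ?Je) = J_mat \<Phi> (\<gamma> t) *v (?C *v axis j 1)"
    using J_parallel[OF fr V(2) X, of j] D_frame[OF V X, of j]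
    by (simp add: J_mat_def End_mat_mult[OF V J_End])
  ultimately have "tvec_deriv ?X (\<lambda>q. \<Phi> q (?Je q)) = (J_mat \<Phi> (\<gamma> t) ** ?C - ?C ** J_mat \<Phi> (\<gamma> t)) *v axis j 1"
    by (simp add: Je_coord[OF V(2)] matrix_vector_mult_diff_rdistrib flip: matrix_vector_mul_assoc)
  with d show "((\<lambda>u. J_mat \<Phi> (\<gamma> u) $ i $ j) has_vector_derivative
      (J_mat \<Phi> (\<gamma> t) ** ?C - ?C ** J_mat \<Phi> (\<gamma> t)) $ i $ j) (at t)"
    by (simp add: matrix_vector_mult_basis column_def)
qed

definition twistor_sub :: "(nat \<Rightarrow> nat \<Rightarrow> bool) \<Rightarrow> ('m \<times> ('v \<Rightarrow> 'v)) set" where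
  "twistor_sub R = {(p, K) \<in> twistor_space E g.
     R (dim {v \<in> E p. J p v + K v = 0}) (dim {v \<in> E p. J p v - K v = 0})}"

lemma twistor_sub_coords:
  assumes V: "(V, \<Phi>) \<in> \<B>" "p \<in> V" and K: "K \<in> End_fibre (E p)"
  shows "(p, K) \<in> twistor_sub R \<longleftrightarrow> End_mat \<Phi> p K \<in> twistor_mat R (gram \<Phi> p) (J_mat \<Phi> p)"
proof -
  let ?M = "End_mat \<Phi> p K" and ?G = "gram \<Phi> p" and ?u = "untriv \<Phi> p"
  have fibre: "(\<forall>v\<in>E p. P v) \<longleftrightarrow> (\<forall>y. P (?u y))" for P
    using untriv_in[OF V] untriv_triv[OF V] by metis
  have KE: "K (?u y) = ?u (?M *v y)" for y
    using untriv_triv[OF V End_fibre_in[OF K untriv_in[OF V]], of y] by (simp add: End_mat_mult[OF V K])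
  have JE: "J p (?u y) = ?u (J_mat \<Phi> p *v y)" for y
    using untriv_triv[OF V End_fibre_in[OF J_End untriv_in[OF V]], of y]
    by (simp add: J_mat_def End_mat_mult[OF V J_End])
  have u_eq: "?u x = ?u y \<longleftrightarrow> x = y" for x y using inj_untriv[OF V] by (auto dest: injD)
  note lin = linear_untriv[OF V]
  have 1: "(\<forall>v\<in>E p. K (K v) = - v) \<longleftrightarrow> ?M ** ?M = - mat 1"
    unfolding fibre
    by (simp add: KE linear_neg[OF lin, symmetric] u_eq matrix_eq matrix_vector_mult_minus flip: matrix_vector_mul_assoc)
  have 2: "(\<forall>v\<in>E p. \<forall>w\<in>E p. g p (K v) (K w) = g p v w) \<longleftrightarrow> transpose ?M ** ?G ** ?M = ?G"
  proof -
    have "(?M *v x) \<bullet> (?G *v (?M *v y)) = x \<bullet> ((transpose ?M ** ?G ** ?M) *v y)" for x y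
      by (simp only: inner_transpose_mult flip: matrix_vector_mul_assoc)
    then have "(\<forall>v\<in>E p. \<forall>w\<in>E p. g p (K v) (K w) = g p v w) \<longleftrightarrow>
        (\<forall>x y. x \<bullet> ((transpose ?M ** ?G ** ?M) *v y) = x \<bullet> (?G *v y))"
      unfolding fibre by (simp add: KE g_gram[OF V])
    also have "\<dots> \<longleftrightarrow> transpose ?M ** ?G ** ?M = ?G"
      by (metis matrix_eq vector_eq_ldot)
    finally show ?thesis .
  qed
  have dim: "dim {v \<in> E p. J p v + c *\<^sub>R K v = 0} = dim {y. J_mat \<Phi> p *v y + c *\<^sub>R (?M *v y) = 0}" for c
  proof -
    have "J p (?u y) + c *\<^sub>R K (?u y) = 0 \<longleftrightarrow> J_mat \<Phi> p *v y + c *\<^sub>R (?M *v y) = 0" for y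
      using u_eq[of _ 0]
      by (simp add: KE JE linear_0[OF lin] flip: linear_scale[OF lin] linear_add[OF lin])
    then have "{v \<in> E p. J p v + c *\<^sub>R K v = 0} = ?u ` {y. J_mat \<Phi> p *v y + c *\<^sub>R (?M *v y) = 0}"
      using untriv_in[OF V] untriv_triv[OF V] by (auto simp: image_iff) (metis)
    moreover have "dim (?u ` S) = dim S" for S
      by (rule dim_image_eq[OF lin]) (rule inj_on_subset[OF inj_untriv[OF V]], simp)
    ultimately show ?thesis by simp
  qed
  show ?thesis
    using K 1 2 dim[of 1] dim[of "-1"]
    by (simp add: twistor_sub_def twistor_space_def twistor_fibre_def twistor_mat_def)
qed

end

section \<open>Orthogonal complex structures and their kernels relative to \<open>J\<close>\<close>

definition mat_velocities :: "(real^'k::finite^'k) set \<Rightarrow> real^'k^'k \<Rightarrow> (real^'k^'k) set" where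
  "mat_velocities S M = {A. \<exists>\<epsilon>>0. \<exists>k. smooth_on {-\<epsilon><..<\<epsilon>} k \<and> k 0 = M \<and>
     (k has_vector_derivative A) (at 0) \<and> (\<forall>t\<in>{-\<epsilon><..<\<epsilon>}. k t \<in> S)}"

text \<open>The flags say which of the two kernel dimensions are prescribed.\<close>

definition kernel_cond :: "bool \<Rightarrow> bool \<Rightarrow> nat \<Rightarrow> nat \<Rightarrow> nat \<Rightarrow> nat \<Rightarrow> bool" where
  "kernel_cond \<alpha> \<beta> m m' a b \<longleftrightarrow> (\<alpha> \<longrightarrow> a = m) \<and> (\<beta> \<longrightarrow> b = m')"

locale fibre_metric =
  fixes G :: "real^'k::finite^'k"
  assumes G_sym: "x \<bullet> (G *v y) = y \<bullet> (G *v x)"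
    and G_pos: "x \<noteq> 0 \<Longrightarrow> x \<bullet> (G *v x) > 0"
begin

definition ip :: "real^'k \<Rightarrow> real^'k \<Rightarrow> real" where
  "ip x y = x \<bullet> (G *v y)"

lemma ip_simps:
  "ip (x + x') y = ip x y + ip x' y" "ip x (y + y') = ip x y + ip x y'"
  "ip (x - x') y = ip x y - ip x' y" "ip x (y - y') = ip x y - ip x y'"
  "ip (- x) y = - ip x y" "ip x (- y) = - ip x y"
  "ip (c *\<^sub>R x) y = c * ip x y" "ip x (c *\<^sub>R y) = c * ip x y"
  "ip 0 y = 0" "ip x 0 = 0"
  by (simp_all add: ip_def inner_add_left inner_add_right inner_diff_left inner_diff_right
      matrix_vector_right_distrib matrix_vector_mult_diff_distrib matrix_vector_mult_minus matrix_vector_mult_scaleR)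

lemma ip_commute: "ip x y = ip y x"
  by (simp add: ip_def G_sym)

lemma ip_eq_0: "ip x x = 0 \<longleftrightarrow> x = 0"
  using G_pos[of x] by (cases "x = 0") (auto simp: ip_def)

lemma ip_eqI: "(\<And>z. ip x z = ip y z) \<Longrightarrow> x = y"
  using ip_eq_0[of "x - y"] by (simp add: ip_simps)

definition skew :: "real^'k^'k \<Rightarrow> bool" where
  "skew A \<longleftrightarrow> (\<forall>x y. ip (A *v x) y = - ip x (A *v y))"

lemma skew_matrix: "skew A \<longleftrightarrow> transpose A ** G + G ** A = 0"
proof -
  have "skew A \<longleftrightarrow> (\<forall>x y. x \<bullet> ((transpose A ** G + G ** A) *v y) = x \<bullet> (0 *v y))"
    by (simp add: skew_def ip_def matrix_vector_mult_add_rdistrib inner_add_right inner_transpose_mult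
        eq_neg_iff_add_eq_0 del: transpose_matrix_vector flip: matrix_vector_mul_assoc)
  also have "\<dots> \<longleftrightarrow> transpose A ** G + G ** A = 0"
    by (metis matrix_eq vector_eq_ldot)
  finally show ?thesis .
qed

text \<open>The kernel and the range of a skew matrix are orthogonal, hence complementary. The matrix \<open>P\<close> projects
  to the kernel along the range, and \<open>X\<close> inverts \<open>N\<close> on the range and vanishes on the kernel.\<close>

lemma skew_group_inverse:
  assumes N: "skew N"
  obtains P X :: "real^'k^'k" where
    "\<And>v. N *v (P *v v) = 0" "\<And>v. P *v (N *v v) = 0" "\<And>v. N *v v = 0 \<Longrightarrow> P *v v = v"
    "\<And>v. X *v (N *v v) = v - P *v v" "\<And>v. N *v (X *v v) = v - P *v v"
    "\<And>v. X *v (P *v v) = 0" "\<And>v. P *v (X *v v) = 0"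
    "\<And>x y. ip (P *v x) y = ip x (P *v y)" "skew X"
proof -
  have Ns: "ip (N *v x) y = - ip x (N *v y)" for x y using N by (simp add: skew_def)
  have indep: "N *v w = 0" if "N *v (N *v w) = 0" for w
    using Ns[of w "N *v w"] that by (simp add: ip_simps ip_eq_0)
  let ?I = "range ((*v) N)"
  have sI: "subspace ?I"
    using linear_subspace_image[OF matrix_vector_mul_linear subspace_UNIV] .
  have "dim ((*v) N ` ?I) = dim ?I"
  proof (rule dim_image_eq)
    show "inj_on ((*v) N) (span ?I)"
      unfolding span_eq_iff[THEN iffD2, OF sI]
    proof (rule inj_onI, clarify)
      fix x y assume "N *v (N *v x) = N *v (N *v y)"
      then have "N *v (N *v (x - y)) = 0" by (simp add: matrix_vector_mult_diff_distrib)
      then have "N *v (x - y) = 0" by (rule indep)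
      then show "N *v x = N *v y" by (simp add: matrix_vector_mult_diff_distrib)
    qed
  qed simp
  then have NI: "(*v) N ` ?I = ?I"
    by (intro subspace_dim_equal[OF linear_subspace_image[OF matrix_vector_mul_linear sI] sI]) auto
  have "\<exists>a. N *v a = 0 \<and> (\<exists>w. v - a = N *v w)" for v
  proof -
    have "N *v v \<in> (*v) N ` ?I" unfolding NI by simp
    then obtain w where "N *v v = N *v (N *v w)" by blast
    then show ?thesis
      by (intro exI[of _ "v - N *v w"]) (auto simp: matrix_vector_mult_diff_distrib)
  qed
  then obtain f where f0: "\<And>v. N *v (f v) = 0" and f1: "\<And>v. \<exists>w. v - f v = N *v w" by metis
  have uniq: "f v = a" if "N *v a = 0" "v - a = N *v w" for v a w
  proof -
    obtain w' where w': "v - f v = N *v w'" using f1 by blast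
    have eq: "a - f v = N *v (w' - w)"
      using that(2) w' by (simp add: matrix_vector_mult_diff_distrib algebra_simps)
    have "N *v (N *v (w' - w)) = N *v a - N *v (f v)"
      unfolding eq[symmetric] by (rule matrix_vector_mult_diff_distrib)
    then have "N *v (N *v (w' - w)) = 0" by (simp only: that(1) f0) simp
    then show ?thesis using indep eq by fastforce
  qed
  have lin: "linear f"
  proof (rule linearI)
    fix x y c
    obtain w w' where w: "x - f x = N *v w" "y - f y = N *v w'" using f1 by metis
    show "f (x + y) = f x + f y"
      by (rule uniq[of _ _ "w + w'"]) (simp_all add: f0 matrix_vector_right_distrib flip: w)
    show "f (c *\<^sub>R x) = c *\<^sub>R f x"
      by (rule uniq[of _ _ "c *\<^sub>R w"]) (simp_all add: f0 matrix_vector_mult_scaleR scaleR_diff_right flip: w)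
  qed
  define P where "P = matrix f"
  have Pv: "P *v v = f v" for v by (simp add: P_def matrix_mult_linear[OF lin])
  have P1: "N *v (P *v v) = 0" "P *v (N *v v) = 0" "N *v v = 0 \<Longrightarrow> P *v v = v" for v
    using f0 uniq[of 0 "N *v v" v] uniq[of v v 0] by (simp_all add: Pv)
  \<comment> \<open>The inverse of \<open>N + P\<close> is the identity on the kernel and inverts \<open>N\<close> on the range.\<close>
  have "\<exists>Y. Y ** (N + P) = mat 1"
    unfolding matrix_left_invertible_ker
  proof (intro allI impI)
    fix v assume v: "(N + P) *v v = 0"
    then have "P *v ((N + P) *v v) = 0" by simp
    then have "P *v v = 0"
      by (simp add: matrix_vector_mult_add_rdistrib matrix_vector_right_distrib P1)
    then show "v = 0" using v P1(3) by (simp add: matrix_vector_mult_add_rdistrib)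
  qed
  then obtain Y where "Y ** (N + P) = mat 1" "(N + P) ** Y = mat 1"
    using matrix_left_right_inverse by blast
  then have "Y *v ((N + P) *v v) = v" "(N + P) *v (Y *v v) = v" for v
    by (simp_all add: matrix_vector_mul_assoc)
  then have Y: "Y *v (N *v v + P *v v) = v" "N *v (Y *v v) + P *v (Y *v v) = v" for v
    by (simp_all add: matrix_vector_mult_add_rdistrib)
  have PP: "P *v (P *v v) = P *v v" for v using P1 by blast
  have YP: "Y *v (P *v v) = P *v v" for v using Y(1)[of "P *v v"] by (simp add: P1 PP)
  have PY: "P *v (Y *v v) = P *v v" for v
    using arg_cong[OF Y(2)[of v], of "(*v) P"] by (simp add: matrix_vector_right_distrib P1 PP)
  define X where "X = Y - P"
  have X: "X *v (N *v v) = v - P *v v" "N *v (X *v v) = v - P *v v"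
    "X *v (P *v v) = 0" "P *v (X *v v) = 0" for v
    using Y(1)[of v] Y(2)[of v]
    by (auto simp: X_def matrix_vector_mult_diff_rdistrib matrix_vector_mult_diff_distrib
        matrix_vector_right_distrib P1 PP YP PY algebra_simps)
  have Psym0: "ip (P *v x) (v - P *v v) = 0" for x v
    using Ns[of "P *v x" "X *v v"] by (simp add: X P1 ip_simps)
  have Psym: "ip (P *v x) y = ip x (P *v y)" for x y
    using Psym0[of x y] Psym0[of y x] by (simp add: ip_simps ip_commute)
  have "skew X"
    unfolding skew_def
  proof (intro allI)
    fix x y
    have "ip (X *v x) y = ip (X *v x) (P *v y) + ip (X *v x) (N *v (X *v y))"
      by (simp add: X ip_simps)
    also have "ip (X *v x) (P *v y) = 0" by (simp flip: Psym add: X ip_simps)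
    also have "ip (X *v x) (N *v (X *v y)) = - ip (N *v (X *v x)) (X *v y)" by (simp add: Ns)
    also have "\<dots> = - ip x (X *v y)" by (simp add: X ip_simps Psym)
    finally show "ip (X *v x) y = - ip x (X *v y)" by simp
  qed
  then show thesis using that[of P X] P1 X Psym by blast
qed

lemma kernel_subspace: "subspace {v. N *v v = 0}" for N :: "real^'k^'k"
  by (simp add: subspace_def matrix_vector_right_distrib matrix_vector_mult_scaleR)

text \<open>Near \<open>N\<close>, a kernel vector of \<open>N'\<close> is determined by its projection to the kernel of \<open>N\<close> and differs
  from it by a term of the order of \<open>N' - N\<close>; in particular the kernel does not grow. If the dimensions agree, every
  \<open>u\<close> in the kernel of \<open>N\<close> is the projection of some \<open>u'\<close> in the kernel of \<open>N'\<close>. For \<open>v\<close> in the kernel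
  of \<open>N\<close>, skewness gives \<open>\<langle>(N' - N) u', v\<rangle> = 0\<close>, and replacing \<open>u'\<close> by \<open>u\<close> costs a term of second
  order.\<close>

lemma kernel_perturbation:
  assumes N: "skew N"
  obtains \<eta> C where "\<eta> > 0"
    "\<And>N'. norm (N' - N) < \<eta> \<Longrightarrow> dim {v. N' *v v = 0} \<le> dim {v. N *v v = 0}"
    "\<And>N' u v. norm (N' - N) < \<eta> \<Longrightarrow> dim {v. N' *v v = 0} = dim {v. N *v v = 0} \<Longrightarrow>
      N *v u = 0 \<Longrightarrow> N *v v = 0 \<Longrightarrow> \<bar>ip ((N' - N) *v u) v\<bar> \<le> C * (norm (N' - N))\<^sup>2 * norm u * norm v"
proof -
  obtain P X where P: "\<And>v. N *v (P *v v) = 0" "\<And>v. P *v (N *v v) = 0" "\<And>v. N *v v = 0 \<Longrightarrow> P *v v = v"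
    and X: "\<And>v. X *v (N *v v) = v - P *v v"
    using skew_group_inverse[OF N] by metis
  obtain K where K: "K > 0" "\<And>(A::real^'k^'k) x. norm (A *v x) \<le> norm A * norm x * K"
    using bounded_bilinear.pos_bounded[OF bounded_bilinear_matrix_vector_mult] by blast
  define c where "c = norm X * K * K + 1"
  have c: "c > 0" using K by (auto simp: c_def intro: add_nonneg_pos)
  define \<eta> where "\<eta> = 1 / (2 * c)"
  have \<eta>: "\<eta> > 0" using c by (simp add: \<eta>_def)
  have est: "norm (X *v ((N' - N) *v v)) \<le> c * norm (N' - N) * norm v" for N' v
  proof -
    have "norm (X *v ((N' - N) *v v)) \<le> norm X * (norm (N' - N) * norm v * K) * K"
      using K(2)[of X "(N' - N) *v v"] K(2)[of "N' - N" v] K(1)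
      by (meson mult_left_mono mult_right_mono norm_ge_zero less_imp_le order_trans)
    also have "\<dots> = (norm X * K * K) * (norm (N' - N) * norm v)" by simp
    also have "\<dots> \<le> c * (norm (N' - N) * norm v)"
      by (intro mult_right_mono) (simp_all add: c_def)
    finally show ?thesis by (simp add: mult.assoc)
  qed
  have small: "c * norm (N' - N) \<le> 1/2" if "norm (N' - N) < \<eta>" for N'
    using that c by (simp add: \<eta>_def field_simps)
  \<comment> \<open>For \<open>v\<close> in the kernel of \<open>N'\<close>, the component of \<open>v\<close> off the kernel of \<open>N\<close> is \<open>X N v = X (N - N') v\<close>.\<close>
  have off: "norm (v - P *v v) \<le> 2 * c * norm (N' - N) * norm (P *v v)"
    if N': "norm (N' - N) < \<eta>" and v: "N' *v v = 0" for N' v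
  proof -
    have "v - P *v v = - (X *v ((N' - N) *v v))"
      using v by (simp add: matrix_vector_mult_diff_rdistrib matrix_vector_mult_minus X)
    then have "norm (v - P *v v) \<le> c * norm (N' - N) * norm v" using est[of N' v] by (metis norm_minus_cancel)
    also have "norm v \<le> norm (P *v v) + norm (v - P *v v)"
      using norm_triangle_ineq[of "P *v v" "v - P *v v"] by simp
    finally have "norm (v - P *v v) \<le> c * norm (N' - N) * (norm (P *v v) + norm (v - P *v v))"
      using c by (simp add: mult_left_mono)
    also have "\<dots> \<le> c * norm (N' - N) * norm (P *v v) + 1/2 * norm (v - P *v v)"
      using mult_right_mono[OF small[OF N'], of "norm (v - P *v v)"] by (simp add: algebra_simps)
    finally show ?thesis by simp
  qed
  have inj: "inj_on ((*v) P) {v. N' *v v = 0}" if N': "norm (N' - N) < \<eta>" for N'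
  proof (rule inj_onI)
    fix x y assume xy: "x \<in> {v. N' *v v = 0}" "y \<in> {v. N' *v v = 0}" "P *v x = P *v y"
    then have "N' *v (x - y) = 0" "P *v (x - y) = 0" by (simp_all add: matrix_vector_mult_diff_distrib)
    then show "x = y" using off[OF N', of "x - y"] by simp
  qed
  have dimP: "dim ((*v) P ` {v. N' *v v = 0}) = dim {v. N' *v v = 0}" if "norm (N' - N) < \<eta>" for N'
    by (rule dim_image_eq[OF matrix_vector_mul_linear])
      (simp add: span_eq_iff[THEN iffD2, OF kernel_subspace] inj[OF that])
  have sub: "(*v) P ` {v. N' *v v = 0} \<subseteq> {v. N *v v = 0}" for N' using P(1) by auto
  show thesis
  proof (rule that[OF \<eta>, of "2 * c * K * K * norm G"])
    fix N' assume N': "norm (N' - N) < \<eta>"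
    show le: "dim {v. N' *v v = 0} \<le> dim {v. N *v v = 0}"
      using dim_subset[OF sub, of N'] dimP[OF N'] by simp
    fix u v assume eq: "dim {v. N' *v v = 0} = dim {v. N *v v = 0}" and u: "N *v u = 0" and v: "N *v v = 0"
    have "(*v) P ` {v. N' *v v = 0} = {v. N *v v = 0}"
      by (rule subspace_dim_equal[OF linear_subspace_image[OF matrix_vector_mul_linear kernel_subspace]
            kernel_subspace sub]) (simp add: dimP[OF N'] eq)
    moreover have "u \<in> {v. N *v v = 0}" using u by simp
    ultimately have "u \<in> (*v) P ` {v. N' *v v = 0}" by (simp only:)
    then obtain u' where u': "N' *v u' = 0" "P *v u' = u" by auto
    have "ip ((N' - N) *v u') v = ip u' (N *v v)"
      using N u'(1) by (simp add: matrix_vector_mult_diff_rdistrib skew_def ip_simps)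
    then have "ip ((N' - N) *v u) v = - ip ((N' - N) *v (u' - u)) v"
      using v by (simp add: matrix_vector_mult_diff_distrib ip_simps)
    moreover have "norm (u' - u) \<le> 2 * c * norm (N' - N) * norm u"
      using off[OF N' u'(1)] u'(2) by simp
    ultimately have "\<bar>ip ((N' - N) *v u) v\<bar> \<le> norm ((N' - N) *v (u' - u)) * norm (G *v v)"
      by (simp add: ip_def Cauchy_Schwarz_ineq2)
    also have "\<dots> \<le> (norm (N' - N) * (2 * c * norm (N' - N) * norm u) * K) * (norm G * norm v * K)"
    proof (rule mult_mono)
      have "norm ((N' - N) *v (u' - u)) \<le> norm (N' - N) * norm (u' - u) * K" by (rule K(2))
      also have "\<dots> \<le> norm (N' - N) * (2 * c * norm (N' - N) * norm u) * K"
        using \<open>norm (u' - u) \<le> 2 * c * norm (N' - N) * norm u\<close> K(1)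
        by (intro mult_right_mono mult_left_mono) auto
      finally show "norm ((N' - N) *v (u' - u)) \<le> norm (N' - N) * (2 * c * norm (N' - N) * norm u) * K" .
    qed (use K c in auto)
    also have "\<dots> = 2 * c * K * K * norm G * (norm (N' - N))\<^sup>2 * norm u * norm v"
      by (simp add: power2_eq_square)
    finally show "\<bar>ip ((N' - N) *v u) v\<bar> \<le> 2 * c * K * K * norm G * (norm (N' - N))\<^sup>2 * norm u * norm v" .
  qed
qed

lemma constant_kernel_dim_derivative:
  assumes N: "skew (k 0)" and k: "(k has_vector_derivative A) (at 0)" and \<epsilon>: "\<epsilon> > 0"
    and dim: "\<And>t. t \<in> {-\<epsilon><..<\<epsilon>} \<Longrightarrow> dim {v. k t *v v = 0} = dim {v. k 0 *v v = 0}"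
    and uv: "k 0 *v u = 0" "k 0 *v v = 0"
  shows "ip (A *v u) v = 0"
proof -
  obtain \<eta> C where \<eta>: "\<eta> > 0" and pert:
    "\<And>N' u v. norm (N' - k 0) < \<eta> \<Longrightarrow> dim {v. N' *v v = 0} = dim {v. k 0 *v v = 0} \<Longrightarrow>
      k 0 *v u = 0 \<Longrightarrow> k 0 *v v = 0 \<Longrightarrow>
      \<bar>ip ((N' - k 0) *v u) v\<bar> \<le> C * (norm (N' - k 0))\<^sup>2 * norm u * norm v"
    by (rule kernel_perturbation[OF N]) (rule that; assumption)
  define h where "h t = C * norm u * norm v * ((k t - k 0) \<bullet> (k t - k 0)) - ip ((k t - k 0) *v u) v" for t
  have k': "((\<lambda>t. k t - k 0) has_vector_derivative A) (at 0)"
    using has_vector_derivative_diff[OF k has_vector_derivative_const[of "k 0"]] by simp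
  have "((\<lambda>t. ip ((k t - k 0) *v u) v) has_vector_derivative ip (A *v u) v) (at 0)"
    unfolding ip_def
    by (intro bounded_linear.has_vector_derivative[OF bounded_linear_inner_left]
        bounded_linear.has_vector_derivative[OF bounded_bilinear.bounded_linear_left[OF
          bounded_bilinear_matrix_vector_mult]] k')
  moreover have "((\<lambda>t. (k t - k 0) \<bullet> (k t - k 0)) has_vector_derivative 0) (at 0)"
    using bounded_bilinear.has_vector_derivative[OF bounded_bilinear_inner k' k'] by simp
  ultimately have "(h has_vector_derivative C * norm u * norm v * 0 - ip (A *v u) v) (at 0)"
    unfolding h_def
    by (intro has_vector_derivative_diff bounded_linear.has_vector_derivative[OF bounded_linear_mult_right])
  then have h': "(h has_real_derivative - ip (A *v u) v) (at 0)"
    by (simp add: has_real_derivative_iff_has_vector_derivative)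
  have "\<forall>\<^sub>F t in nhds 0. norm (k t - k 0) < \<eta>"
  proof -
    have "isCont (\<lambda>t. norm (k t - k 0)) 0"
      using has_vector_derivative_continuous[OF k'] by (intro continuous_norm)
    then have "((\<lambda>t. norm (k t - k 0)) \<longlongrightarrow> norm (k 0 - k 0)) (nhds 0)"
      unfolding continuous_at tendsto_at_iff_tendsto_nhds[of "\<lambda>t. norm (k t - k 0)"] .
    then show ?thesis using \<eta> by (intro order_tendstoD(2)) auto
  qed
  then obtain d where d: "d > 0" "\<And>t. dist t 0 < d \<Longrightarrow> norm (k t - k 0) < \<eta>"
    unfolding eventually_nhds_metric by blast
  \<comment> \<open>\<open>h\<close> is nonnegative near its zero at \<open>0\<close>, so its derivative vanishes there.\<close>
  have "h 0 \<le> h t" if t: "\<bar>0 - t\<bar> < min d \<epsilon>" for t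
  proof -
    have "\<bar>ip ((k t - k 0) *v u) v\<bar> \<le> C * (norm (k t - k 0))\<^sup>2 * norm u * norm v"
      using t by (intro pert d dim uv) auto
    then show ?thesis by (simp add: h_def ip_simps power2_norm_eq_inner mult_ac)
  qed
  then have "- ip (A *v u) v = 0"
    using d(1) \<epsilon> by (intro DERIV_local_min[OF h', of "min d \<epsilon>"]) auto
  then show ?thesis by simp
qed

definition orth_complex :: "real^'k^'k \<Rightarrow> bool" where
  "orth_complex J \<longleftrightarrow> J ** J = - mat 1 \<and> transpose J ** G ** J = G"

lemma orth_complex_sq: "orth_complex J \<Longrightarrow> J *v (J *v v) = - v"
  by (simp add: orth_complex_def matrix_vector_mult_minus matrix_vector_mul_assoc)

lemma orth_complex_isometry:
  assumes "orth_complex J" shows "ip (J *v x) (J *v y) = ip x y"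
proof -
  have "x \<bullet> ((transpose J ** G ** J) *v y) = (J *v x) \<bullet> (G *v (J *v y))"
    by (simp only: inner_transpose_mult flip: matrix_vector_mul_assoc)
  with assms show ?thesis by (simp add: orth_complex_def ip_def)
qed

lemma orth_complex_skew: "orth_complex J \<Longrightarrow> skew J"
  unfolding skew_def by (metis orth_complex_sq orth_complex_isometry ip_simps(6) minus_minus)

lemma orth_complex_minus: "orth_complex J \<Longrightarrow> orth_complex (- J)"
  by (simp add: orth_complex_def matrix_ring transpose_def vec_eq_iff)
    (simp add: matrix_matrix_mult_def sum_negf)

lemma skew_add: "skew A \<Longrightarrow> skew B \<Longrightarrow> skew (A + B)"
  and skew_scale: "skew A \<Longrightarrow> skew (c *\<^sub>R A)"
  and skew_0: "skew 0"
  by (simp_all add: skew_def mv_simps ip_simps flip: scaleR_matrix_vector_assoc)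

lemma skewD: "skew A \<Longrightarrow> ip (A *v x) y = - ip x (A *v y)"
  by (simp add: skew_def)

text \<open>Let \<open>N = J + M\<close>, with \<open>P\<close> and \<open>X\<close> as in \<open>skew_group_inverse\<close>. From \<open>J N = N M\<close> and \<open>M N = N J\<close> one
  gets \<open>J X = X M\<close>, \<open>M X = X J\<close> and that \<open>P\<close> commutes with both. With these rules \<open>B = P A X - X A P\<close> is skew,
  commutes with \<open>J\<close>, and \<open>[B, M]\<close> is \<open>A - (1 - P) A (1 - P)\<close>, as \<open>P A P = 0\<close>.\<close>

lemma off_diagonal_part:
  assumes J: "orth_complex J" and M: "orth_complex M" and A: "skew A" and AM: "\<And>v. A *v (M *v v) = - (M *v (A *v v))"
    and ker: "\<And>u v. J *v u + M *v u = 0 \<Longrightarrow> J *v v + M *v v = 0 \<Longrightarrow> ip (A *v u) v = 0"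
  obtains B P :: "real^'k^'k" where "skew B" "B ** J = J ** B"
    "\<And>v. (B ** M - M ** B) *v v = A *v v - (A *v (v - P *v v) - P *v (A *v (v - P *v v)))"
    "\<And>v. J *v v + M *v v = 0 \<Longrightarrow> P *v v = v" "\<And>v. J *v (P *v v) + M *v (P *v v) = 0"
    "\<And>x y. ip (P *v x) y = ip x (P *v y)"
proof -
  define N where "N = J + M"
  have Nv: "N *v v = J *v v + M *v v" for v by (simp add: N_def mv_simps)
  have "skew N" unfolding N_def by (intro skew_add orth_complex_skew J M)
  then obtain P X :: "real^'k^'k" where P:
    "\<And>v. N *v (P *v v) = 0" "\<And>v. P *v (N *v v) = 0" "\<And>v. N *v v = 0 \<Longrightarrow> P *v v = v"
    and X: "\<And>v. X *v (N *v v) = v - P *v v" "\<And>v. N *v (X *v v) = v - P *v v"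
    "\<And>v. X *v (P *v v) = 0" "\<And>v. P *v (X *v v) = 0"
    and Ps: "\<And>x y. ip (P *v x) y = ip x (P *v y)" and Xs: "skew X"
    by (rule skew_group_inverse) (rule that; assumption)
  have JN: "J *v (N *v v) = N *v (M *v v)" and MN: "M *v (N *v v) = N *v (J *v v)" for v
    by (simp_all add: Nv mv_simps orth_complex_sq[OF J] orth_complex_sq[OF M])
  have split: "P *v v + N *v (X *v v) = v" for v by (simp add: X)
  have PJ: "P *v (J *v v) = J *v (P *v v)" and PM: "P *v (M *v v) = M *v (P *v v)" for v
  proof -
    have "N *v (J *v (P *v v)) = 0" "N *v (M *v (P *v v)) = 0"
      by (simp_all add: JN[symmetric] MN[symmetric] P)
    note * = this[THEN P(3)]
    have "P *v (J *v v) = P *v (J *v (P *v v + N *v (X *v v)))" by (simp only: split)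
    also have "\<dots> = J *v (P *v v)"
      using * by (simp only: matrix_vector_right_distrib JN P) simp
    finally show "P *v (J *v v) = J *v (P *v v)" .
    have "P *v (M *v v) = P *v (M *v (P *v v + N *v (X *v v)))" by (simp only: split)
    also have "\<dots> = M *v (P *v v)"
      using * by (simp only: matrix_vector_right_distrib MN P) simp
    finally show "P *v (M *v v) = M *v (P *v v)" .
  qed
  have JX: "J *v (X *v v) = X *v (M *v v)" and MX: "M *v (X *v v) = X *v (J *v v)" for v
  proof -
    have "J *v (X *v v) = X *v (N *v (J *v (X *v v)))" by (simp add: X PJ)
    also have "\<dots> = X *v (M *v v)" by (simp only: MN[symmetric] X(2)) (simp add: mv_simps PM[symmetric] X)
    finally show "J *v (X *v v) = X *v (M *v v)" .
    have "M *v (X *v v) = X *v (N *v (M *v (X *v v)))" by (simp add: X PM)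
    also have "\<dots> = X *v (J *v v)" by (simp only: JN[symmetric] X(2)) (simp add: mv_simps PJ[symmetric] X)
    finally show "M *v (X *v v) = X *v (J *v v)" .
  qed
  have JP: "J *v (P *v v) = - (M *v (P *v v))" for v
    using P(1)[of v] by (simp add: Nv eq_neg_iff_add_eq_0)
  have PAP: "P *v (A *v (P *v v)) = 0" for v
  proof (rule ip_eqI)
    fix z show "ip (P *v (A *v (P *v v))) z = ip 0 z"
      using ker[of "P *v v" "P *v z"] P(1) by (simp add: Ps Nv ip_simps)
  qed
  define B where "B = P ** A ** X - X ** A ** P"
  have Bv: "B *v v = P *v (A *v (X *v v)) - X *v (A *v (P *v v))" for v
    by (simp add: B_def mv_simps flip: matrix_vector_mul_assoc)
  show thesis
  proof (rule that[of B P])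
    show "skew B"
      unfolding skew_def by (simp add: Bv ip_simps Ps skewD[OF Xs] skewD[OF A])
    have 1: "P *v (A *v (M *v (X *v v))) = J *v (P *v (A *v (X *v v)))" for v
      by (simp add: AM mv_simps PM JP)
    have 2: "X *v (A *v (M *v (P *v v))) = - (J *v (X *v (A *v (P *v v))))" for v
      by (simp add: AM mv_simps JX)
    have "B *v (J *v v) = J *v (B *v v)" for v
    proof -
      have "B *v (J *v v) = P *v (A *v (M *v (X *v v))) + X *v (A *v (M *v (P *v v)))"
        by (simp add: Bv MX PJ JP mv_simps)
      then show ?thesis by (simp add: 1 2 Bv mv_simps)
    qed
    then show "B ** J = J ** B" by (simp add: matrix_eq flip: matrix_vector_mul_assoc)
    show "(B ** M - M ** B) *v v = A *v v - (A *v (v - P *v v) - P *v (A *v (v - P *v v)))" for v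
    proof -
      have "(B ** M - M ** B) *v v = (P *v (A *v (X *v (M *v v))) - M *v (P *v (A *v (X *v v))))
          + (M *v (X *v (A *v (P *v v))) - X *v (A *v (P *v (M *v v))))"
        by (simp add: Bv mv_simps flip: matrix_vector_mul_assoc)
      also have "M *v (P *v (A *v (X *v v))) = - (P *v (A *v (X *v (J *v v))))"
        by (simp add: MX[symmetric] AM mv_simps PM)
      also have "P *v (A *v (X *v (M *v v))) - - (P *v (A *v (X *v (J *v v)))) = P *v (A *v (X *v (N *v v)))"
        by (simp add: Nv mv_simps)
      also have "\<dots> = P *v (A *v v)" by (simp add: X mv_simps PAP)
      also have "X *v (A *v (P *v (M *v v))) = - (J *v (X *v (A *v (P *v v))))"
        by (simp add: PM 2)
      also have "M *v (X *v (A *v (P *v v))) - - (J *v (X *v (A *v (P *v v)))) = N *v (X *v (A *v (P *v v)))"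
        by (simp add: Nv)
      also have "\<dots> = A *v (P *v v)" by (simp add: X PAP)
      finally show ?thesis by (simp add: mv_simps PAP)
    qed
    show "P *v v = v" if "J *v v + M *v v = 0" for v using P(3) that by (simp add: Nv)
    show "J *v (P *v v) + M *v (P *v v) = 0" for v using P(1)[of v] by (simp add: Nv)
  qed (rule Ps)
qed

lemma skew_flow:
  assumes C: "skew C"
  obtains d P Q where "inverse_flows d (\<lambda>_. - C) P Q"
    "\<And>t. t \<in> {-d<..<d} \<Longrightarrow> transpose (P t) ** G ** P t = G"
proof -
  obtain d P Q where F: "inverse_flows d (\<lambda>_. - C) P Q"
    by (rule inverse_flows_exist[OF zero_less_one smooth_on_const])
  have "transpose (- C) = - transpose C"
    using linear_neg[OF bounded_linear.linear[OF bounded_linear_transpose]] .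
  then have "transpose (- C) ** G + G ** (- C) = 0"
    using C by (simp add: skew_matrix matrix_ring add_eq_0_iff)
  then have "transpose (P t) ** G ** P t = G" if "t \<in> {-d<..<d}" for t
    using flow_preserves_form[OF F that, of "\<lambda>_. G"] by simp
  with F show thesis by (rule that)
qed

lemma velocity_conj:
  fixes P Q k :: "real \<Rightarrow> real^'k^'k"
  assumes P: "P 0 = mat 1" "Q 0 = mat 1" "(P has_vector_derivative C) (at 0)" "(Q has_vector_derivative - C) (at 0)"
    and k: "(k has_vector_derivative A) (at 0)"
  shows "((\<lambda>t. P t ** k t ** Q t) has_vector_derivative A + (C ** k 0 - k 0 ** C)) (at 0)"
proof -
  have "((\<lambda>t. P t ** k t ** Q t) has_vector_derivative
      (P 0 ** k 0) ** (- C) + (P 0 ** A + C ** k 0) ** Q 0) (at 0)"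
    by (rule has_vector_derivative_matrix_mult[OF has_vector_derivative_matrix_mult[OF P(3) k] P(4)])
  then show ?thesis by (simp add: P matrix_ring algebra_simps)
qed

text \<open>Conjugation by \<open>exp (t B)\<close> preserves the metric, \<open>J\<close> and hence the whole set of matrices, so every
  curve in the set may be conjugated by it.\<close>

lemma velocities_add_orbit:
  assumes B: "skew B" "B ** J = J ** B" and A: "A \<in> mat_velocities (twistor_mat R G J) M"
  shows "A + (B ** M - M ** B) \<in> mat_velocities (twistor_mat R G J) M"
proof -
  obtain \<delta> P Q where F0: "inverse_flows \<delta> (\<lambda>_. - B) P Q"
    and PG: "\<And>t. t \<in> {-\<delta><..<\<delta>} \<Longrightarrow> transpose (P t) ** G ** P t = G"
    by (rule skew_flow[OF B(1)]) (rule that; assumption)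
  note F = inverse_flowsD[OF F0]
  obtain \<epsilon> k where k: "\<epsilon> > 0" "smooth_on {-\<epsilon><..<\<epsilon>} k" "k 0 = M" "(k has_vector_derivative A) (at 0)"
    "\<And>t. t \<in> {-\<epsilon><..<\<epsilon>} \<Longrightarrow> k t \<in> twistor_mat R G J"
    using A unfolding mat_velocities_def by blast
  have J: "Q t ** J ** P t = J" if "t \<in> {-\<delta><..<\<delta>}" for t
    using flow_intertwines[OF F0 that, of "\<lambda>_. J"] B(2) by (simp add: matrix_ring)
  have 0: "0 \<in> {-\<delta><..<\<delta>}" using F(1) by simp
  let ?I = "{- min \<delta> \<epsilon><..<min \<delta> \<epsilon>}"
  have I: "?I \<subseteq> {-\<delta><..<\<delta>}" "?I \<subseteq> {-\<epsilon><..<\<epsilon>}" by auto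
  show ?thesis
    unfolding mat_velocities_def
  proof (intro CollectI exI conjI ballI)
    show "min \<delta> \<epsilon> > 0" using F k by simp
    show "smooth_on ?I (\<lambda>t. P t ** k t ** Q t)"
      by (intro smooth_on_matrix_mult smooth_on_subset[OF F(4) I(1)] smooth_on_subset[OF F(5) I(1)]
          smooth_on_subset[OF k(2) I(2)]) simp_all
    show "P 0 ** k 0 ** Q 0 = M" by (simp add: F k)
    show "((\<lambda>t. P t ** k t ** Q t) has_vector_derivative A + (B ** M - M ** B)) (at 0)"
      using velocity_conj[of P Q B, OF F(2,3) _ _ k(4)] F(6,7)[OF 0] by (simp add: F(2,3) k(3) matrix_ring)
    fix t assume "t \<in> ?I"
    then have t: "t \<in> {-\<delta><..<\<delta>}" "t \<in> {-\<epsilon><..<\<epsilon>}" using I by blast+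
    show "P t ** k t ** Q t \<in> twistor_mat R G J"
      by (rule twistor_mat_conj_eq(2)[OF F(9)[OF t(1)] F(8)[OF t(1)] PG[OF t(1)] J[OF t(1)] k(5)[OF t(2)]])
  qed
qed

text \<open>The velocity of \<open>exp (t C) M exp (-t C)\<close> with \<open>C = M A / 2\<close> is \<open>A\<close>, and this curve agrees with \<open>M\<close> on the
  kernel of \<open>A\<close>. So the kernels of \<open>J + M\<close> and \<open>J - M\<close>, where they are to be preserved, persist along the
  curve, and by semicontinuity they do not grow for small times.\<close>

lemma velocities_diagonal:
  assumes J: "orth_complex J" and M: "M \<in> twistor_mat (kernel_cond \<alpha> \<beta> m m') G J"
    and A: "skew A" and AM: "\<And>v. A *v (M *v v) = - (M *v (A *v v))"
    and ker1: "\<And>v. \<alpha> \<Longrightarrow> J *v v + M *v v = 0 \<Longrightarrow> A *v v = 0"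
    and ker2: "\<And>v. \<beta> \<Longrightarrow> J *v v - M *v v = 0 \<Longrightarrow> A *v v = 0"
  shows "A \<in> mat_velocities (twistor_mat (kernel_cond \<alpha> \<beta> m m') G J) M"
proof -
  have cM: "orth_complex M" using M by (simp add: twistor_mat_def orth_complex_def)
  have dimM: "\<alpha> \<Longrightarrow> dim {v. J *v v + M *v v = 0} = m" "\<beta> \<Longrightarrow> dim {v. J *v v - M *v v = 0} = m'"
    using M by (simp_all add: twistor_mat_def kernel_cond_def)
  define C where "C = (1/2) *\<^sub>R (M ** A)"
  have Cv: "C *v v = (1/2) *\<^sub>R (M *v (A *v v))" for v
    by (simp add: C_def flip: scaleR_matrix_vector_assoc matrix_vector_mul_assoc)
  have C: "skew C"
    unfolding skew_def by (simp add: Cv ip_simps skewD[OF A] skewD[OF orth_complex_skew[OF cM]] AM)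
  have "(C ** M - M ** C) *v v = A *v v" for v
    by (simp add: Cv mv_simps AM orth_complex_sq[OF cM] flip: matrix_vector_mul_assoc)
  then have CM: "C ** M - M ** C = A" by (simp add: matrix_eq)
  obtain \<delta> P Q where F0: "inverse_flows \<delta> (\<lambda>_. - C) P Q"
    and PG: "\<And>t. t \<in> {-\<delta><..<\<delta>} \<Longrightarrow> transpose (P t) ** G ** P t = G"
    by (rule skew_flow[OF C]) (rule that; assumption)
  note F = inverse_flowsD[OF F0]
  define k where "k t = P t ** M ** Q t" for t
  have k0: "k 0 = M" by (simp add: k_def F)
  have 0: "0 \<in> {-\<delta><..<\<delta>}" using F(1) by simp
  have ks: "smooth_on {-\<delta><..<\<delta>} k"
    unfolding k_def by (intro smooth_on_matrix_mult F(4,5) smooth_on_const) simp_all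
  have k': "(k has_vector_derivative A) (at 0)"
    using velocity_conj[of P Q C "\<lambda>_. M" 0, OF F(2,3) _ _ has_vector_derivative_const] F(6,7)[OF 0]
    by (simp add: F(2,3) CM k_def[abs_def] matrix_ring)
  have kc: "orth_complex (k t)" if t: "t \<in> {-\<delta><..<\<delta>}" for t
  proof -
    have "M \<in> twistor_mat (\<lambda>_ _. True) G M" using cM by (simp add: twistor_mat_def orth_complex_def)
    moreover have "Q t ** (P t ** M ** Q t) ** P t = (Q t ** P t) ** M ** (Q t ** P t)"
      by (simp add: matrix_mul_assoc)
    then have "Q t ** (P t ** M ** Q t) ** P t = M" by (simp add: F(8)[OF t])
    ultimately have "P t ** M ** Q t \<in> twistor_mat (\<lambda>_ _. True) G (P t ** M ** Q t)"
      using twistor_mat_conj_eq(2)[OF F(9)[OF t] F(8)[OF t] PG[OF t]] by blast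
    then show ?thesis by (simp add: twistor_mat_def orth_complex_def k_def)
  qed
  have fixed: "k t *v v = M *v v" if t: "t \<in> {-\<delta><..<\<delta>}" and v: "A *v v = 0" for t v
  proof -
    have Q: "Q t *v w = w" if w: "A *v w = 0" for w
    proof -
      have "((\<lambda>t. Q t *v w) has_vector_derivative 0) (at u)" if "u \<in> {-\<delta><..<\<delta>}" for u
        using bounded_linear.has_vector_derivative[OF bounded_bilinear.bounded_linear_left[OF
              bounded_bilinear_matrix_vector_mult] F(7)[OF that], of w]
        by (simp add: matrix_ring matrix_vector_mult_minus w Cv flip: matrix_vector_mul_assoc)
      from has_vector_derivative_0_const[OF this t] show ?thesis by (simp add: F)
    qed
    have PQ: "P t *v (Q t *v w) = w" for w by (simp add: matrix_vector_mul_assoc F(9)[OF t])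
    have "A *v (M *v v) = 0" using v by (simp add: AM)
    then have "P t *v (M *v v) = M *v v" using PQ[of "M *v v"] by (simp only: Q)
    then show ?thesis using Q[OF v] by (simp add: k_def flip: matrix_vector_mul_assoc)
  qed
  \<comment> \<open>The cases \<open>c = 1\<close> and \<open>c = -1\<close> are the two kernels.\<close>
  have ev: "\<exists>d>0. \<forall>t. \<bar>t\<bar> < d \<longrightarrow> dim {v. J *v v + c *\<^sub>R (k t *v v) = 0} = dim {v. J *v v + c *\<^sub>R (M *v v) = 0}"
    if ker: "\<And>v. J *v v + c *\<^sub>R (M *v v) = 0 \<Longrightarrow> A *v v = 0" for c
  proof -
    have eq: "(J + c *\<^sub>R K) *v v = J *v v + c *\<^sub>R (K *v v)" for K v
      by (simp add: mv_simps flip: scaleR_matrix_vector_assoc)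
    have "skew (J + c *\<^sub>R M)" by (intro skew_add skew_scale orth_complex_skew J cM)
    then obtain \<eta> where \<eta>: "\<eta> > 0" "\<And>N'. norm (N' - (J + c *\<^sub>R M)) < \<eta> \<Longrightarrow>
        dim {v. N' *v v = 0} \<le> dim {v. (J + c *\<^sub>R M) *v v = 0}"
      by (rule kernel_perturbation) (rule that; assumption)
    have "isCont (\<lambda>t. norm ((J + c *\<^sub>R k t) - (J + c *\<^sub>R M))) 0"
      using has_vector_derivative_continuous[OF k'] by (intro continuous_intros)
    then have "((\<lambda>t. norm ((J + c *\<^sub>R k t) - (J + c *\<^sub>R M))) \<longlongrightarrow> norm ((J + c *\<^sub>R k 0) - (J + c *\<^sub>R M))) (nhds 0)"
      unfolding continuous_at tendsto_at_iff_tendsto_nhds[of "\<lambda>t. norm ((J + c *\<^sub>R k t) - (J + c *\<^sub>R M))"] .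
    then have "\<forall>\<^sub>F t in nhds 0. norm ((J + c *\<^sub>R k t) - (J + c *\<^sub>R M)) < \<eta>"
      using \<eta>(1) by (intro order_tendstoD(2)) (auto simp: k0)
    then obtain d where d: "d > 0" "\<And>t. dist t 0 < d \<Longrightarrow> norm ((J + c *\<^sub>R k t) - (J + c *\<^sub>R M)) < \<eta>"
      unfolding eventually_nhds_metric by blast
    have "dim {v. J *v v + c *\<^sub>R (k t *v v) = 0} = dim {v. J *v v + c *\<^sub>R (M *v v) = 0}"
      if t: "\<bar>t\<bar> < min d \<delta>" for t
    proof (rule antisym)
      show "dim {v. J *v v + c *\<^sub>R (k t *v v) = 0} \<le> dim {v. J *v v + c *\<^sub>R (M *v v) = 0}"
        using \<eta>(2)[OF d(2)[of t]] t unfolding eq by simp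
      have "k t *v v = M *v v" if "J *v v + c *\<^sub>R (M *v v) = 0" for v
        using t by (intro fixed ker that) auto
      then show "dim {v. J *v v + c *\<^sub>R (M *v v) = 0} \<le> dim {v. J *v v + c *\<^sub>R (k t *v v) = 0}"
        by (intro dim_subset) auto
    qed
    then show ?thesis using d(1) F(1) by (intro exI[of _ "min d \<delta>"]) auto
  qed
  have "\<exists>d>0. \<forall>t. \<bar>t\<bar> < d \<longrightarrow> \<alpha> \<longrightarrow> dim {v. J *v v + k t *v v = 0} = m"
    using ev[of 1] ker1 dimM(1) by (cases \<alpha>) (auto intro: zero_less_one)
  then obtain d1 where d1: "d1 > 0" "\<And>t. \<bar>t\<bar> < d1 \<Longrightarrow> \<alpha> \<Longrightarrow> dim {v. J *v v + k t *v v = 0} = m" by blast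
  have "\<exists>d>0. \<forall>t. \<bar>t\<bar> < d \<longrightarrow> \<beta> \<longrightarrow> dim {v. J *v v - k t *v v = 0} = m'"
    using ev[of "-1"] ker2 dimM(2) by (cases \<beta>) (auto intro: zero_less_one)
  then obtain d2 where d2: "d2 > 0" "\<And>t. \<bar>t\<bar> < d2 \<Longrightarrow> \<beta> \<Longrightarrow> dim {v. J *v v - k t *v v = 0} = m'" by blast
  define d where "d = min \<delta> (min d1 d2)"
  have d: "d > 0" using d1 d2 F by (simp add: d_def)
  have "k t \<in> twistor_mat (kernel_cond \<alpha> \<beta> m m') G J" if "t \<in> {-d<..<d}" for t
  proof -
    have t: "\<bar>t\<bar> < d1" "\<bar>t\<bar> < d2" "t \<in> {-\<delta><..<\<delta>}" using that by (auto simp: d_def)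
    show ?thesis
      using kc[OF t(3)] d1(2)[OF t(1)] d2(2)[OF t(2)] by (simp add: twistor_mat_def orth_complex_def kernel_cond_def)
  qed
  moreover have "smooth_on {-d<..<d} k" by (rule smooth_on_subset[OF ks]) (auto simp: d_def)
  ultimately show ?thesis
    unfolding mat_velocities_def using d k0 k' by blast
qed

lemma velocity_conditions:
  assumes J: "orth_complex J" and A: "A \<in> mat_velocities (twistor_mat (kernel_cond \<alpha> \<beta> m m') G J) M"
  shows "skew A" and "A *v (M *v v) = - (M *v (A *v v))"
    and "\<alpha> \<Longrightarrow> J *v u + M *v u = 0 \<Longrightarrow> J *v w + M *v w = 0 \<Longrightarrow> ip (A *v u) w = 0"
    and "\<beta> \<Longrightarrow> J *v u - M *v u = 0 \<Longrightarrow> J *v w - M *v w = 0 \<Longrightarrow> ip (A *v u) w = 0"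
proof -
  obtain \<epsilon> k where k: "\<epsilon> > 0" "k 0 = M" "(k has_vector_derivative A) (at 0)"
    "\<And>t. t \<in> {-\<epsilon><..<\<epsilon>} \<Longrightarrow> k t \<in> twistor_mat (kernel_cond \<alpha> \<beta> m m') G J"
    using A unfolding mat_velocities_def by blast
  have 0: "0 \<in> {-\<epsilon><..<\<epsilon>}" using k(1) by simp
  have c: "orth_complex (k t)" if "t \<in> {-\<epsilon><..<\<epsilon>}" for t
    using k(4)[OF that] by (simp add: twistor_mat_def orth_complex_def)
  note app = bounded_linear.has_vector_derivative[OF bounded_bilinear.bounded_linear_left[OF
              bounded_bilinear_matrix_vector_mult] k(3)]
  show "skew A"
    unfolding skew_def
  proof (intro allI)
    fix x y
    have ipl: "bounded_linear (\<lambda>x. ip x y)" for y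
      unfolding ip_def by (rule bounded_linear_inner_left)
    have "((\<lambda>t. ip (k t *v x) y + ip (k t *v y) x) has_vector_derivative (ip (A *v x) y + ip (A *v y) x)) (at 0)"
      by (intro has_vector_derivative_add bounded_linear.has_vector_derivative[OF ipl] app)
    moreover have "ip (k t *v x) y + ip (k t *v y) x = 0" if t: "t \<in> {-\<epsilon><..<\<epsilon>}" for t
      using skewD[OF orth_complex_skew[OF c[OF t]], of x y] ip_commute[of x "k t *v y"] by simp
    ultimately have "ip (A *v x) y + ip (A *v y) x = 0"
      by (rule constant_derivative_0[OF _ k(1)])
    then show "ip (A *v x) y = - ip x (A *v y)" using ip_commute[of x "A *v y"] by simp
  qed
  have "((\<lambda>t. k t ** k t) has_vector_derivative M ** A + A ** M) (at 0)"
    using has_vector_derivative_matrix_mult[OF k(3) k(3)] k(2) by simp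
  from constant_derivative_0[OF this k(1), of "- mat 1"]
  have "M ** A + A ** M = 0" using c by (simp add: orth_complex_def)
  then have "(M ** A + A ** M) *v v = 0" by simp
  then show "A *v (M *v v) = - (M *v (A *v v))"
    by (simp add: mv_simps eq_neg_iff_add_eq_0 add.commute flip: matrix_vector_mul_assoc)
  have ker: "ip (A *v u) w = 0"
    if \<sigma>: "\<sigma> \<noteq> 0" and u: "J *v u + \<sigma> *\<^sub>R (M *v u) = 0" and w: "J *v w + \<sigma> *\<^sub>R (M *v w) = 0"
      and dim: "\<And>t. t \<in> {-\<epsilon><..<\<epsilon>} \<Longrightarrow> dim {v. J *v v + \<sigma> *\<^sub>R (k t *v v) = 0} = d" for \<sigma> d
  proof -
    let ?N = "\<lambda>t. J + \<sigma> *\<^sub>R k t"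
    have eq: "(J + \<sigma> *\<^sub>R L) *v v = J *v v + \<sigma> *\<^sub>R (L *v v)" for L v
      by (simp add: mv_simps flip: scaleR_matrix_vector_assoc)
    have "(?N has_vector_derivative 0 + \<sigma> *\<^sub>R A) (at 0)"
      by (intro has_vector_derivative_add has_vector_derivative_const
          bounded_linear.has_vector_derivative[OF bounded_linear_scaleR_right] k(3))
    moreover have "skew (?N 0)" by (intro skew_add skew_scale orth_complex_skew J c 0)
    moreover have "dim {v. J *v v + \<sigma> *\<^sub>R (M *v v) = 0} = d" using dim[OF 0] k(2) by simp
    ultimately have "ip ((0 + \<sigma> *\<^sub>R A) *v u) w = 0"
      using u w k(2) dim by (intro constant_kernel_dim_derivative[of ?N _ \<epsilon>] k(1)) (simp_all add: eq)
    then show ?thesis using \<sigma> by (simp add: ip_simps flip: scaleR_matrix_vector_assoc)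
  qed
  show "\<alpha> \<Longrightarrow> J *v u + M *v u = 0 \<Longrightarrow> J *v w + M *v w = 0 \<Longrightarrow> ip (A *v u) w = 0"
    using ker[of 1 m] k(4) by (simp add: twistor_mat_def kernel_cond_def)
  show "\<beta> \<Longrightarrow> J *v u - M *v u = 0 \<Longrightarrow> J *v w - M *v w = 0 \<Longrightarrow> ip (A *v u) w = 0"
    using ker[of "-1" m'] k(4) by (simp add: twistor_mat_def kernel_cond_def)
qed

text \<open>The kernels of \<open>J + M\<close> and \<open>J - M\<close> are orthogonal, so splitting off the part that mixes one of them
  with its complement does not spoil the conditions on the other; the two kernels can be treated one after
  the other.\<close>

lemma reduce_to_diagonal:
  assumes J: "orth_complex J" and M: "orth_complex M" and A: "skew A" and AM: "\<And>v. A *v (M *v v) = - (M *v (A *v v))"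
    and ker: "\<And>u v. J *v u + M *v u = 0 \<Longrightarrow> J *v v + M *v v = 0 \<Longrightarrow> ip (A *v u) v = 0"
  obtains B A' where "skew B" "B ** J = J ** B" "A = A' + (B ** M - M ** B)"
    "skew A'" "\<And>v. A' *v (M *v v) = - (M *v (A' *v v))"
    "\<And>v. J *v v + M *v v = 0 \<Longrightarrow> A' *v v = 0"
    "\<And>v. J *v v = M *v v \<Longrightarrow> A *v v = 0 \<Longrightarrow> A' *v v = 0"
    "\<And>u v. J *v u = M *v u \<Longrightarrow> J *v v = M *v v \<Longrightarrow> ip (A *v u) v = 0 \<Longrightarrow> ip (A' *v u) v = 0"
proof -
  obtain B P where B: "skew B" "B ** J = J ** B"
    "\<And>v. (B ** M - M ** B) *v v = A *v v - (A *v (v - P *v v) - P *v (A *v (v - P *v v)))"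
    and P: "\<And>v. J *v v + M *v v = 0 \<Longrightarrow> P *v v = v" "\<And>v. J *v (P *v v) + M *v (P *v v) = 0"
    "\<And>x y. ip (P *v x) y = ip x (P *v y)"
    by (rule off_diagonal_part[OF J M A AM]) ((rule ker; assumption), (rule that; assumption))
  define A' where "A' = A - (B ** M - M ** B)"
  have A'v: "A' *v v = A *v (v - P *v v) - P *v (A *v (v - P *v v))" for v
    by (simp only: A'_def matrix_vector_mult_diff_rdistrib[of A] B(3)) simp
  have Mv: "(B ** M - M ** B) *v v = B *v (M *v v) - M *v (B *v v)" for v
    by (simp add: mv_simps flip: matrix_vector_mul_assoc)
  have A'v2: "A' *v v = A *v v - (B *v (M *v v) - M *v (B *v v))" for v
    by (simp only: A'_def matrix_vector_mult_diff_rdistrib[of A] Mv)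
  \<comment> \<open>The kernel of \<open>J - M\<close> is orthogonal to that of \<open>J + M\<close>, the range of the symmetric projection \<open>P\<close>.\<close>
  have P0: "P *v v = 0" if v: "J *v v = M *v v" for v
  proof -
    have "ip v u = 0" if u: "J *v u + M *v u = 0" for u
    proof -
      have "ip v u = ip (J *v v) (J *v u)" by (simp add: orth_complex_isometry[OF J])
      also have "J *v u = - (M *v u)" using u by (simp add: eq_neg_iff_add_eq_0)
      also have "ip (J *v v) (- (M *v u)) = - ip v u" by (simp add: v ip_simps orth_complex_isometry[OF M])
      finally show ?thesis by simp
    qed
    then have "ip (P *v v) z = ip 0 z" for z using P(2) by (simp add: P(3) ip_simps)
    then show ?thesis by (rule ip_eqI)
  qed
  show thesis
  proof (rule that[OF B(1,2), of A'])
    show "A = A' + (B ** M - M ** B)" by (simp add: A'_def)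
    show "skew A'"
      unfolding skew_def
      by (simp add: A'v2 ip_simps skewD[OF A] skewD[OF B(1)] skewD[OF orth_complex_skew[OF M]])
    show "A' *v (M *v v) = - (M *v (A' *v v))" for v
      by (simp add: A'v2 AM mv_simps orth_complex_sq[OF M])
    show "A' *v v = 0" if "J *v v + M *v v = 0" for v using P(1)[OF that] by (simp add: A'v)
    show "A' *v v = 0" if "J *v v = M *v v" "A *v v = 0" for v
      using P0[OF that(1)] that(2) by (simp add: A'v)
    show "ip (A' *v u) v = 0" if "J *v u = M *v u" "J *v v = M *v v" "ip (A *v u) v = 0" for u v
      using P0[OF that(1)] P0[OF that(2)] that(3) by (simp add: A'v ip_simps P(3))
  qed
qed

text \<open>The right-hand side is a system of linear equations for \<open>A\<close>. Sufficiency of these conditions follows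
  by applying \<open>reduce_to_diagonal\<close> to \<open>J\<close> for the first kernel and to \<open>-J\<close> for the second one.\<close>

lemma velocities_twistor_mat:
  assumes J: "orth_complex J" and M: "M \<in> twistor_mat (kernel_cond \<alpha> \<beta> m m') G J"
  shows "mat_velocities (twistor_mat (kernel_cond \<alpha> \<beta> m m') G J) M =
    {A. skew A \<and> (\<forall>v. A *v (M *v v) = - (M *v (A *v v))) \<and>
      (\<alpha> \<longrightarrow> (\<forall>u w. J *v u + M *v u = 0 \<longrightarrow> J *v w + M *v w = 0 \<longrightarrow> ip (A *v u) w = 0)) \<and>
      (\<beta> \<longrightarrow> (\<forall>u w. J *v u - M *v u = 0 \<longrightarrow> J *v w - M *v w = 0 \<longrightarrow> ip (A *v u) w = 0))}"
    (is "?V = ?W")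
proof
  show "?V \<subseteq> ?W"
  proof
    fix A assume "A \<in> ?V"
    from velocity_conditions[OF J this] show "A \<in> ?W" by blast
  qed
  have cM: "orth_complex M" using M by (simp add: twistor_mat_def orth_complex_def)
  show "?W \<subseteq> ?V"
  proof
    fix A assume "A \<in> ?W"
    then have A: "skew A" "\<And>v. A *v (M *v v) = - (M *v (A *v v))"
      and k1: "\<And>u w. \<alpha> \<Longrightarrow> J *v u + M *v u = 0 \<Longrightarrow> J *v w + M *v w = 0 \<Longrightarrow> ip (A *v u) w = 0"
      and k2: "\<And>u w. \<beta> \<Longrightarrow> J *v u - M *v u = 0 \<Longrightarrow> J *v w - M *v w = 0 \<Longrightarrow> ip (A *v u) w = 0"
      by blast+
    \<comment> \<open>If the dimension of a kernel is not prescribed, nothing is split off for it.\<close>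
    obtain B A' where 1: "skew B" "B ** J = J ** B" "A = A' + (B ** M - M ** B)"
      "skew A'" "\<And>v. A' *v (M *v v) = - (M *v (A' *v v))"
      "\<And>v. \<alpha> \<Longrightarrow> J *v v + M *v v = 0 \<Longrightarrow> A' *v v = 0"
      "\<And>u v. \<beta> \<Longrightarrow> J *v u = M *v u \<Longrightarrow> J *v v = M *v v \<Longrightarrow> ip (A' *v u) v = 0"
    proof (cases \<alpha>)
      case True
      obtain B A' where r: "skew B" "B ** J = J ** B" "A = A' + (B ** M - M ** B)"
        "skew A'" "\<And>v. A' *v (M *v v) = - (M *v (A' *v v))"
        "\<And>v. J *v v + M *v v = 0 \<Longrightarrow> A' *v v = 0"
        "\<And>u v. J *v u = M *v u \<Longrightarrow> J *v v = M *v v \<Longrightarrow> ip (A *v u) v = 0 \<Longrightarrow> ip (A' *v u) v = 0"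
        by (rule reduce_to_diagonal[OF J cM A]) ((rule k1[OF True]; assumption), (rule that; assumption))
      show thesis by (rule that[OF r(1-6)]) (use r(7) k2 in auto)
    next
      case False
      show thesis by (rule that[of 0 A]) (use A k2 False in \<open>auto simp: skew_0 matrix_mult_0\<close>)
    qed
    have mJ: "(- J) *v v = - (J *v v)" for v by (rule matrix_vector_mult_minus)
    obtain B' A'' where 2: "skew B'" "B' ** J = J ** B'" "A' = A'' + (B' ** M - M ** B')"
      "skew A''" "\<And>v. A'' *v (M *v v) = - (M *v (A'' *v v))"
      "\<And>v. \<alpha> \<Longrightarrow> J *v v + M *v v = 0 \<Longrightarrow> A'' *v v = 0"
      "\<And>v. \<beta> \<Longrightarrow> J *v v - M *v v = 0 \<Longrightarrow> A'' *v v = 0"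
    proof (cases \<beta>)
      case True
      have k: "ip (A' *v u) v = 0" if "(- J) *v u + M *v u = 0" "(- J) *v v + M *v v = 0" for u v
        using 1(7)[OF True, of u v] that by (simp add: mJ)
      obtain B' A'' where r: "skew B'" "B' ** (- J) = (- J) ** B'" "A' = A'' + (B' ** M - M ** B')"
        "skew A''" "\<And>v. A'' *v (M *v v) = - (M *v (A'' *v v))"
        "\<And>v. (- J) *v v + M *v v = 0 \<Longrightarrow> A'' *v v = 0"
        "\<And>v. (- J) *v v = M *v v \<Longrightarrow> A' *v v = 0 \<Longrightarrow> A'' *v v = 0"
        by (rule reduce_to_diagonal[OF orth_complex_minus[OF J] cM 1(4,5)]) ((rule k; assumption), (rule that; assumption))
      show thesis
      proof (rule that[OF r(1) _ r(3-5)])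
        show "B' ** J = J ** B'" using r(2) by (simp add: matrix_ring)
        show "A'' *v v = 0" if "\<alpha>" "J *v v + M *v v = 0" for v
          using r(7)[of v] 1(6)[OF that] that(2) by (simp add: mJ neg_eq_iff_add_eq_0)
        show "A'' *v v = 0" if "J *v v - M *v v = 0" for v
          using r(6)[of v] that by (simp add: mJ)
      qed
    next
      case False
      show thesis by (rule that[of 0 A']) (use 1 False in \<open>auto simp: skew_0 matrix_mult_0\<close>)
    qed
    have "A'' \<in> ?V" by (rule velocities_diagonal[OF J M 2(4,5)]) (use 2 in auto)
    then have "A' \<in> ?V" using velocities_add_orbit[OF 2(1,2)] 2(3) by blast
    then show "A \<in> ?V" using velocities_add_orbit[OF 1(1,2)] 1(3) by blast
  qed
qed

lemma velocities_subspace: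
  assumes J: "orth_complex J" and M: "M \<in> twistor_mat (kernel_cond \<alpha> \<beta> m m') G J"
  shows "subspace (mat_velocities (twistor_mat (kernel_cond \<alpha> \<beta> m m') G J) M)"
  unfolding velocities_twistor_mat[OF J M] subspace_def
  by (auto simp: skew_0 skew_add skew_scale mv_simps ip_simps simp flip: scaleR_matrix_vector_assoc)

end

section \<open>Tangent spaces of the twistor subspaces\<close>

context twistor_bundle begin

text \<open>By \<open>gram_derivative\<close> and \<open>J_mat_derivative\<close> the metric and \<open>J\<close> are carried along by the flow of the
  connection matrix.\<close>

lemma parallel_transport:
  assumes V: "(V, \<Phi>) \<in> \<B>" and U: "(U, \<phi>) \<in> \<A>" and \<epsilon>: "\<epsilon> > 0"
    and \<gamma>: "smooth_curve \<A> {-\<epsilon><..<\<epsilon>} \<gamma>" "\<gamma> ` {-\<epsilon><..<\<epsilon>} \<subseteq> U \<inter> V"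
  obtains \<delta> P Q where "\<delta> \<le> \<epsilon>"
    "inverse_flows \<delta> (\<lambda>t. conn_mat \<Phi> (\<gamma> t) (velocity \<A> \<gamma> t)) P Q"
    "\<And>t. t \<in> {-\<delta><..<\<delta>} \<Longrightarrow> transpose (P t) ** gram \<Phi> (\<gamma> t) ** P t = gram \<Phi> (\<gamma> 0)"
    "\<And>t. t \<in> {-\<delta><..<\<delta>} \<Longrightarrow> Q t ** J_mat \<Phi> (\<gamma> t) ** P t = J_mat \<Phi> (\<gamma> 0)"
proof -
  let ?C = "\<lambda>t. conn_mat \<Phi> (\<gamma> t) (velocity \<A> \<gamma> t)"
  obtain \<delta> P Q where \<delta>: "\<delta> \<le> \<epsilon>" and F: "inverse_flows \<delta> ?C P Q"
    by (rule inverse_flows_exist[OF \<epsilon> conn_mat_smooth_along_curve[OF V U _ \<gamma>]]) simp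
  have \<gamma>V: "\<gamma> u \<in> V" "u \<in> {-\<epsilon><..<\<epsilon>}" if "u \<in> {-\<delta><..<\<delta>}" for u
  proof -
    show "u \<in> {-\<epsilon><..<\<epsilon>}" using that \<delta> by auto
    then show "\<gamma> u \<in> V" using \<gamma>(2) by blast
  qed
  show thesis
    by (rule that[OF \<delta> F]) (rule flow_preserves_form[OF F] flow_intertwines[OF F], assumption,
      rule gram_derivative[OF V \<gamma>V(1) \<gamma>(1) \<gamma>V(2)] J_mat_derivative[OF V \<gamma>V(1) \<gamma>(1) \<gamma>V(2)], assumption+)+
qed

lemma twistor_sub_End: "(p, K) \<in> twistor_sub R \<Longrightarrow> K \<in> End_fibre (E p)"
  by (simp add: twistor_sub_def twistor_space_def twistor_fibre_def)

lemma twistor_sub_mat: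
  assumes "(V, \<Phi>) \<in> \<B>" "p \<in> V" "(p, K) \<in> twistor_sub R"
  shows "End_mat \<Phi> p K \<in> twistor_mat R (gram \<Phi> p) (J_mat \<Phi> p)"
  using twistor_sub_coords[OF assms(1,2) twistor_sub_End[OF assms(3)]] assms(3) by blast

text \<open>A curve \<open>k\<close> of twistor matrices in the fibre at \<open>p\<close> is moved along a curve \<open>\<gamma>\<close> through \<open>p\<close> with velocity
  \<open>v\<close> by parallel transport. The result stays in the twistor subspace, and its second coordinate \<open>P k Q\<close> has
  derivative \<open>A + [k 0, \<Gamma>(v)]\<close> at \<open>0\<close>. For constant \<open>k\<close> it is parallel.\<close>

lemma lift_curve:
  fixes v :: 'a
  assumes V: "(V, \<Phi>) \<in> \<B>" "p \<in> V" and U: "(U, \<phi>) \<in> \<A>" "p \<in> U"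
    and \<epsilon>: "\<epsilon> > 0" and k: "smooth_on {-\<epsilon><..<\<epsilon>} k" "(k has_vector_derivative A) (at 0)"
    "\<And>t. t \<in> {-\<epsilon><..<\<epsilon>} \<Longrightarrow> k t \<in> twistor_mat R (gram \<Phi> p) (J_mat \<Phi> p)"
  defines "\<Gamma> \<equiv> conn_mat \<Phi> p (chart_vec U \<phi> p v)"
  obtains d \<gamma> L where "d > 0" "smooth_curve \<A> {-d<..<d} \<gamma>" "\<gamma> 0 = p" "L 0 = End_of \<Phi> p (k 0)"
    "smooth_curve (End_atlas \<A> E \<B>) {-d<..<d} (\<lambda>t. (\<gamma> t, L t))"
    "\<And>t. t \<in> {-d<..<d} \<Longrightarrow> (\<gamma> t, L t) \<in> twistor_sub R"
    "velocity (End_atlas \<A> E \<B>) (\<lambda>t. (\<gamma> t, L t)) 0 =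
       End_vec U \<phi> V \<Phi> (p, End_of \<Phi> p (k 0)) (v, A + (k 0 ** \<Gamma> - \<Gamma> ** k 0))"
    "(\<And>t. k t = k 0) \<Longrightarrow> parallel_End_along \<A> E \<B> D {-d<..<d} \<gamma> L"
proof -
  obtain \<gamma> \<epsilon>\<^sub>1 where \<gamma>: "\<epsilon>\<^sub>1 > 0" "smooth_curve \<A> {-\<epsilon>\<^sub>1<..<\<epsilon>\<^sub>1} \<gamma>" "\<gamma> 0 = p" "\<gamma> ` {-\<epsilon>\<^sub>1<..<\<epsilon>\<^sub>1} \<subseteq> U"
    "((\<phi> \<circ> \<gamma>) has_vector_derivative v) (at 0)"
    using line_in_chart[OF U] by metis
  obtain \<epsilon>\<^sub>2 where \<epsilon>2: "\<epsilon>\<^sub>2 > 0" "{0-\<epsilon>\<^sub>2<..<0+\<epsilon>\<^sub>2} \<subseteq> {-\<epsilon>\<^sub>1<..<\<epsilon>\<^sub>1}" "\<gamma> ` {0-\<epsilon>\<^sub>2<..<0+\<epsilon>\<^sub>2} \<subseteq> V"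
    by (rule curve_stays_in_open[OF \<gamma>(2) _ triv_open[OF V(1)], of 0]) (use \<gamma> V in auto)
  let ?I2 = "{-\<epsilon>\<^sub>2<..<\<epsilon>\<^sub>2}"
  have \<gamma>2: "smooth_curve \<A> ?I2 \<gamma>"
    by (rule smooth_curve_subset[OF \<gamma>(2)]) (use \<epsilon>2(2) in auto)
  have \<gamma>UV: "\<gamma> ` ?I2 \<subseteq> U \<inter> V" using \<epsilon>2 \<gamma>(4) by auto
  let ?C = "\<lambda>t. conn_mat \<Phi> (\<gamma> t) (velocity \<A> \<gamma> t)"
  obtain \<delta> P Q where F0: "\<delta> \<le> \<epsilon>\<^sub>2" "inverse_flows \<delta> ?C P Q"
    "\<And>t. t \<in> {-\<delta><..<\<delta>} \<Longrightarrow> transpose (P t) ** gram \<Phi> (\<gamma> t) ** P t = gram \<Phi> (\<gamma> 0)"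
    "\<And>t. t \<in> {-\<delta><..<\<delta>} \<Longrightarrow> Q t ** J_mat \<Phi> (\<gamma> t) ** P t = J_mat \<Phi> (\<gamma> 0)"
    by (rule parallel_transport[OF V(1) U(1) \<epsilon>2(1) \<gamma>2 \<gamma>UV]) (rule that; assumption)
  note F = inverse_flowsD[OF F0(2)]
  define d where "d = min \<epsilon> \<delta>"
  let ?I = "{-d<..<d}"
  have d: "d > 0" "?I \<subseteq> {-\<delta><..<\<delta>}" "?I \<subseteq> {-\<epsilon><..<\<epsilon>}" "?I \<subseteq> ?I2" "0 \<in> ?I"
    using F(1) F0(1) \<epsilon> by (auto simp: d_def)
  define M where "M t = P t ** k t ** Q t" for t
  define L where "L t = End_of \<Phi> (\<gamma> t) (M t)" for t
  have I: "\<gamma> t \<in> U" "\<gamma> t \<in> V" if "t \<in> ?I" for t using that d(4) \<gamma>UV by blast+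
  have LM: "End_mat \<Phi> (\<gamma> t) (L t) = M t" if "t \<in> ?I" for t
    unfolding L_def by (rule End_mat_of[OF V(1) I(2)[OF that]])
  have LE: "L t \<in> End_fibre (E (\<gamma> t))" if "t \<in> ?I" for t
    unfolding L_def by (rule End_of_in[OF V(1) I(2)[OF that]])
  have M0: "M 0 = k 0" by (simp add: M_def F)
  have \<gamma>d: "smooth_curve \<A> ?I \<gamma>" by (rule smooth_curve_subset[OF \<gamma>2 _ d(4)]) simp
  have Ms: "smooth_on ?I M"
    unfolding M_def
    by (intro smooth_on_matrix_mult smooth_on_subset[OF F(4) d(2)] smooth_on_subset[OF F(5) d(2)]
        smooth_on_subset[OF k(1) d(3)]) simp_all
  have c: "smooth_curve (End_atlas \<A> E \<B>) ?I (\<lambda>t. (\<gamma> t, L t))"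
  proof (rule End_curveI[OF _ U(1) V(1) _ LE])
    show "\<gamma> ` ?I \<subseteq> U \<inter> V" using I by blast
    show "smooth_on ?I (\<phi> \<circ> \<gamma>)" by (rule smooth_curve_chartD[OF \<gamma>d U(1)]) (use I in blast)
    show "smooth_on ?I (\<lambda>t. End_mat \<Phi> (\<gamma> t) (L t))" by (rule smooth_on_eqI[OF Ms]) (simp_all add: LM)
  qed simp_all
  have LM': "((\<lambda>u. End_mat \<Phi> (\<gamma> u) (L u)) has_vector_derivative B) (at t)"
    if "t \<in> ?I" "(M has_vector_derivative B) (at t)" for t B
    by (rule has_vector_derivative_transform_within_open[OF that(2) _ that(1)]) (simp_all add: LM)
  have dM: "(M has_vector_derivative P t ** B ** Q t + (M t ** ?C t - ?C t ** M t)) (at t)"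
    if t: "t \<in> ?I" and B: "(k has_vector_derivative B) (at t)" for t B
  proof -
    have t': "t \<in> {-\<delta><..<\<delta>}" using t d(2) by blast
    show ?thesis
      unfolding M_def
      using has_vector_derivative_matrix_mult[OF has_vector_derivative_matrix_mult[OF F(6)[OF t'] B] F(7)[OF t']]
      by (simp add: matrix_ring matrix_mul_assoc algebra_simps)
  qed
  have vel0: "velocity \<A> \<gamma> 0 = chart_vec U \<phi> p v"
    using velocity_chart[OF \<gamma>d d(5) U(1)] \<gamma>(3) U(2) vector_derivative_at[OF \<gamma>(5)] by simp
  show thesis
  proof (rule that[OF d(1) \<gamma>d \<gamma>(3) _ c])
    show L0: "L 0 = End_of \<Phi> p (k 0)" by (simp add: L_def M0 \<gamma>(3))
    show "(\<gamma> t, L t) \<in> twistor_sub R" if t: "t \<in> ?I" for t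
    proof -
      have t': "t \<in> {-\<delta><..<\<delta>}" "t \<in> {-\<epsilon><..<\<epsilon>}" using t d(2,3) by blast+
      have "M t \<in> twistor_mat R (gram \<Phi> (\<gamma> t)) (J_mat \<Phi> (\<gamma> t))"
        unfolding M_def
        using F0(3,4)[OF t'(1)] k(3)[OF t'(2)] \<gamma>(3)
        by (intro twistor_mat_conj_eq(2)[OF F(9)[OF t'(1)] F(8)[OF t'(1)]]) simp_all
      then show ?thesis
        using twistor_sub_coords[OF V(1) I(2)[OF t] LE[OF t]] LM[OF t] by simp
    qed
    have "(M has_vector_derivative A + (k 0 ** \<Gamma> - \<Gamma> ** k 0)) (at 0)"
      using dM[OF d(5) k(2)] by (simp add: F(2,3) M0 \<gamma>(3) vel0 \<Gamma>_def)
    from End_velocity[OF c d(5) U(1) _ V(1) _ \<gamma>(5) LM'[OF d(5) this]]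
    show "velocity (End_atlas \<A> E \<B>) (\<lambda>t. (\<gamma> t, L t)) 0 =
       End_vec U \<phi> V \<Phi> (p, End_of \<Phi> p (k 0)) (v, A + (k 0 ** \<Gamma> - \<Gamma> ** k 0))"
      using U(2) V(2) by (simp add: \<gamma>(3) L0)
    show "parallel_End_along \<A> E \<B> D ?I \<gamma> L" if const: "\<And>t. k t = k 0"
    proof (rule parallel_EndI[OF V(1) _ c])
      show "\<gamma> ` ?I \<subseteq> V" using I by blast
      fix t assume t: "t \<in> ?I"
      have "k = (\<lambda>_. k 0)" using const by auto
      then have "(k has_vector_derivative 0) (at t)"
        by (metis has_vector_derivative_const)
      from dM[OF t this] have "(M has_vector_derivative M t ** ?C t - ?C t ** M t) (at t)"
        by (simp add: matrix_mult_0)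
      from LM'[OF t this] show "((\<lambda>u. End_mat \<Phi> (\<gamma> u) (L u)) has_vector_derivative
          End_mat \<Phi> (\<gamma> t) (L t) ** ?C t - ?C t ** End_mat \<Phi> (\<gamma> t) (L t)) (at t)"
        by (simp add: LM[OF t])
    qed simp
  qed
qed

text \<open>One inclusion is \<open>lift_curve\<close>. For the other, parallel transport along the base curve moves a curve in
  the subspace back into the fibre at \<open>p\<close>.\<close>

lemma tangent_space_twistor_sub:
  assumes V: "(V, \<Phi>) \<in> \<B>" "p \<in> V" and U: "(U, \<phi>) \<in> \<A>" "p \<in> U" and K: "(p, K) \<in> twistor_sub R"
  shows "tangent_space (End_atlas \<A> E \<B>) (twistor_sub R) (p, K) =
    {End_vec U \<phi> V \<Phi> (p, K) (v, A + (End_mat \<Phi> p K ** conn_mat \<Phi> p (chart_vec U \<phi> p v) -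
        conn_mat \<Phi> p (chart_vec U \<phi> p v) ** End_mat \<Phi> p K)) | v A.
      A \<in> mat_velocities (twistor_mat R (gram \<Phi> p) (J_mat \<Phi> p)) (End_mat \<Phi> p K)}"
    (is "?T = ?R")
proof
  note KE = twistor_sub_End[OF K]
  show "?R \<subseteq> ?T"
  proof clarify
    fix v A assume "A \<in> mat_velocities (twistor_mat R (gram \<Phi> p) (J_mat \<Phi> p)) (End_mat \<Phi> p K)"
    then obtain \<epsilon> k where k: "\<epsilon> > 0" "smooth_on {-\<epsilon><..<\<epsilon>} k" "(k has_vector_derivative A) (at 0)"
      "\<And>t. t \<in> {-\<epsilon><..<\<epsilon>} \<Longrightarrow> k t \<in> twistor_mat R (gram \<Phi> p) (J_mat \<Phi> p)" "k 0 = End_mat \<Phi> p K"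
      unfolding mat_velocities_def by blast
    have k0: "End_of \<Phi> p (k 0) = K" by (simp add: k(5) End_of_mat[OF V KE])
    obtain d \<gamma> L where c: "d > 0" "\<gamma> 0 = p" "L 0 = End_of \<Phi> p (k 0)"
      "smooth_curve (End_atlas \<A> E \<B>) {-d<..<d} (\<lambda>t. (\<gamma> t, L t))"
      "\<And>t. t \<in> {-d<..<d} \<Longrightarrow> (\<gamma> t, L t) \<in> twistor_sub R"
      "velocity (End_atlas \<A> E \<B>) (\<lambda>t. (\<gamma> t, L t)) 0 =
         End_vec U \<phi> V \<Phi> (p, End_of \<Phi> p (k 0)) (v, A + (k 0 ** conn_mat \<Phi> p (chart_vec U \<phi> p v) -
           conn_mat \<Phi> p (chart_vec U \<phi> p v) ** k 0))"
      by (rule lift_curve[OF V U k(1-3), where v = v]) ((rule k(4); assumption), (rule that; assumption))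
    show "End_vec U \<phi> V \<Phi> (p, K) (v, A + (End_mat \<Phi> p K ** conn_mat \<Phi> p (chart_vec U \<phi> p v) -
        conn_mat \<Phi> p (chart_vec U \<phi> p v) ** End_mat \<Phi> p K)) \<in> ?T"
      unfolding tangent_space_def
      using c k0 k(5) by (intro CollectI exI[of _ "\<lambda>t. (\<gamma> t, L t)"] exI[of _ d]) auto
  qed
  show "?T \<subseteq> ?R"
  proof
    fix X assume "X \<in> ?T"
    then obtain c \<epsilon> where X: "X = velocity (End_atlas \<A> E \<B>) c 0" and \<epsilon>: "\<epsilon> > 0"
      and c0: "smooth_curve (End_atlas \<A> E \<B>) {-\<epsilon><..<\<epsilon>} c" "c 0 = (p, K)" "c ` {-\<epsilon><..<\<epsilon>} \<subseteq> twistor_sub R"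
      unfolding tangent_space_def by blast
    define \<gamma> L where "\<gamma> = fst \<circ> c" and "L = snd \<circ> c"
    have c_eq: "c = (\<lambda>t. (\<gamma> t, L t))" by (simp add: \<gamma>_def L_def)
    have 00: "\<gamma> 0 = p" "L 0 = K" using c0(2) by (simp_all add: \<gamma>_def L_def)
    note c = c0(1)[unfolded c_eq]
    obtain \<epsilon>\<^sub>2 where \<epsilon>2: "\<epsilon>\<^sub>2 > 0" "{0-\<epsilon>\<^sub>2<..<0+\<epsilon>\<^sub>2} \<subseteq> {-\<epsilon><..<\<epsilon>}" "\<gamma> ` {0-\<epsilon>\<^sub>2<..<0+\<epsilon>\<^sub>2} \<subseteq> U \<inter> V"
      "smooth_on {0-\<epsilon>\<^sub>2<..<0+\<epsilon>\<^sub>2} (\<phi> \<circ> \<gamma>)" "smooth_on {0-\<epsilon>\<^sub>2<..<0+\<epsilon>\<^sub>2} (\<lambda>u. End_mat \<Phi> (\<gamma> u) (L u))"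
      by (rule End_curve_coords[OF c _ U(1) _ V(1), of 0]) (use \<epsilon> 00 U V in auto)
    let ?I2 = "{-\<epsilon>\<^sub>2<..<\<epsilon>\<^sub>2}"
    have I2: "{0-\<epsilon>\<^sub>2<..<0+\<epsilon>\<^sub>2} = ?I2" by simp
    note \<epsilon>2 = \<epsilon>2[unfolded I2]
    have \<gamma>: "smooth_curve \<A> ?I2 \<gamma>"
      by (rule smooth_curve_subset[OF End_curve_base(1)[OF c] _ \<epsilon>2(2)]) simp
    let ?C = "\<lambda>t. conn_mat \<Phi> (\<gamma> t) (velocity \<A> \<gamma> t)"
    obtain \<delta> P Q where F0: "\<delta> \<le> \<epsilon>\<^sub>2" "inverse_flows \<delta> ?C P Q"
      "\<And>t. t \<in> {-\<delta><..<\<delta>} \<Longrightarrow> transpose (P t) ** gram \<Phi> (\<gamma> t) ** P t = gram \<Phi> (\<gamma> 0)"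
      "\<And>t. t \<in> {-\<delta><..<\<delta>} \<Longrightarrow> Q t ** J_mat \<Phi> (\<gamma> t) ** P t = J_mat \<Phi> (\<gamma> 0)"
      by (rule parallel_transport[OF V(1) U(1) \<epsilon>2(1) \<gamma> \<epsilon>2(3)]) (rule that; assumption)
    note F = inverse_flowsD[OF F0(2)]
    let ?I = "{-\<delta><..<\<delta>}"
    have I: "?I \<subseteq> ?I2" "0 \<in> ?I" "0 \<in> ?I2" using F(1) F0(1) by auto
    define M where "M t = End_mat \<Phi> (\<gamma> t) (L t)" for t
    define k where "k t = Q t ** M t ** P t" for t
    define v where "v = vector_derivative (\<phi> \<circ> \<gamma>) (at 0)"
    define B where "B = vector_derivative M (at 0)"
    have dM: "(M has_vector_derivative B) (at 0)"
      using smooth_on_vector_derivative[OF \<epsilon>2(5) I(3)] by (simp add: B_def M_def[abs_def])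
    have dv: "((\<phi> \<circ> \<gamma>) has_vector_derivative v) (at 0)"
      using smooth_on_vector_derivative[OF \<epsilon>2(4) I(3)] by (simp add: v_def)
    have M0: "M 0 = End_mat \<Phi> p K" by (simp add: M_def 00)
    have vel0: "velocity \<A> \<gamma> 0 = chart_vec U \<phi> p v"
      using velocity_chart[OF \<gamma> I(3) U(1)] 00 U(2) by (simp add: v_def)
    let ?\<Gamma> = "conn_mat \<Phi> p (chart_vec U \<phi> p v)"
    define A where "A = B - (M 0 ** ?\<Gamma> - ?\<Gamma> ** M 0)"
    have "(k has_vector_derivative A) (at 0)"
      unfolding k_def A_def
      using has_vector_derivative_matrix_mult[OF has_vector_derivative_matrix_mult[OF F(7)[OF I(2)] dM] F(6)[OF I(2)]]
      by (simp add: F(2,3) vel0 00 matrix_ring algebra_simps)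
    moreover have "smooth_on ?I k"
      unfolding k_def M_def
      by (intro smooth_on_matrix_mult F(4,5) smooth_on_subset[OF \<epsilon>2(5) I(1)]) simp_all
    moreover have "k t \<in> twistor_mat R (gram \<Phi> p) (J_mat \<Phi> p)" if t: "t \<in> ?I" for t
    proof -
      have t2: "t \<in> {-\<epsilon><..<\<epsilon>}" "\<gamma> t \<in> V" using t I(1) \<epsilon>2(2,3) by blast+
      have "(\<gamma> t, L t) \<in> twistor_sub R" using c0(3) t2(1) c_eq by (metis image_subset_iff)
      then have "M t \<in> twistor_mat R (gram \<Phi> (\<gamma> t)) (J_mat \<Phi> (\<gamma> t))"
        using twistor_sub_mat[OF V(1) t2(2)] by (simp add: M_def)
      then show ?thesis
        unfolding k_def
        using twistor_mat_conj_eq(1)[OF F(9)[OF t] F(8)[OF t] F0(3)[OF t] F0(4)[OF t]] 00 by simp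
    qed
    ultimately have A: "A \<in> mat_velocities (twistor_mat R (gram \<Phi> p) (J_mat \<Phi> p)) (End_mat \<Phi> p K)"
      unfolding mat_velocities_def using F(1) by (intro CollectI exI[of _ \<delta>] exI[of _ k] conjI) (auto simp: k_def F(2,3) M0)
    have "X = End_vec U \<phi> V \<Phi> (p, K) (v, B)"
    proof -
      have "0 \<in> {-\<epsilon><..<\<epsilon>}" using \<epsilon> by simp
      from End_velocity[OF c this U(1) _ V(1) _ dv dM[unfolded M_def[abs_def]]] show ?thesis
        using U(2) V(2) by (simp add: X c_eq 00)
    qed
    also have "B = A + (End_mat \<Phi> p K ** ?\<Gamma> - ?\<Gamma> ** End_mat \<Phi> p K)" by (simp add: A_def M0)
    finally show "X \<in> ?R" using A by blast
  qed
qed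

lemma vertical_space_twistor_sub:
  assumes V: "(V, \<Phi>) \<in> \<B>" "p \<in> V" and U: "(U, \<phi>) \<in> \<A>" "p \<in> U" and K: "(p, K) \<in> twistor_sub R"
  shows "vertical_space \<A> E \<B> (twistor_sub R) (p, K) =
    {End_vec U \<phi> V \<Phi> (p, K) (0, A) | A.
      A \<in> mat_velocities (twistor_mat R (gram \<Phi> p) (J_mat \<Phi> p)) (End_mat \<Phi> p K)}"
    (is "?T = ?R")
proof
  note KE = twistor_sub_End[OF K]
  show "?R \<subseteq> ?T"
  proof clarify
    fix A assume "A \<in> mat_velocities (twistor_mat R (gram \<Phi> p) (J_mat \<Phi> p)) (End_mat \<Phi> p K)"
    then obtain \<epsilon> k where k: "\<epsilon> > 0" "smooth_on {-\<epsilon><..<\<epsilon>} k" "(k has_vector_derivative A) (at 0)"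
      "\<And>t. t \<in> {-\<epsilon><..<\<epsilon>} \<Longrightarrow> k t \<in> twistor_mat R (gram \<Phi> p) (J_mat \<Phi> p)" "k 0 = End_mat \<Phi> p K"
      unfolding mat_velocities_def by blast
    let ?I = "{-\<epsilon><..<\<epsilon>}"
    let ?L = "\<lambda>t. End_of \<Phi> p (k t)"
    have LM: "End_mat \<Phi> p (?L t) = k t" for t by (rule End_mat_of[OF V])
    have 0: "0 \<in> ?I" using k(1) by simp
    have c: "smooth_curve (End_atlas \<A> E \<B>) ?I (\<lambda>t. (p, ?L t))"
      by (rule End_curveI[OF _ U(1) V(1), where \<gamma> = "\<lambda>_. p"])
        (use U V k in \<open>auto simp: LM End_of_in[OF V] o_def intro: smooth_on_const\<close>)
    have "((\<phi> \<circ> (\<lambda>_. p)) has_vector_derivative 0) (at 0)" by (simp add: o_def)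
    from End_velocity[OF c 0 U V this, of A] k(3)
    have "velocity (End_atlas \<A> E \<B>) (\<lambda>t. (p, ?L t)) 0 = End_vec U \<phi> V \<Phi> (p, K) (0, A)"
      by (simp add: LM k(5) End_of_mat[OF V KE])
    moreover have "(p, ?L t) \<in> twistor_sub R" if "t \<in> ?I" for t
      using twistor_sub_coords[OF V End_of_in[OF V]] k(4)[OF that] by (simp add: LM)
    ultimately show "End_vec U \<phi> V \<Phi> (p, K) (0, A) \<in> ?T"
      unfolding vertical_space_def tangent_space_def
      using c k(1) by (intro CollectI exI[of _ "\<lambda>t. (p, ?L t)"] exI[of _ \<epsilon>])
        (auto simp: k(5) End_of_mat[OF V KE])
  qed
  show "?T \<subseteq> ?R"
  proof
    fix X assume "X \<in> ?T"
    then obtain c \<epsilon> where X: "X = velocity (End_atlas \<A> E \<B>) c 0" and \<epsilon>: "\<epsilon> > 0"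
      and c0: "smooth_curve (End_atlas \<A> E \<B>) {-\<epsilon><..<\<epsilon>} c" "c 0 = (p, K)"
        "c ` {-\<epsilon><..<\<epsilon>} \<subseteq> {K' \<in> twistor_sub R. fst K' = p}"
      unfolding vertical_space_def tangent_space_def by auto
    define \<gamma> L where "\<gamma> = fst \<circ> c" and "L = snd \<circ> c"
    have c_eq: "c = (\<lambda>t. (\<gamma> t, L t))" by (simp add: \<gamma>_def L_def)
    have 00: "\<gamma> 0 = p" "L 0 = K" using c0(2) by (simp_all add: \<gamma>_def L_def)
    have \<gamma>p: "\<gamma> t = p" if "t \<in> {-\<epsilon><..<\<epsilon>}" for t
    proof -
      have "c t \<in> {K' \<in> twistor_sub R. fst K' = p}" using c0(3) that by blast
      then show ?thesis by (simp add: \<gamma>_def)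
    qed
    note c = c0(1)[unfolded c_eq]
    obtain \<epsilon>\<^sub>2 where \<epsilon>2: "\<epsilon>\<^sub>2 > 0" "{0-\<epsilon>\<^sub>2<..<0+\<epsilon>\<^sub>2} \<subseteq> {-\<epsilon><..<\<epsilon>}"
      "smooth_on {0-\<epsilon>\<^sub>2<..<0+\<epsilon>\<^sub>2} (\<lambda>u. End_mat \<Phi> (\<gamma> u) (L u))"
      by (rule End_curve_coords[OF c _ U(1) _ V(1), of 0]) (use \<epsilon> 00 U V in auto)
    let ?I2 = "{-\<epsilon>\<^sub>2<..<\<epsilon>\<^sub>2}"
    have I2: "{0-\<epsilon>\<^sub>2<..<0+\<epsilon>\<^sub>2} = ?I2" by simp
    note \<epsilon>2 = \<epsilon>2[unfolded I2]
    have 0: "0 \<in> ?I2" "0 \<in> {-\<epsilon><..<\<epsilon>}" using \<epsilon> \<epsilon>2 by auto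
    define M where "M t = End_mat \<Phi> (\<gamma> t) (L t)" for t
    define A where "A = vector_derivative M (at 0)"
    have dM: "(M has_vector_derivative A) (at 0)"
      using smooth_on_vector_derivative[OF \<epsilon>2(3) 0(1)] by (simp add: A_def M_def[abs_def])
    have dv: "((\<phi> \<circ> \<gamma>) has_vector_derivative 0) (at 0)"
      by (rule has_vector_derivative_transform_within_open[OF has_vector_derivative_const[of "\<phi> p"] _ 0(2)])
        (simp_all add: \<gamma>p)
    have "M t \<in> twistor_mat R (gram \<Phi> p) (J_mat \<Phi> p)" if t: "t \<in> ?I2" for t
    proof -
      have t2: "t \<in> {-\<epsilon><..<\<epsilon>}" using t \<epsilon>2(2) by blast
      then have "c t \<in> twistor_sub R" using c0(3) by blast
      then have "(p, L t) \<in> twistor_sub R" using \<gamma>p[OF t2] by (simp add: c_eq)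
      then show ?thesis
        using twistor_sub_mat[OF V] \<gamma>p[OF t2] by (simp add: M_def)
    qed
    then have A: "A \<in> mat_velocities (twistor_mat R (gram \<Phi> p) (J_mat \<Phi> p)) (End_mat \<Phi> p K)"
      unfolding mat_velocities_def using \<epsilon>2(1,3) dM
      by (intro CollectI exI[of _ \<epsilon>\<^sub>2] exI[of _ M] conjI) (auto simp: M_def[abs_def] 00)
    have "X = End_vec U \<phi> V \<Phi> (p, K) (0, A)"
      using End_velocity[OF c 0(2) U(1) _ V(1) _ dv dM[unfolded M_def[abs_def]]] U(2) V(2)
      by (simp add: X c_eq 00)
    then show "X \<in> ?R" using A by blast
  qed
qed

text \<open>Every direction \<open>v\<close> occurs by \<open>lift_curve\<close> for constant \<open>k\<close>, and the parallel equation determines the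
  second coordinate from \<open>v\<close>.\<close>

lemma horizontal_space_twistor_sub:
  assumes V: "(V, \<Phi>) \<in> \<B>" "p \<in> V" and U: "(U, \<phi>) \<in> \<A>" "p \<in> U" and K: "(p, K) \<in> twistor_sub R"
  shows "horizontal_space \<A> E \<B> D (p, K) =
    {End_vec U \<phi> V \<Phi> (p, K) (v, End_mat \<Phi> p K ** conn_mat \<Phi> p (chart_vec U \<phi> p v) -
        conn_mat \<Phi> p (chart_vec U \<phi> p v) ** End_mat \<Phi> p K) | v. True}"
    (is "?T = ?R")
proof
  note KE = twistor_sub_End[OF K]
  show "?R \<subseteq> ?T"
  proof clarify
    fix v
    let ?M = "End_mat \<Phi> p K" and ?\<Gamma> = "conn_mat \<Phi> p (chart_vec U \<phi> p v)"
    have M: "?M \<in> twistor_mat R (gram \<Phi> p) (J_mat \<Phi> p)"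
      using twistor_sub_coords[OF V KE] K by blast
    obtain d \<gamma> L where c: "d > 0" "smooth_curve \<A> {-d<..<d} \<gamma>" "\<gamma> 0 = p" "L 0 = End_of \<Phi> p ?M"
      "velocity (End_atlas \<A> E \<B>) (\<lambda>t. (\<gamma> t, L t)) 0 =
         End_vec U \<phi> V \<Phi> (p, End_of \<Phi> p ?M) (v, 0 + (?M ** ?\<Gamma> - ?\<Gamma> ** ?M))"
      "parallel_End_along \<A> E \<B> D {-d<..<d} \<gamma> L"
      by (rule lift_curve[OF V U zero_less_one smooth_on_const[of _ ?M] has_vector_derivative_const M, where v = v])
        (rule that; simp)
    then show "End_vec U \<phi> V \<Phi> (p, K) (v, ?M ** ?\<Gamma> - ?\<Gamma> ** ?M) \<in> ?T"
      unfolding horizontal_space_def End_of_mat[OF V KE]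
      by (intro CollectI exI[of _ \<gamma>] exI[of _ L] exI[of _ d]) simp
  qed
  show "?T \<subseteq> ?R"
  proof
    fix X assume "X \<in> ?T"
    then obtain \<gamma> L \<epsilon> where X: "X = velocity (End_atlas \<A> E \<B>) (\<lambda>t. (\<gamma> t, L t)) 0" and \<epsilon>: "\<epsilon> > 0"
      and \<gamma>: "smooth_curve \<A> {-\<epsilon><..<\<epsilon>} \<gamma>" "\<gamma> 0 = p" "L 0 = K"
      and par: "parallel_End_along \<A> E \<B> D {-\<epsilon><..<\<epsilon>} \<gamma> L"
      unfolding horizontal_space_def by blast
    have 0: "0 \<in> {-\<epsilon><..<\<epsilon>}" using \<epsilon> by simp
    have c: "smooth_curve (End_atlas \<A> E \<B>) {-\<epsilon><..<\<epsilon>} (\<lambda>t. (\<gamma> t, L t))"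
      using par by (simp add: parallel_End_along_def)
    have g0: "\<gamma> 0 \<in> U" "\<gamma> 0 \<in> V" using \<gamma>(2) U V by auto
    define v where "v = vector_derivative (\<phi> \<circ> \<gamma>) (at 0)"
    obtain \<delta> where "\<delta> > 0" "smooth_on {0-\<delta><..<0+\<delta>} (\<phi> \<circ> \<gamma>)"
      using smooth_curve_in_chart[OF \<gamma>(1) 0 U(1) g0(1)] by metis
    then have dv: "((\<phi> \<circ> \<gamma>) has_vector_derivative v) (at 0)"
      unfolding v_def by (intro smooth_on_vector_derivative) auto
    have "velocity \<A> \<gamma> 0 = chart_vec U \<phi> p v"
      using velocity_chart[OF \<gamma>(1) 0 U(1) g0(1)] \<gamma>(2) by (simp add: v_def)
    moreover have "X = End_vec U \<phi> V \<Phi> (\<gamma> 0, L 0) (v, End_mat \<Phi> (\<gamma> 0) (L 0) ** conn_mat \<Phi> (\<gamma> 0) (velocity \<A> \<gamma> 0) -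
        conn_mat \<Phi> (\<gamma> 0) (velocity \<A> \<gamma> 0) ** End_mat \<Phi> (\<gamma> 0) (L 0))"
      unfolding X
      by (rule End_velocity[OF c 0 U(1) g0(1) V(1) g0(2) dv parallel_EndD[OF V(1) g0(2) _ 0 par]]) simp
    ultimately show "X \<in> ?R" using \<gamma> by auto
  qed
qed

lemma gram_fibre_metric:
  assumes V: "(V, \<Phi>) \<in> \<B>" "p \<in> V"
  shows "fibre_metric (gram \<Phi> p)"
proof
  show "x \<bullet> (gram \<Phi> p *v y) = y \<bullet> (gram \<Phi> p *v x)" for x y
    by (simp add: g_sym untriv_in[OF V] flip: g_gram[OF V])
  fix x :: "real^'k" assume "x \<noteq> 0"
  then have "untriv \<Phi> p x \<noteq> 0"
    using inj_untriv[OF V] linear_0[OF linear_untriv[OF V]] by (metis injD)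
  then show "x \<bullet> (gram \<Phi> p *v x) > 0"
    using g_pos[OF untriv_in[OF V]] by (simp flip: g_gram[OF V])
qed

text \<open>In coordinates the three spaces are the sets of all \<open>(v, A + h v)\<close>, \<open>(0, A)\<close> and \<open>(v, h v)\<close> with \<open>A\<close> in
  the linear space \<open>W\<close>, for the linear map \<open>h v = [K, \<Gamma>(v)]\<close>.\<close>

lemma twistor_sub_direct_sum:
  assumes K: "(p, K) \<in> twistor_sub (kernel_cond \<alpha> \<beta> m m')"
  shows "is_direct_sum (tangent_space (End_atlas \<A> E \<B>) (twistor_sub (kernel_cond \<alpha> \<beta> m m')) (p, K))
     (vertical_space \<A> E \<B> (twistor_sub (kernel_cond \<alpha> \<beta> m m')) (p, K)) (horizontal_space \<A> E \<B> D (p, K))"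
proof -
  obtain U \<phi> where U: "(U, \<phi>) \<in> \<A>" "p \<in> U" using charts_cover by blast
  obtain V \<Phi> where V: "(V, \<Phi>) \<in> \<B>" "p \<in> V" using trivs_cover by blast
  interpret fm: fibre_metric "gram \<Phi> p" by (rule gram_fibre_metric[OF V])
  note KE = twistor_sub_End[OF K]
  define W where "W = mat_velocities (twistor_mat (kernel_cond \<alpha> \<beta> m m') (gram \<Phi> p) (J_mat \<Phi> p)) (End_mat \<Phi> p K)"
  define h where "h v = End_mat \<Phi> p K ** conn_mat \<Phi> p (chart_vec U \<phi> p v) -
        conn_mat \<Phi> p (chart_vec U \<phi> p v) ** End_mat \<Phi> p K" for v
  let ?X = "End_vec U \<phi> V \<Phi> (p, K)"
  have "(p, J p) \<in> twistor_sub (\<lambda>_ _. True)"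
    using J(1) by (simp add: twistor_sub_def twistor_section_def)
  then have "fm.orth_complex (J_mat \<Phi> p)"
    using twistor_sub_coords[OF V J_End] by (simp add: J_mat_def twistor_mat_def fm.orth_complex_def)
  then have W: "subspace W"
    unfolding W_def using twistor_sub_coords[OF V KE] K by (intro fm.velocities_subspace) auto
  have h: "linear h"
  proof -
    note lin = conn_mat_chart_linear[OF V U]
    show ?thesis
      unfolding h_def by (rule linearI) (simp_all add: linear_add[OF lin] linear_scale[OF lin] matrix_ring algebra_simps)
  qed
  have C: "(End_dom U V, End_chart \<phi> \<Phi>) \<in> End_atlas \<A> E \<B>" "(p, K) \<in> End_dom U V"
    using End_chart_in_atlas[OF U(1) V(1)] KE U V by (auto simp: End_dom_def)
  have X_lin: "(\<lambda>f. a * ?X x f + b * ?X y f) = ?X (a *\<^sub>R x + b *\<^sub>R y)" for a b x y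
    by (simp add: End.chart_vec_linear[OF C])
  have X_inj: "?X x = ?X y \<Longrightarrow> x = y" for x y by (rule End.chart_vec_inj[OF C])
  have X_0: "?X 0 = (\<lambda>f. 0)" by (rule End.chart_vec_0[OF C])
  have T: "tangent_space (End_atlas \<A> E \<B>) (twistor_sub (kernel_cond \<alpha> \<beta> m m')) (p, K) =
      {?X (v, A + h v) | v A. A \<in> W}"
    unfolding tangent_space_twistor_sub[OF V U K] h_def W_def ..
  have Ve: "vertical_space \<A> E \<B> (twistor_sub (kernel_cond \<alpha> \<beta> m m')) (p, K) = {?X (0, A) | A. A \<in> W}"
    unfolding vertical_space_twistor_sub[OF V U K] W_def ..
  have H: "horizontal_space \<A> E \<B> D (p, K) = range (\<lambda>v. ?X (v, h v))"
    unfolding horizontal_space_twistor_sub[OF V U K] h_def by blast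
  show ?thesis
    unfolding is_direct_sum_def T Ve H
  proof (intro conjI)
    show "tvec_subspace {?X (0, A) | A. A \<in> W}"
      unfolding tvec_subspace_def
    proof (intro conjI ballI allI)
      show "(\<lambda>f. 0) \<in> {?X (0, A) | A. A \<in> W}"
        using X_0 subspace_0[OF W] by (intro CollectI exI[of _ 0]) (simp add: zero_prod_def)
      fix Y Z a b assume "Y \<in> {?X (0, A) | A. A \<in> W}" "Z \<in> {?X (0, A) | A. A \<in> W}"
      then obtain A B where "Y = ?X (0, A)" "Z = ?X (0, B)" "A \<in> W" "B \<in> W" by blast
      then show "(\<lambda>f. a * Y f + b * Z f) \<in> {?X (0, A) | A. A \<in> W}"
        using subspace_add[OF W subspace_scale[OF W] subspace_scale[OF W]] by (auto simp: X_lin)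
    qed
    show "tvec_subspace (range (\<lambda>v. ?X (v, h v)))"
      unfolding tvec_subspace_def
    proof (intro conjI ballI allI)
      show "(\<lambda>f. 0) \<in> range (\<lambda>v. ?X (v, h v))"
        using X_0 linear_0[OF h] by (intro range_eqI[of _ _ 0]) (simp add: zero_prod_def)
      fix Y Z a b assume "Y \<in> range (\<lambda>v. ?X (v, h v))" "Z \<in> range (\<lambda>v. ?X (v, h v))"
      then obtain v w where "Y = ?X (v, h v)" "Z = ?X (w, h w)" by blast
      then show "(\<lambda>f. a * Y f + b * Z f) \<in> range (\<lambda>v. ?X (v, h v))"
        by (intro range_eqI[of _ _ "a *\<^sub>R v + b *\<^sub>R w"]) (simp add: X_lin linear_add[OF h] linear_scale[OF h])
    qed
    show "{?X (0, A) | A. A \<in> W} \<inter> range (\<lambda>v. ?X (v, h v)) = {\<lambda>f. 0}"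
    proof
      show "{?X (0, A) | A. A \<in> W} \<inter> range (\<lambda>v. ?X (v, h v)) \<subseteq> {\<lambda>f. 0}"
      proof
        fix Y assume "Y \<in> {?X (0, A) | A. A \<in> W} \<inter> range (\<lambda>v. ?X (v, h v))"
        then obtain A v where Y: "Y = ?X (0, A)" "Y = ?X (v, h v)" by blast
        then have "?X (0, A) = ?X (v, h v)" by simp
        then have "(0, A) = (v, h v)" by (rule X_inj)
        then have "(v, h v) = 0" using linear_0[OF h] by (auto simp: zero_prod_def)
        then show "Y \<in> {\<lambda>f. 0}" using X_0 Y(2) by simp
      qed
      show "{\<lambda>f. 0} \<subseteq> {?X (0, A) | A. A \<in> W} \<inter> range (\<lambda>v. ?X (v, h v))"
        using X_0 subspace_0[OF W] linear_0[OF h]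
        by (auto simp: zero_prod_def intro!: exI[of _ 0] range_eqI[of _ _ 0])
    qed
    have sum: "(\<lambda>f. ?X (0, A) f + ?X (v, h v) f) = ?X (v, A + h v)" for A v
      using X_lin[of 1 "(0, A)" 1 "(v, h v)"] by simp
    show "{?X (v, A + h v) | v A. A \<in> W} =
        {\<lambda>f. X f + Y f | X Y. X \<in> {?X (0, A) | A. A \<in> W} \<and> Y \<in> range (\<lambda>v. ?X (v, h v))}"
      unfolding sum[symmetric] by blast
  qed
qed

end

theorem proposition6p34:
  fixes \<A> :: "('m::{t2_space, second_countable_topology}, complex^'d) atlas"
    and E :: "'m \<Rightarrow> 'v::real_vector set"
    and \<B> :: "('m, 'v, 'k::finite) trivs"
    and g :: "'m \<Rightarrow> 'v \<Rightarrow> 'v \<Rightarrow> real"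
    and D :: "('m, 'v) conn"
    and J :: "'m \<Rightarrow> 'v \<Rightarrow> 'v"
    and n m\<^sub>1 m\<^sub>2 :: nat
    and S :: "('m \<times> ('v \<Rightarrow> 'v)) set"
    and K :: "'m \<times> ('v \<Rightarrow> 'v)"
  assumes "complex_manifold \<A>"
    and "vector_bundle \<A> E \<B>" and "CARD('k) = 2 * n"
    and "bundle_metric \<A> E \<B> g"
    and "metric_connection \<A> E \<B> g D"
    and "curvature_type_11 \<A> E \<B> D"
    and "twistor_section \<A> E \<B> g J" and "parallel_End \<A> E \<B> D J"
    and "S \<in> {twistor_plus E g J m\<^sub>1, twistor_minus E g J m\<^sub>2,
               twistor_plus E g J m\<^sub>1 \<inter> twistor_minus E g J m\<^sub>2}"
    and "K \<in> S"
  shows "is_direct_sum (tangent_space (End_atlas \<A> E \<B>) S K)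
           (vertical_space \<A> E \<B> S K) (horizontal_space \<A> E \<B> D K)"
proof -
  interpret twistor_bundle \<A> E \<B> D g J
  proof (intro twistor_bundle.intro bundle_with_connection.intro smooth_vector_bundle.intro)
    show "smooth_atlas \<A>" by (rule complex_manifold_smooth_atlas(1)[OF assms(1)])
    show "smooth_vector_bundle_axioms \<A> E \<B>"
      using complex_manifold_smooth_atlas(2-4)[OF assms(1)] assms(2) by unfold_locales
    show "bundle_with_connection_axioms \<A> E \<B> D"
      using assms(5) by unfold_locales (simp add: metric_connection_def)
    show "twistor_bundle_axioms \<A> E \<B> D g J"
      using assms(4,5,7,8) by unfold_locales
  qed
  obtain p A where K: "K = (p, A)" by fastforce
  have "twistor_plus E g J m\<^sub>1 = twistor_sub (kernel_cond True False (2 * m\<^sub>1) 0)"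
    "twistor_minus E g J m\<^sub>2 = twistor_sub (kernel_cond False True 0 (2 * m\<^sub>2))"
    "twistor_plus E g J m\<^sub>1 \<inter> twistor_minus E g J m\<^sub>2 = twistor_sub (kernel_cond True True (2 * m\<^sub>1) (2 * m\<^sub>2))"
    by (auto simp: twistor_plus_def twistor_minus_def twistor_sub_def kernel_cond_def)
  with assms(9) obtain \<alpha> \<beta> m m' where "S = twistor_sub (kernel_cond \<alpha> \<beta> m m')" by auto
  then show ?thesis using twistor_sub_direct_sum assms(10) K by blast
qed

end
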